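(* Let $\mathcal{H}$ be a regular unitarily invariant complete Pick space of holomorphic functions on $\mathbb{B}_d$. For a compact set $E \subset \partial\mathbb{B}_d$, the following assertions are equivalent: (i) $\operatorname{cap}_{\mathcal{H}}(E) = 0$; (ii) $E$ is an unboundedness set for $\mathcal{H}$, i.e. there exists $f \in \mathcal{H}$ with $\lim_{r \nearrow 1} |f(r\zeta)| = \infty$ for all $\zeta \in E$; (iii) $E$ is $\operatorname{Mult}(\mathcal{H})$-totally null.
   Context: $\mathbb{B}_d$ is the open Euclidean unit ball of $\mathbb{C}^d$ ($d \ge 1$), with boundary sphere $\partial\mathbb{B}_d$. A regular unitarily invariant space of holomorphic functions on $\mathbb{B}_d$ is a reproducing kernel Hilbert space $\mathcal{H}$ on $\mathbb{B}_d$ with kernel $K(z,w) = \sum_{n=0}^\infty a_n\langle z,w\rangle^n$, where $a_n > 0$ for all $n \ge 0$, $a_0 = 1$ and $\lim_{n\to\infty} a_n/a_{n+1} = 1$. It is a complete Pick space if $K$ does not vanish on $\mathbb{B}_d\times\mathbb{B}_d$ and the function $1 - \frac{1}{K}$ is positive semi-definite. $\operatorname{Mult}(\mathcal{H})$ is the multiplier algebra of $\mathcal{H}$ with the multiplication operator norm; it contains the polynomials. The $\mathcal{H}$-energy of a Borel probability measure $\mu$ on $\partial\mathbb{B}_d$ is $\mathcal{E}(\mu) = \sup_{0 \le r < 1} \int\int K(rz,rw)\, d\mu(w)\, d\mu(z) \in [0,\infty]$ (the double integrals are non-negative reals, increasing in $r$). For compact $E \subset \partial\mathbb{B}_d$,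 $\operatorname{cap}_{\mathcal{H}}(E) = \sup\{1/\mathcal{E}(\mu) : \mu$ a Borel probability measure supported on $E\}$ (with $1/\infty = 0$ and $\operatorname{cap}(\emptyset) = 0$). A complex Borel measure $\mu$ on $\partial\mathbb{B}_d$ is $\operatorname{Mult}(\mathcal{H})$-Henkin if for every sequence $(p_n)$ of polynomials with $\sup_n \|p_n\|_{\operatorname{Mult}(\mathcal{H})} < \infty$ and $\lim_n p_n(z) = 0$ for all $z \in \mathbb{B}_d$, one has $\lim_n \int_{\partial\mathbb{B}_d} p_n\, d\mu = 0$. A Borel set $E \subset \partial\mathbb{B}_d$ is $\operatorname{Mult}(\mathcal{H})$-totally null if $|\mu|(E) = 0$ for every $\operatorname{Mult}(\mathcal{H})$-Henkin measure $\mu$. *)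

theory Defs
  imports "HOL-Probability.Probability_Measure"
begin

text \<open>
  A function on a set \<open>X\<close> is represented by the total function that vanishes off \<open>X\<close>. A Hilbert
  space of such functions is given by its carrier \<open>H\<close> and its inner product \<open>ip\<close>, which is linear
  in the first argument.
\<close>

definition hnorm :: "(('a \<Rightarrow> complex) \<Rightarrow> ('a \<Rightarrow> complex) \<Rightarrow> complex) \<Rightarrow> ('a \<Rightarrow> complex) \<Rightarrow> real" where
  "hnorm ip f = sqrt (Re (ip f f))"

locale rkhs =
  fixes X :: "'a set"
    and H :: "('a \<Rightarrow> complex) set"
    and ip :: "('a \<Rightarrow> complex) \<Rightarrow> ('a \<Rightarrow> complex) \<Rightarrow> complex"
    and K :: "'a \<Rightarrow> 'a \<Rightarrow> complex"
  assumes vanishes_off: "\<And>f x. f \<in> H \<Longrightarrow> x \<notin> X \<Longrightarrow> f x = 0"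
    and zero_mem: "(\<lambda>x. 0) \<in> H"
    and add_mem: "\<And>f g. f \<in> H \<Longrightarrow> g \<in> H \<Longrightarrow> (\<lambda>x. f x + g x) \<in> H"
    and scale_mem: "\<And>c f. f \<in> H \<Longrightarrow> (\<lambda>x. c * f x) \<in> H"
    and ip_add: "\<And>f g h. f \<in> H \<Longrightarrow> g \<in> H \<Longrightarrow> h \<in> H \<Longrightarrow>
                  ip (\<lambda>x. f x + g x) h = ip f h + ip g h"
    and ip_scale: "\<And>c f h. f \<in> H \<Longrightarrow> h \<in> H \<Longrightarrow> ip (\<lambda>x. c * f x) h = c * ip f h"
    and ip_cnj: "\<And>f g. f \<in> H \<Longrightarrow> g \<in> H \<Longrightarrow> ip g f = cnj (ip f g)"
    and ip_pos: "\<And>f. f \<in> H \<Longrightarrow> f \<noteq> (\<lambda>x. 0) \<Longrightarrow> Re (ip f f) > 0"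
    and complete: "\<And>F. (\<And>n::nat. F n \<in> H) \<Longrightarrow>
                  (\<forall>e>0. \<exists>N. \<forall>m\<ge>N. \<forall>n\<ge>N. hnorm ip (\<lambda>x. F m x - F n x) < e) \<Longrightarrow>
                  \<exists>f\<in>H. (\<lambda>n. hnorm ip (\<lambda>x. F n x - f x)) \<longlonglongrightarrow> 0"
    and kernel_mem: "\<And>y. y \<in> X \<Longrightarrow> (\<lambda>x. if x \<in> X then K x y else 0) \<in> H"
    and reproducing: "\<And>f y. f \<in> H \<Longrightarrow> y \<in> X \<Longrightarrow>
                  ip f (\<lambda>x. if x \<in> X then K x y else 0) = f y"

definition psd_kernel :: "'a set \<Rightarrow> ('a \<Rightarrow> 'a \<Rightarrow> complex) \<Rightarrow> bool" where
  "psd_kernel X k \<longleftrightarrow>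
     (\<forall>F c. finite F \<and> F \<subseteq> X \<longrightarrow> (\<Sum>x\<in>F. \<Sum>y\<in>F. cnj (c x) * c y * k x y) \<in> \<real>\<^sub>\<ge>\<^sub>0)"

definition complete_pick_kernel :: "'a set \<Rightarrow> ('a \<Rightarrow> 'a \<Rightarrow> complex) \<Rightarrow> bool" where
  "complete_pick_kernel X K \<longleftrightarrow>
     (\<forall>x\<in>X. \<forall>y\<in>X. K x y \<noteq> 0) \<and> psd_kernel X (\<lambda>x y. 1 - 1 / K x y)"

definition multipliers :: "('a \<Rightarrow> complex) set \<Rightarrow> ('a \<Rightarrow> complex) set" where
  "multipliers H = {\<phi>. \<forall>f\<in>H. (\<lambda>x. \<phi> x * f x) \<in> H}"

text \<open>The operator norm of multiplication by \<open>\<phi>\<close>, with value \<open>\<infinity>\<close> if \<open>\<phi>\<close> is not a multiplier.\<close>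

definition mult_norm ::
  "('a \<Rightarrow> complex) set \<Rightarrow> (('a \<Rightarrow> complex) \<Rightarrow> ('a \<Rightarrow> complex) \<Rightarrow> complex) \<Rightarrow> ('a \<Rightarrow> complex) \<Rightarrow> ennreal"
  where
  "mult_norm H ip \<phi> =
     (if \<phi> \<in> multipliers H
      then (SUP f\<in>{f \<in> H. hnorm ip f \<le> 1}. ennreal (hnorm ip (\<lambda>x. \<phi> x * f x)))
      else \<infinity>)"

definition cinner_prod :: "complex ^ 'd \<Rightarrow> complex ^ 'd \<Rightarrow> complex" where
  "cinner_prod z w = (\<Sum>i\<in>UNIV. z $ i * cnj (w $ i))"

definition power_kernel :: "(nat \<Rightarrow> real) \<Rightarrow> complex ^ 'd \<Rightarrow> complex ^ 'd \<Rightarrow> complex" where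
  "power_kernel a z w = (\<Sum>n. complex_of_real (a n) * cinner_prod z w ^ n)"

locale regular_unitarily_invariant_space = rkhs "ball 0 1" H ip "power_kernel a"
  for a :: "nat \<Rightarrow> real"
    and H :: "(complex ^ 'd \<Rightarrow> complex) set"
    and ip :: "(complex ^ 'd \<Rightarrow> complex) \<Rightarrow> (complex ^ 'd \<Rightarrow> complex) \<Rightarrow> complex" +
  assumes coeff_pos: "\<And>n. a n > 0"
    and coeff_0: "a 0 = 1"
    and coeff_ratio: "(\<lambda>n. a n / a (Suc n)) \<longlonglongrightarrow> 1"

definition unboundedness_set ::
  "(complex ^ 'd \<Rightarrow> complex) set \<Rightarrow> (complex ^ 'd) set \<Rightarrow> bool" where
  "unboundedness_set H E \<longleftrightarrow>
     (\<exists>f\<in>H. \<forall>\<zeta>\<in>E. filterlim (\<lambda>r. cmod (f (r *\<^sub>R \<zeta>))) at_top (at_left 1))"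

abbreviation borel_sphere :: "(complex ^ 'd) measure" where
  "borel_sphere \<equiv> restrict_space borel (sphere 0 1)"

text \<open>
  The double integrals are non-negative reals, so taking real parts loses nothing.
\<close>

definition energy :: "(nat \<Rightarrow> real) \<Rightarrow> (complex ^ 'd) measure \<Rightarrow> ennreal" where
  "energy a \<mu> =
     (SUP r\<in>{0..<1::real}.
        ennreal (Re (\<integral>z. (\<integral>w. power_kernel a (r *\<^sub>R z) (r *\<^sub>R w) \<partial>\<mu>) \<partial>\<mu>)))"

text \<open>In \<^typ>\<open>ennreal\<close>, \<open>1 / \<infinity> = 0\<close> and the supremum of the empty set is \<open>0\<close>.\<close>

definition capacity :: "(nat \<Rightarrow> real) \<Rightarrow> (complex ^ 'd) set \<Rightarrow> ennreal" where
  "capacity a E =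
     (SUP \<mu>\<in>{\<mu>. prob_space \<mu> \<and> sets \<mu> = sets borel_sphere \<and> emeasure \<mu> (sphere 0 1 - E) = 0}.
        1 / energy a \<mu>)"

text \<open>
  A complex measure is a countably additive set function on the \<open>\<sigma>\<close>-algebra of \<open>M\<close>; the measure
  carried by \<open>M\<close> itself and the values of \<open>\<nu>\<close> on non-measurable sets play no role.
\<close>

definition complex_measure :: "'a measure \<Rightarrow> ('a set \<Rightarrow> complex) \<Rightarrow> bool" where
  "complex_measure M \<nu> \<longleftrightarrow>
     (\<forall>A::nat \<Rightarrow> 'a set. range A \<subseteq> sets M \<longrightarrow> disjoint_family A \<longrightarrow>
        (\<lambda>n. \<nu> (A n)) sums \<nu> (\<Union>n. A n))"

definition total_variation :: "'a measure \<Rightarrow> ('a set \<Rightarrow> complex) \<Rightarrow> 'a set \<Rightarrow> ennreal" where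
  "total_variation M \<nu> E =
     (SUP A\<in>{A::nat \<Rightarrow> 'a set. range A \<subseteq> sets M \<and> disjoint_family A \<and> (\<Union>n. A n) = E}.
        \<Sum>n. ennreal (cmod (\<nu> (A n))))"

text \<open>
  The positive part of the Jordan decomposition of a finite signed measure \<open>\<rho>\<close>, given by
  \<open>\<rho>\<^sup>+(A) = sup {\<rho>(B) | B \<subseteq> A}\<close>. Negative values of \<open>\<rho>\<close> are truncated to \<open>0 = \<rho>({})\<close> by
  \<^const>\<open>ennreal\<close>, which does not change the supremum.
\<close>

definition positive_part :: "'a measure \<Rightarrow> ('a set \<Rightarrow> real) \<Rightarrow> 'a measure" where
  "positive_part M \<rho> =
     measure_of (space M) (sets M) (\<lambda>A. SUP B\<in>{B \<in> sets M. B \<subseteq> A}. ennreal (\<rho> B))"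

definition complex_measure_integral ::
  "'a measure \<Rightarrow> ('a set \<Rightarrow> complex) \<Rightarrow> ('a \<Rightarrow> complex) \<Rightarrow> complex" where
  "complex_measure_integral M \<nu> f =
     (\<integral>x. f x \<partial>positive_part M (\<lambda>A. Re (\<nu> A))) - (\<integral>x. f x \<partial>positive_part M (\<lambda>A. - Re (\<nu> A)))
     + \<i> * ((\<integral>x. f x \<partial>positive_part M (\<lambda>A. Im (\<nu> A))) - (\<integral>x. f x \<partial>positive_part M (\<lambda>A. - Im (\<nu> A))))"

text \<open>Polynomials in \<open>z\<^sub>1, \<dots>, z\<^sub>d\<close>, as functions; monomials are indexed by multi-indices \<open>\<alpha>\<close>.\<close>

definition polynomial_fun :: "(complex ^ 'd \<Rightarrow> complex) \<Rightarrow> bool" where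
  "polynomial_fun p \<longleftrightarrow>
     (\<exists>(S :: ('d \<Rightarrow> nat) set) c. finite S \<and> p = (\<lambda>z. \<Sum>\<alpha>\<in>S. c \<alpha> * (\<Prod>i\<in>UNIV. z $ i ^ \<alpha> i)))"

definition henkin_measure ::
  "(complex ^ 'd \<Rightarrow> complex) set \<Rightarrow>
   ((complex ^ 'd \<Rightarrow> complex) \<Rightarrow> (complex ^ 'd \<Rightarrow> complex) \<Rightarrow> complex) \<Rightarrow>
   ((complex ^ 'd) set \<Rightarrow> complex) \<Rightarrow> bool" where
  "henkin_measure H ip \<nu> \<longleftrightarrow>
     complex_measure borel_sphere \<nu> \<and>
     (\<forall>p :: nat \<Rightarrow> complex ^ 'd \<Rightarrow> complex.
        (\<forall>n. polynomial_fun (p n)) \<longrightarrow>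
        (SUP n. mult_norm H ip (p n)) < \<infinity> \<longrightarrow>
        (\<forall>z\<in>ball 0 1. (\<lambda>n. p n z) \<longlonglongrightarrow> 0) \<longrightarrow>
        (\<lambda>n. complex_measure_integral borel_sphere \<nu> (p n)) \<longlonglongrightarrow> 0)"

definition totally_null ::
  "(complex ^ 'd \<Rightarrow> complex) set \<Rightarrow>
   ((complex ^ 'd \<Rightarrow> complex) \<Rightarrow> (complex ^ 'd \<Rightarrow> complex) \<Rightarrow> complex) \<Rightarrow>
   (complex ^ 'd) set \<Rightarrow> bool" where
  "totally_null H ip E \<longleftrightarrow>
     (\<forall>\<nu>. henkin_measure H ip \<nu> \<longrightarrow> total_variation borel_sphere \<nu> E = 0)"

end

theory Submission
  imports Defs "HOL-Probability.Probability" "HOL-Computational_Algebra.Formal_Power_Series"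
begin

text \<open>
  Write \<open>K = 1 / (1 - B)\<close>, where \<open>B = \<Sum>n. b n * \<langle>z, w\<rangle>\<^sup>n\<close> with \<open>b n \<ge> 0\<close> by the complete Pick property.
  A bound \<open>c\<close> on a multiplier \<open>\<phi>\<close> means that \<open>K(z, w) (c\<^sup>2 - \<phi>(z) \<phi>(w)\<^sup>*)\<close> is positive semi-definite,
  and all estimates on multipliers are made in this form.

  If every measure on \<open>E\<close> has infinite energy, then by weak compactness the norms of the potentials of
  finitely supported probability measures on \<open>r E\<close> are uniformly large for some \<open>r < 1\<close>. A combination
  of almost minimal norm has, after normalization, a potential \<open>g\<close> with \<open>\<parallel>g\<parallel> \<le> 1\<close>, \<open>Re g \<ge> 0\<close>, \<open>Re g\<close>
  large on \<open>E\<close> and \<open>g\<close> small away from \<open>E\<close>. Summing such functions gives a function unbounded on \<open>E\<close>.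
  As \<open>g\<close> acts accretively by multiplication, the functions \<open>1 - 1 / (1 + g)\<close> are bounded multipliers
  which tend to \<open>1\<close> on \<open>E\<close> and to \<open>0\<close> elsewhere on the closed ball, so Henkin measures do not charge
  \<open>E\<close>; the same applies to compact subsets of \<open>E\<close>.

  Conversely, for a measure \<open>\<mu>\<close> of finite energy, \<open>\<integral> h(s z) d\<mu>\<close> converges as \<open>s \<rightarrow> 1\<close>, uniformly for \<open>h\<close> in the
  unit ball of \<open>H\<close>. Hence \<open>\<mu>\<close> is Henkin. If \<open>f \<in> H\<close> were unbounded on the support of \<open>\<mu>\<close>, let \<open>V\<close> be
  the Sarason function of \<open>f\<close>, so that \<open>Re V \<ge> \<bar>f\<bar>\<^sup>2\<close> and \<open>h = 1 / (1 + \<epsilon> V)\<close> is in the unit ball of \<open>H\<close>: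
  letting \<open>s \<rightarrow> 1\<close> makes the integral \<open>0\<close>, letting \<open>\<epsilon> \<rightarrow> 0\<close> first makes it \<open>1\<close>.
\<close>

text \<open>The normalization is a matter of scaling. If \<open>T\<close> is the almost minimal
  norm, the potential has real part at least \<open>T\<^sup>2 - 1\<close> on \<open>E\<close>.
  Division by \<open>T\<close> makes the norm at most 1, keeps a real part of order \<open>T\<close>
  on \<open>E\<close> and reduces the total mass to \<open>1 / T\<close>. As
  \<open>b 1 = a 1 > 0\<close> and the \<open>b n\<close> sum to at most 1, the kernel satisfies
  \<open>cmod (K z w) \<le> 1 / (a 1 * (1 - Re (cinner_prod z w)))\<close>; hence a small total mass
  gives a small potential at every point away from \<open>E\<close>. Almost minimal finite
  combinations take the place of an equilibrium measure: their potentials are finite sums of kernel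
  functions, hence continuous up to the sphere and limits of polynomials in the multiplier norm, and
  Henkin measures are tested on polynomials. Accretivity comes from
  \<open>kf x = 1 / (1 - Bk z x)\<close> with a contractive \<open>Bk\<close>. Being a linear
  condition, it passes from single kernel functions to their positive combinations.\<close>

section \<open>Positive semi-definite kernels\<close>

text \<open>The index type is arbitrary, since kernels are also evaluated along families of points,
  which may repeat a point or be indexed by a disjoint sum as in \<open>qform_Plus\<close>.\<close>

definition qform :: "'i set \<Rightarrow> ('i \<Rightarrow> complex) \<Rightarrow> ('i \<Rightarrow> 'i \<Rightarrow> complex) \<Rightarrow> complex" where
  "qform I c k = (\<Sum>x\<in>I. \<Sum>y\<in>I. cnj (c x) * c y * k x y)"

lemma psd_kernel_iff_qform:
  "psd_kernel X k \<longleftrightarrow> (\<forall>F c. finite F \<and> F \<subseteq> X \<longrightarrow> qform F c k \<in> \<real>\<^sub>\<ge>\<^sub>0)"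
  by (simp add: psd_kernel_def qform_def)

lemma psd_qform: "psd_kernel X k \<Longrightarrow> finite F \<Longrightarrow> F \<subseteq> X \<Longrightarrow> qform F c k \<in> \<real>\<^sub>\<ge>\<^sub>0"
  by (simp add: psd_kernel_iff_qform)

lemma psd_kernelI: "(\<And>F c. finite F \<Longrightarrow> F \<subseteq> X \<Longrightarrow> qform F c k \<in> \<real>\<^sub>\<ge>\<^sub>0) \<Longrightarrow> psd_kernel X k"
  by (simp add: psd_kernel_iff_qform)

lemma qform_cong:
  assumes "\<And>x y. x \<in> I \<Longrightarrow> y \<in> I \<Longrightarrow> k x y = k' x y"
  shows "qform I c k = qform I c k'"
  unfolding qform_def by (intro sum.cong refl) (simp add: assms)

lemma qform_add: "qform I c (\<lambda>x y. k x y + l x y) = qform I c k + qform I c l"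
  by (simp add: qform_def sum.distrib distrib_left)

lemma qform_scale: "qform I c (\<lambda>x y. t * k x y) = t * qform I c k"
  by (simp add: qform_def sum_distrib_left mult_ac)

lemma qform_diff: "qform I c (\<lambda>x y. k x y - l x y) = qform I c k - qform I c l"
  by (simp add: qform_def sum_subtractf right_diff_distrib)

lemma qform_congruence:
  "qform I c (\<lambda>x y. f x * cnj (f y) * k x y) = qform I (\<lambda>x. c x * cnj (f x)) k"
  by (simp add: qform_def mult_ac)

lemma qform_rank1:
  "qform I c (\<lambda>x y. f x * cnj (f y)) = (\<Sum>x\<in>I. cnj (c x) * f x) * cnj (\<Sum>x\<in>I. cnj (c x) * f x)"
  unfolding qform_def cnj_sum sum_product by (intro sum.cong refl) (simp add: mult_ac)

lemma psd_subset: "psd_kernel X k \<Longrightarrow> Y \<subseteq> X \<Longrightarrow> psd_kernel Y k"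
  by (meson psd_kernel_iff_qform subset_trans)

lemma psd_cong:
  assumes "\<And>x y. x \<in> X \<Longrightarrow> y \<in> X \<Longrightarrow> k x y = k' x y"
  shows "psd_kernel X k \<longleftrightarrow> psd_kernel X k'"
proof -
  have "qform F c k = qform F c k'" if "F \<subseteq> X" for F c
    using that assms by (intro qform_cong) auto
  then show ?thesis unfolding psd_kernel_iff_qform by auto
qed

lemma psd_cong_imp:
  assumes "psd_kernel X k" "\<And>x y. x \<in> X \<Longrightarrow> y \<in> X \<Longrightarrow> k' x y = k x y"
  shows "psd_kernel X k'"
  using psd_cong[of X k' k] assms by simp

lemma psd_add:
  "psd_kernel X k \<Longrightarrow> psd_kernel X l \<Longrightarrow> psd_kernel X (\<lambda>x y. k x y + l x y)"
  by (simp add: psd_kernel_iff_qform qform_add nonneg_Reals_add_I)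

lemma psd_scale:
  "psd_kernel X k \<Longrightarrow> t \<ge> 0 \<Longrightarrow> psd_kernel X (\<lambda>x y. complex_of_real t * k x y)"
  by (simp add: psd_kernel_iff_qform qform_scale nonneg_Reals_mult_I)

lemma psd_congruence: "psd_kernel X k \<Longrightarrow> psd_kernel X (\<lambda>x y. f x * cnj (f y) * k x y)"
  by (simp add: psd_kernel_iff_qform qform_congruence)

lemma psd_rank1: "psd_kernel X (\<lambda>x y. f x * cnj (f y))"
proof (rule psd_kernelI)
  fix F c assume "finite F" "F \<subseteq> X"
  show "qform F c (\<lambda>x y. f x * cnj (f y)) \<in> \<real>\<^sub>\<ge>\<^sub>0"
    unfolding qform_rank1 complex_mult_cnj by (simp del: of_real_add)
qed

lemma psd_zero: "psd_kernel X (\<lambda>x y. 0)"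
  using psd_rank1[of X "\<lambda>x. 0"] by simp

lemma psd_one: "psd_kernel X (\<lambda>x y. 1)"
  using psd_rank1[of X "\<lambda>x. 1"] by simp

lemma psd_sum:
  "(\<And>i. i \<in> I \<Longrightarrow> psd_kernel X (k i)) \<Longrightarrow> psd_kernel X (\<lambda>x y. \<Sum>i\<in>I. k i x y)"
  by (induction I rule: infinite_finite_induct) (auto simp: psd_zero intro: psd_add)

lemma psd_limit:
  fixes k :: "nat \<Rightarrow> 'a \<Rightarrow> 'a \<Rightarrow> complex"
  assumes "\<And>n. psd_kernel X (k n)"
    and "\<And>x y. x \<in> X \<Longrightarrow> y \<in> X \<Longrightarrow> (\<lambda>n. k n x y) \<longlonglongrightarrow> l x y"
  shows "psd_kernel X l"
proof (rule psd_kernelI)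
  fix F c assume F: "finite F" "F \<subseteq> X"
  have "(\<lambda>n. qform F c (k n)) \<longlonglongrightarrow> qform F c l"
    unfolding qform_def using F by (intro tendsto_sum tendsto_mult tendsto_const assms(2)) auto
  moreover have "\<And>n. qform F c (k n) \<in> \<real>\<^sub>\<ge>\<^sub>0"
    using psd_qform[OF assms(1) F] .
  ultimately show "qform F c l \<in> \<real>\<^sub>\<ge>\<^sub>0"
    by (rule closed_sequentially[OF closed_nonneg_Reals_complex, rotated])
qed

text \<open>Points may repeat in the family \<open>p\<close>.\<close>

lemma psd_family:
  assumes "psd_kernel X k" "finite I" "p ` I \<subseteq> X"
  shows "qform I c (\<lambda>i j. k (p i) (p j)) \<in> \<real>\<^sub>\<ge>\<^sub>0"
proof -
  define d where "d x = (\<Sum>i | i \<in> I \<and> p i = x. c i)" for x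
  have "qform I c (\<lambda>i j. k (p i) (p j)) =
     (\<Sum>x\<in>p ` I. \<Sum>i | i \<in> I \<and> p i = x. \<Sum>y\<in>p ` I. \<Sum>j | j \<in> I \<and> p j = y. cnj (c i) * c j * k (p i) (p j))"
    unfolding qform_def by (simp only: sum.image_gen[OF assms(2), of _ p, symmetric])
  also have "\<dots> = (\<Sum>x\<in>p ` I. \<Sum>i | i \<in> I \<and> p i = x. \<Sum>y\<in>p ` I. \<Sum>j | j \<in> I \<and> p j = y. cnj (c i) * c j * k x y)"
    by (intro sum.cong refl) auto
  also have "\<dots> = (\<Sum>x\<in>p ` I. \<Sum>y\<in>p ` I. \<Sum>i | i \<in> I \<and> p i = x. \<Sum>j | j \<in> I \<and> p j = y. cnj (c i) * c j * k x y)"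
    by (intro sum.cong refl sum.swap)
  also have "\<dots> = qform (p ` I) d k"
    unfolding qform_def d_def by (simp add: sum_product sum_distrib_left sum_distrib_right mult_ac)
  finally show ?thesis
    using psd_qform[OF assms(1), of "p ` I" d] assms by auto
qed

lemma psd_pullback:
  assumes "psd_kernel X k" "p ` Y \<subseteq> X"
  shows "psd_kernel Y (\<lambda>x y. k (p x) (p y))"
  using assms by (intro psd_kernelI psd_family[OF assms(1)]) auto

lemma psd_diag:
  assumes "psd_kernel X k" "x \<in> X"
  shows "k x x \<in> \<real>\<^sub>\<ge>\<^sub>0"
  using psd_qform[OF assms(1), of "{x}" "\<lambda>_. 1"] assms(2) by (simp add: qform_def)

text \<open>Over the complex numbers, reality of all quadratic forms forces Hermitian symmetry: test
  on two points with coefficients \<open>1, 1\<close> and \<open>1, \<i>\<close>.\<close>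

lemma psd_hermitian:
  assumes "psd_kernel X k" "x \<in> X" "y \<in> X"
  shows "k y x = cnj (k x y)"
proof (cases "x = y")
  case True
  then show ?thesis using psd_diag[OF assms(1,2)] by (simp add: complex_nonneg_Reals_iff complex_eq_iff)
next
  case False
  have d: "Im (k x x) = 0" "Im (k y y) = 0"
    using psd_diag[OF assms(1)] assms by (auto simp: complex_nonneg_Reals_iff)
  have "qform {x, y} (\<lambda>z. if z = x then 1 else t) k =
      k x x + cnj t * t * k y y + t * k x y + cnj t * k y x" for t
    using False by (simp add: qform_def algebra_simps)
  then have "Im (k x x + cnj t * t * k y y + t * k x y + cnj t * k y x) = 0" for t
    using psd_qform[OF assms(1), of "{x, y}" "\<lambda>z. if z = x then 1 else t"] assms(2,3)
    by (simp add: complex_nonneg_Reals_iff)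
  from this[of 1] this[of \<i>] d show ?thesis
    by (simp add: complex_eq_iff)
qed

text \<open>The common core of the Cauchy-Schwarz inequalities; with \<open>S = 0\<close> it also
  gives the first-order condition \<open>L = 0\<close> at a minimum, as in
  \<open>riesz_graph\<close>. For \<open>k > 0\<close> the minimizing \<open>t\<close> is
  \<open>- cnj L / k\<close>. For \<open>k \<le> 0\<close> the values along multiples of
  \<open>- cnj L\<close> tend to minus infinity unless \<open>L = 0\<close>.\<close>

lemma quadratic_discriminant_bound:
  fixes L :: complex
  assumes "\<And>t :: complex. S + 2 * Re (t * L) + (cmod t)\<^sup>2 * k \<ge> 0"
  shows "(cmod L)\<^sup>2 \<le> S * k"
proof (cases "k \<le> 0")
  case True
  have S: "S \<ge> 0" using assms[of 0] by simp
  have *: "0 \<le> S - 2 * s * (cmod L)\<^sup>2" if "s \<ge> 0" for s :: real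
  proof -
    have "Re (- of_real s * cnj L * L) = - s * (cmod L)\<^sup>2"
      unfolding cmod_power2 by (simp add: power2_eq_square algebra_simps)
    moreover have "(cmod (- of_real s * cnj L))\<^sup>2 * k \<le> 0" using True by (simp add: mult_nonneg_nonpos)
    ultimately show ?thesis using assms[of "- of_real s * cnj L"] by linarith
  qed
  have "L = 0"
  proof (rule ccontr)
    assume "L \<noteq> 0"
    then have "(cmod L)\<^sup>2 > 0" by simp
    then show False using *[of "(S + 1) / (2 * (cmod L)\<^sup>2)"] S by (simp add: field_simps)
  qed
  moreover have "0 \<le> S * k"
  proof (cases "k = 0")
    case False
    then have "k < 0" using True by simp
    moreover have "S + (cmod (of_real (sqrt ((S + 1) / - k))))\<^sup>2 * k \<ge> 0"
      using assms[of "of_real (sqrt ((S + 1) / - k))"] \<open>L = 0\<close> by simp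
    ultimately show ?thesis using S by (simp add: field_simps)
  qed simp
  ultimately show ?thesis by simp
next
  case False
  have "Re (- (cnj L / of_real k) * L) = - (cmod L)\<^sup>2 / k"
    using cmod_power2[of L] False by (simp add: power2_eq_square Re_divide_of_real field_simps)
  moreover have "(cmod (- (cnj L / of_real k)))\<^sup>2 * k = (cmod L)\<^sup>2 / k"
    using False by (simp add: norm_divide power2_eq_square)
  ultimately have "S - (cmod L)\<^sup>2 / k \<ge> 0" using assms[of "- (cnj L / of_real k)"] by linarith
  then show ?thesis using False by (simp add: field_simps)
qed

lemma qform_Plus:
  fixes k :: "'i + 'j \<Rightarrow> 'i + 'j \<Rightarrow> complex"
  assumes "finite I" "finite J"
  shows "qform (I <+> J) (case_sum d c) k =
    qform I d (\<lambda>i i'. k (Inl i) (Inl i')) + qform J c (\<lambda>j j'. k (Inr j) (Inr j'))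
     + (\<Sum>i\<in>I. \<Sum>j\<in>J. cnj (d i) * c j * k (Inl i) (Inr j))
     + (\<Sum>i\<in>I. \<Sum>j\<in>J. cnj (c j) * d i * k (Inr j) (Inl i))"
proof -
  have "(\<Sum>i\<in>I. \<Sum>j\<in>J. cnj (c j) * d i * k (Inr j) (Inl i)) =
        (\<Sum>j\<in>J. \<Sum>i\<in>I. cnj (c j) * d i * k (Inr j) (Inl i))" by (rule sum.swap)
  then show ?thesis
    using assms by (simp add: qform_def sum.Plus sum.distrib algebra_simps)
qed

text \<open>The two families are joined into one, indexed by the disjoint sum, with the second
  coefficients multiplied by \<open>t\<close>. Positivity for all \<open>t\<close> is then the
  hypothesis of \<open>quadratic_discriminant_bound\<close>.\<close>

lemma psd_Cauchy_Schwarz: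
  assumes k: "psd_kernel X k" and I: "finite I" "p ` I \<subseteq> X" and J: "finite J" "q ` J \<subseteq> X"
  shows "(cmod (\<Sum>i\<in>I. \<Sum>j\<in>J. cnj (d i) * c j * k (p i) (q j)))\<^sup>2 \<le>
     Re (qform I d (\<lambda>i i'. k (p i) (p i'))) * Re (qform J c (\<lambda>j j'. k (q j) (q j')))"
proof (rule quadratic_discriminant_bound)
  fix t :: complex
  define L where "L = (\<Sum>i\<in>I. \<Sum>j\<in>J. cnj (d i) * c j * k (p i) (q j))"
  define r where "r = case_sum p q"
  have "r ` (I <+> J) \<subseteq> X" using I J by (auto simp: r_def)
  then have "qform (I <+> J) (case_sum d (\<lambda>j. t * c j)) (\<lambda>i j. k (r i) (r j)) \<in> \<real>\<^sub>\<ge>\<^sub>0"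
    using I J by (intro psd_family[OF k]) auto
  moreover have "qform J (\<lambda>j. t * c j) (\<lambda>j j'. k (q j) (q j')) = cnj t * t * qform J c (\<lambda>j j'. k (q j) (q j'))"
    by (simp add: qform_def sum_distrib_left mult_ac)
  moreover have "(\<Sum>i\<in>I. \<Sum>j\<in>J. cnj (d i) * (t * c j) * k (p i) (q j)) = t * L"
    by (simp add: L_def sum_distrib_left mult_ac)
  moreover have "(\<Sum>i\<in>I. \<Sum>j\<in>J. cnj (t * c j) * d i * k (q j) (p i)) = cnj (t * L)"
    unfolding L_def cnj_sum sum_distrib_left
    using I J by (intro sum.cong refl) (simp add: psd_hermitian[OF k, of "p _" "q _"] image_subset_iff)
  ultimately have "(qform I d (\<lambda>i i'. k (p i) (p i')) + cnj t * t * qform J c (\<lambda>j j'. k (q j) (q j'))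
       + t * L + cnj (t * L)) \<in> \<real>\<^sub>\<ge>\<^sub>0"
    by (simp only: qform_Plus[OF I(1) J(1)] r_def sum.case)
  then have "0 \<le> Re (qform I d (\<lambda>i i'. k (p i) (p i')) + cnj t * t * qform J c (\<lambda>j j'. k (q j) (q j'))
       + t * L + cnj (t * L))"
    by (simp only: complex_nonneg_Reals_iff)
  moreover have "Re (cnj t * t * z) = (cmod t)\<^sup>2 * Re z" for z
    using cmod_power2[of t] by (simp add: power2_eq_square algebra_simps)
  moreover have "Re (t * L + cnj (t * L)) = 2 * Re (t * L)"
    by (simp only: complex_add_cnj Re_complex_of_real)
  ultimately show "0 \<le> Re (qform I d (\<lambda>i i'. k (p i) (p i'))) + 2 * Re (t * L) + (cmod t)\<^sup>2 * Re (qform J c (\<lambda>j j'. k (q j) (q j')))"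
    by (simp only: plus_complex.sel add.assoc)
qed

lemma qform_real: "psd_kernel X k \<Longrightarrow> finite F \<Longrightarrow> F \<subseteq> X \<Longrightarrow> qform F c k = of_real (Re (qform F c k))"
  using psd_qform[of X k F c] by (simp add: complex_nonneg_Reals_iff complex_eq_iff)

text \<open>Cauchy-Schwarz between a finite combination and the single point \<open>x0\<close>. The
  factor \<open>k x0 x0\<close> stands in front instead of in a denominator, so the diagonal value
  may be zero.\<close>

lemma psd_Schur_complement:
  assumes k: "psd_kernel X k" and x0: "x0 \<in> X"
  shows "psd_kernel X (\<lambda>z w. k x0 x0 * k z w - k z x0 * k x0 w)"
proof (rule psd_kernelI)
  fix F c assume F: "finite F" "F \<subseteq> X"
  define L where "L = (\<Sum>x\<in>F. cnj (c x) * k x x0)"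
  have L: "(cmod L)\<^sup>2 \<le> Re (qform F c k) * Re (k x0 x0)"
    using psd_Cauchy_Schwarz[OF k, of F "\<lambda>x. x" "{x0}" "\<lambda>x. x" c "\<lambda>_. 1"] F x0
    by (simp add: qform_def L_def)
  have d: "k x0 x0 = of_real (Re (k x0 x0))"
    using psd_diag[OF k x0] by (simp add: complex_nonneg_Reals_iff complex_eq_iff)
  have "qform F c (\<lambda>z w. k z x0 * k x0 w) = qform F c (\<lambda>z w. k z x0 * cnj (k w x0))"
    using F x0 by (intro qform_cong) (simp add: psd_hermitian[OF k, of _ x0] subsetD)
  also have "\<dots> = of_real ((cmod L)\<^sup>2)"
    unfolding qform_rank1 L_def[symmetric] by (simp only: complex_norm_square)
  finally have "qform F c (\<lambda>z w. k x0 x0 * k z w - k z x0 * k x0 w) =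
      of_real (Re (k x0 x0)) * of_real (Re (qform F c k)) - of_real ((cmod L)\<^sup>2)"
    by (simp add: qform_diff qform_scale d[symmetric] qform_real[OF k F, symmetric])
  also have "\<dots> = of_real (Re (qform F c k) * Re (k x0 x0) - (cmod L)\<^sup>2)" by simp
  finally show "qform F c (\<lambda>z w. k x0 x0 * k z w - k z x0 * k x0 w) \<in> \<real>\<^sub>\<ge>\<^sub>0"
    using L by (simp only: nonneg_Reals_of_real_iff diff_ge_0_iff_ge)
qed

lemma psd_zero_diag:
  assumes k: "psd_kernel X k" and "x \<in> X" "y \<in> X" "k x x = 0"
  shows "k x y = 0"
  using psd_Cauchy_Schwarz[OF k, of "{x}" "\<lambda>x. x" "{y}" "\<lambda>x. x" "\<lambda>_. 1" "\<lambda>_. 1"] assms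
  by (simp add: qform_def)

text \<open>The Schur product theorem, by removing one point at a time: subtracting from \<open>k\<close> its
  rank-one part through \<open>x0\<close> leaves a psd kernel that vanishes in the row and column of \<open>x0\<close>.\<close>

lemma psd_mult:
  assumes "psd_kernel X k" "psd_kernel X l"
  shows "psd_kernel X (\<lambda>x y. k x y * l x y)"
proof -
  have main: "psd_kernel F k \<Longrightarrow> psd_kernel F l \<Longrightarrow> qform F c (\<lambda>x y. k x y * l x y) \<in> \<real>\<^sub>\<ge>\<^sub>0"
    if "finite F" for F c and k :: "'a \<Rightarrow> 'a \<Rightarrow> complex"
    using that
  proof (induction F arbitrary: k rule: finite_induct)
    case empty
    then show ?case by (simp add: qform_def)
  next
    case (insert x0 F)
    define r where "r x y = k x x0 * k x0 y / k x0 x0" for x y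
    define k' where "k' x y = k x y - r x y" for x y
    have d: "k x0 x0 \<in> \<real>\<^sub>\<ge>\<^sub>0" "k x0 x0 = of_real (Re (k x0 x0))"
      using psd_diag[OF insert(4), of x0] by (auto simp: complex_nonneg_Reals_iff complex_eq_iff)
    have r: "psd_kernel (insert x0 F) (\<lambda>x y. r x y * l x y)"
    proof (rule psd_cong_imp)
      show "psd_kernel (insert x0 F) (\<lambda>x y. of_real (1 / Re (k x0 x0)) * (k x x0 * cnj (k y x0) * l x y))"
        using d(1) by (intro psd_scale psd_congruence insert) (simp add: complex_nonneg_Reals_iff)
      show "r x y * l x y = of_real (1 / Re (k x0 x0)) * (k x x0 * cnj (k y x0) * l x y)"
        if "x \<in> insert x0 F" "y \<in> insert x0 F" for x y
      proof -
        have "cnj (k y x0) = k x0 y" using psd_hermitian[OF insert(4), of y x0] that by simp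
        moreover have "of_real (1 / Re (k x0 x0)) = 1 / k x0 x0" using d(2) by (metis of_real_1 of_real_divide)
        ultimately show ?thesis by (simp add: r_def)
      qed
    qed
    have k': "psd_kernel (insert x0 F) k'"
    proof (cases "k x0 x0 = 0")
      \<comment> \<open>Division by zero makes \<open>r\<close> vanish here, so
        \<open>k' = k\<close>; the row of \<open>x0\<close> is then zero by
        \<open>psd_zero_diag\<close>.\<close>
      case True
      then show ?thesis using insert(4) by (simp add: k'_def[abs_def] r_def)
    next
      case False
      have "psd_kernel (insert x0 F) (\<lambda>z w. of_real (1 / Re (k x0 x0)) * (k x0 x0 * k z w - k z x0 * k x0 w))"
        using d(1) by (intro psd_scale psd_Schur_complement insert) (auto simp: complex_nonneg_Reals_iff)
      moreover have "of_real (1 / Re (k x0 x0)) * (k x0 x0 * k z w - k z x0 * k x0 w) = k' z w" for z w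
      proof -
        have "of_real (1 / Re (k x0 x0)) = 1 / k x0 x0" using d(2) by (metis of_real_1 of_real_divide)
        then show ?thesis using False by (simp add: k'_def r_def diff_divide_distrib)
      qed
      ultimately show ?thesis by simp
    qed
    have z: "k' x0 y = 0" "k' y x0 = 0" if "y \<in> insert x0 F" for y
    proof -
      have "k' x0 x0 = 0" by (simp add: k'_def r_def)
      from psd_zero_diag[OF k' _ that this] show "k' x0 y = 0" by simp
      then show "k' y x0 = 0" using psd_hermitian[OF k', of x0 y] that by simp
    qed
    have "qform (insert x0 F) c (\<lambda>x y. k' x y * l x y) = qform F c (\<lambda>x y. k' x y * l x y)"
      using insert(1,2) z by (simp add: qform_def)
    then have "qform (insert x0 F) c (\<lambda>x y. k' x y * l x y) \<in> \<real>\<^sub>\<ge>\<^sub>0"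
      using insert.IH[of k'] psd_subset[OF k'] psd_subset[OF insert(5)] by auto
    moreover have "qform (insert x0 F) c (\<lambda>x y. r x y * l x y) \<in> \<real>\<^sub>\<ge>\<^sub>0"
      using insert(1) by (intro psd_qform[OF r]) auto
    ultimately have "qform (insert x0 F) c (\<lambda>x y. k' x y * l x y + r x y * l x y) \<in> \<real>\<^sub>\<ge>\<^sub>0"
      by (simp add: qform_add nonneg_Reals_add_I)
    moreover have "k' x y * l x y + r x y * l x y = k x y * l x y" for x y
      by (simp add: k'_def algebra_simps)
    ultimately show ?case by simp
  qed
  show ?thesis
    using main psd_subset[OF assms(1)] psd_subset[OF assms(2)] by (intro psd_kernelI) blast
qed

lemma psd_power: "psd_kernel X k \<Longrightarrow> psd_kernel X (\<lambda>x y. k x y ^ n)"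
  by (induction n) (auto simp: psd_one psd_mult)

section \<open>Hilbert function spaces and multiplier bounds\<close>

context rkhs
begin

abbreviation hn :: "('a \<Rightarrow> complex) \<Rightarrow> real" where "hn \<equiv> hnorm ip"

definition kf :: "'a \<Rightarrow> 'a \<Rightarrow> complex" where
  "kf y = (\<lambda>x. if x \<in> X then K x y else 0)"

lemma kf_mem: "y \<in> X \<Longrightarrow> kf y \<in> H"
  using kernel_mem by (simp add: kf_def)

lemma ip_kf: "f \<in> H \<Longrightarrow> y \<in> X \<Longrightarrow> ip f (kf y) = f y"
  using reproducing by (simp add: kf_def)

lemma ip_kf_left: "f \<in> H \<Longrightarrow> y \<in> X \<Longrightarrow> ip (kf y) f = cnj (f y)"
  using ip_cnj[OF _ kf_mem, of f y] ip_kf by simp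

lemma kf_apply: "x \<in> X \<Longrightarrow> kf y x = K x y"
  by (simp add: kf_def)

lemma diff_mem: "f \<in> H \<Longrightarrow> g \<in> H \<Longrightarrow> (\<lambda>x. f x - g x) \<in> H"
  using add_mem[of f "\<lambda>x. (-1) * g x"] scale_mem[of g "-1"] by simp

lemma sum_mem: "(\<And>i. i \<in> I \<Longrightarrow> f i \<in> H) \<Longrightarrow> (\<lambda>x. \<Sum>i\<in>I. c i * f i x) \<in> H"
proof (induction I rule: infinite_finite_induct)
  case (insert j I)
  then have "(\<lambda>x. c j * f j x + (\<Sum>i\<in>I. c i * f i x)) \<in> H"
    by (intro add_mem[of "\<lambda>x. c j * f j x"] scale_mem) auto
  then show ?case using insert by simp
qed (simp_all add: zero_mem)

lemma ip_zero: "h \<in> H \<Longrightarrow> ip (\<lambda>x. 0) h = 0"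
  using ip_scale[of "\<lambda>x. 0" h 0] zero_mem by simp

lemma ip_diff: "f \<in> H \<Longrightarrow> g \<in> H \<Longrightarrow> h \<in> H \<Longrightarrow> ip (\<lambda>x. f x - g x) h = ip f h - ip g h"
  using ip_add[of f "\<lambda>x. (-1) * g x" h] scale_mem[of g "-1"] ip_scale[of g h "-1"] by simp

lemma ip_add_right:
  assumes "f \<in> H" "g \<in> H" "h \<in> H"
  shows "ip h (\<lambda>x. f x + g x) = ip h f + ip h g"
  using assms by (simp add: ip_cnj[of _ h] add_mem ip_add)

lemma ip_scale_right:
  assumes "f \<in> H" "h \<in> H"
  shows "ip h (\<lambda>x. c * f x) = cnj c * ip h f"
  using assms by (simp add: ip_cnj[of _ h] scale_mem ip_scale)

lemma ip_diff_right:
  assumes "f \<in> H" "g \<in> H" "h \<in> H"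
  shows "ip h (\<lambda>x. f x - g x) = ip h f - ip h g"
  using assms by (simp add: ip_cnj[of _ h] diff_mem ip_diff)

lemma ip_sum:
  "(\<And>i. i \<in> I \<Longrightarrow> f i \<in> H) \<Longrightarrow> h \<in> H \<Longrightarrow>
    ip (\<lambda>x. \<Sum>i\<in>I. c i * f i x) h = (\<Sum>i\<in>I. c i * ip (f i) h)"
proof (induction I rule: infinite_finite_induct)
  case (insert j I)
  have "ip (\<lambda>x. c j * f j x + (\<Sum>i\<in>I. c i * f i x)) h = ip (\<lambda>x. c j * f j x) h + ip (\<lambda>x. \<Sum>i\<in>I. c i * f i x) h"
    using insert by (intro ip_add scale_mem sum_mem) auto
  then show ?case using insert by (simp add: ip_scale)
qed (simp_all add: ip_zero)

lemma ip_sum_right: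
  assumes "\<And>i. i \<in> I \<Longrightarrow> f i \<in> H" "h \<in> H"
  shows "ip h (\<lambda>x. \<Sum>i\<in>I. c i * f i x) = (\<Sum>i\<in>I. cnj (c i) * ip h (f i))"
proof -
  have "ip h (\<lambda>x. \<Sum>i\<in>I. c i * f i x) = cnj (\<Sum>i\<in>I. c i * ip (f i) h)"
    using assms by (simp add: ip_cnj[of _ h] sum_mem ip_sum)
  also have "\<dots> = (\<Sum>i\<in>I. cnj (c i) * ip h (f i))"
    unfolding cnj_sum using assms by (intro sum.cong) (simp_all add: ip_cnj[of _ h])
  finally show ?thesis .
qed

lemma ip_self:
  assumes "f \<in> H"
  shows "Re (ip f f) = (hn f)\<^sup>2" "ip f f = of_real ((hn f)\<^sup>2)" "hn f \<ge> 0"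
proof -
  have nn: "Re (ip f f) \<ge> 0"
    using ip_pos[OF assms] ip_zero[OF zero_mem] by (cases "f = (\<lambda>x. 0)") auto
  then show "hn f \<ge> 0" by (simp add: hnorm_def)
  show *: "Re (ip f f) = (hn f)\<^sup>2" using nn by (simp add: hnorm_def)
  show "ip f f = of_real ((hn f)\<^sup>2)"
    using ip_cnj[OF assms assms] * by (simp add: complex_eq_iff)
qed

lemma hn_nonneg: "f \<in> H \<Longrightarrow> hn f \<ge> 0"
  by (rule ip_self(3))

lemma hn_zero: "hn (\<lambda>x. 0) = 0"
  using ip_zero[OF zero_mem] by (simp add: hnorm_def)

lemma hn_add_sq:
  assumes "f \<in> H" "g \<in> H"
  shows "(hn (\<lambda>x. f x + g x))\<^sup>2 = (hn f)\<^sup>2 + (hn g)\<^sup>2 + 2 * Re (ip f g)"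
  using assms ip_cnj[of f g] by (simp add: ip_self(1)[symmetric] add_mem ip_add ip_add_right)

lemma hn_scale:
  assumes "f \<in> H"
  shows "hn (\<lambda>x. c * f x) = cmod c * hn f"
proof -
  have "Re (ip (\<lambda>x. c * f x) (\<lambda>x. c * f x)) = (cmod c)\<^sup>2 * (hn f)\<^sup>2"
    using assms ip_self(2)[OF assms] cmod_power2[of c]
    by (simp add: ip_scale ip_scale_right scale_mem power2_eq_square algebra_simps)
  then have "(hn (\<lambda>x. c * f x))\<^sup>2 = (cmod c * hn f)\<^sup>2"
    using assms by (simp add: ip_self(1) scale_mem power_mult_distrib)
  then show ?thesis
    using hn_nonneg[OF assms] hn_nonneg[OF scale_mem[OF assms]] by (simp add: power2_eq_iff_nonneg)
qed

lemma hn_diff_sq: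
  assumes "f \<in> H" "g \<in> H"
  shows "(hn (\<lambda>x. f x - g x))\<^sup>2 = (hn f)\<^sup>2 + (hn g)\<^sup>2 - 2 * Re (ip f g)"
  using hn_add_sq[of f "\<lambda>x. (-1) * g x"] hn_scale[of g "-1"] ip_scale_right[of g f "-1"] assms
  by (simp add: scale_mem[of g "-1", simplified])

lemma ip_Cauchy_Schwarz:
  assumes "f \<in> H" "g \<in> H"
  shows "cmod (ip f g) \<le> hn f * hn g"
proof -
  have "(cmod (ip f g))\<^sup>2 \<le> (hn f)\<^sup>2 * (hn g)\<^sup>2"
  proof (rule quadratic_discriminant_bound)
    fix t
    show "0 \<le> (hn f)\<^sup>2 + 2 * Re (t * ip f g) + (cmod t)\<^sup>2 * (hn g)\<^sup>2"
      using hn_add_sq[of f "\<lambda>x. cnj t * g x"] assms zero_le_power2[of "hn (\<lambda>x. f x + cnj t * g x)"]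
      by (simp add: scale_mem hn_scale ip_scale_right power_mult_distrib)
  qed
  then have "(cmod (ip f g))\<^sup>2 \<le> (hn f * hn g)\<^sup>2" by (simp add: power_mult_distrib)
  then show ?thesis
    by (rule power2_le_imp_le) (use assms in \<open>simp add: hn_nonneg\<close>)
qed

lemma hn_triangle:
  assumes "f \<in> H" "g \<in> H"
  shows "hn (\<lambda>x. f x + g x) \<le> hn f + hn g"
proof (rule power2_le_imp_le)
  have "Re (ip f g) \<le> hn f * hn g"
    using ip_Cauchy_Schwarz[OF assms] complex_Re_le_cmod order_trans by blast
  then show "(hn (\<lambda>x. f x + g x))\<^sup>2 \<le> (hn f + hn g)\<^sup>2"
    using hn_add_sq[OF assms] by (simp add: power2_sum)
qed (use assms in \<open>simp add: hn_nonneg\<close>)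

lemma hn_diff_commute:
  assumes "f \<in> H" "g \<in> H"
  shows "hn (\<lambda>x. f x - g x) = hn (\<lambda>x. g x - f x)"
  using hn_scale[OF diff_mem[OF assms], of "-1"] by simp

lemma hn_sum_le:
  "(\<And>i. i \<in> I \<Longrightarrow> f i \<in> H) \<Longrightarrow> hn (\<lambda>x. \<Sum>i\<in>I. c i * f i x) \<le> (\<Sum>i\<in>I. cmod (c i) * hn (f i))"
proof (induction I rule: infinite_finite_induct)
  case (insert x F)
  have "hn (\<lambda>y. c x * f x y + (\<Sum>i\<in>F. c i * f i y)) \<le> hn (\<lambda>y. c x * f x y) + hn (\<lambda>y. \<Sum>i\<in>F. c i * f i y)"
    using insert by (intro hn_triangle scale_mem sum_mem) auto
  then show ?case using insert by (simp add: hn_scale)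
qed (simp_all add: hn_zero)

lemma eval_bound:
  assumes "f \<in> H" "x \<in> X"
  shows "cmod (f x) \<le> hn f * hn (kf x)"
  using ip_Cauchy_Schwarz[OF assms(1) kf_mem[OF assms(2)]] ip_kf[OF assms] by simp

lemma hn_kf_sq: "x \<in> X \<Longrightarrow> (hn (kf x))\<^sup>2 = Re (K x x)"
  using ip_self(1)[OF kf_mem, of x] ip_kf[OF kf_mem, of x x] by (simp add: kf_apply)

text \<open>The arguments of \<open>ip\<close> appear swapped because \<open>qform\<close>
  conjugates the first coefficient while \<open>ip\<close> is conjugate-linear in its second
  argument.\<close>

lemma qform_gram:
  assumes "finite I" "\<And>i. i \<in> I \<Longrightarrow> g i \<in> H"
  shows "qform I c (\<lambda>i j. ip (g j) (g i)) = of_real ((hn (\<lambda>x. \<Sum>i\<in>I. c i * g i x))\<^sup>2)"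
proof -
  have m: "(\<lambda>x. \<Sum>i\<in>I. c i * g i x) \<in> H" using assms by (intro sum_mem)
  have "ip (\<lambda>x. \<Sum>i\<in>I. c i * g i x) (\<lambda>x. \<Sum>i\<in>I. c i * g i x) =
      (\<Sum>i\<in>I. cnj (c i) * ip (\<lambda>x. \<Sum>i\<in>I. c i * g i x) (g i))"
    using assms m by (intro ip_sum_right)
  also have "\<dots> = (\<Sum>i\<in>I. cnj (c i) * (\<Sum>j\<in>I. c j * ip (g j) (g i)))"
    using assms by (intro sum.cong refl arg_cong2[of _ _ _ _ "(*)"] ip_sum) auto
  also have "\<dots> = qform I c (\<lambda>i j. ip (g j) (g i))"
    by (simp add: qform_def sum_distrib_left mult_ac)
  finally show ?thesis using ip_self(2)[OF m] by simp
qed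

lemma psd_gram: "psd_kernel H (\<lambda>h h'. ip h' h)"
proof (rule psd_kernelI)
  fix F c assume F: "finite F" "F \<subseteq> H"
  have "qform F c (\<lambda>h h'. ip h' h) = of_real ((hn (\<lambda>x. \<Sum>h\<in>F. c h * h x))\<^sup>2)"
    by (rule qform_gram[of F "\<lambda>h. h"]) (use F in auto)
  then show "qform F c (\<lambda>h h'. ip h' h) \<in> \<real>\<^sub>\<ge>\<^sub>0" by (simp del: of_real_power)
qed

lemma psd_K: "psd_kernel X K"
proof (rule psd_cong_imp)
  show "psd_kernel X (\<lambda>x y. ip (kf y) (kf x))"
    by (rule psd_pullback[OF psd_gram]) (auto simp: kf_mem)
qed (simp add: ip_kf kf_mem kf_apply)

lemma hn_kernel_sum:
  assumes "finite I" "p ` I \<subseteq> X"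
  shows "(hn (\<lambda>x. \<Sum>i\<in>I. c i * kf (p i) x))\<^sup>2 = Re (qform I c (\<lambda>i j. K (p i) (p j)))"
proof -
  have m: "p i \<in> X" if "i \<in> I" for i using assms that by auto
  have "qform I c (\<lambda>i j. K (p i) (p j)) = qform I c (\<lambda>i j. ip (kf (p j)) (kf (p i)))"
    by (intro qform_cong) (simp add: m ip_kf kf_mem kf_apply)
  also have "\<dots> = of_real ((hn (\<lambda>x. \<Sum>i\<in>I. c i * kf (p i) x))\<^sup>2)"
    by (rule qform_gram[OF assms(1)]) (simp add: m kf_mem)
  finally show ?thesis by simp
qed

lemma ip_tendsto:
  assumes "\<And>n::nat. F n \<in> H" "f \<in> H" "(\<lambda>n. hn (\<lambda>x. F n x - f x)) \<longlonglongrightarrow> 0" "z \<in> H"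
  shows "(\<lambda>n. ip z (F n)) \<longlonglongrightarrow> ip z f" "(\<lambda>n. ip (F n) z) \<longlonglongrightarrow> ip f z"
proof -
  have lim: "(\<lambda>n. ip (F n) z - ip f z) \<longlonglongrightarrow> 0"
  proof (rule tendsto_0_le[where K = "hn z"])
    show "(\<lambda>n. hn (\<lambda>x. F n x - f x)) \<longlonglongrightarrow> 0" by fact
    have "cmod (ip (F n) z - ip f z) \<le> norm (hn (\<lambda>x. F n x - f x)) * hn z" for n
      using ip_Cauchy_Schwarz[OF diff_mem[OF assms(1,2)] assms(4), of n] ip_diff[OF assms(1,2,4), of n]
        hn_nonneg[OF diff_mem[OF assms(1,2)], of n] by simp
    then show "\<forall>\<^sub>F n in sequentially. norm (ip (F n) z - ip f z) \<le> norm (hn (\<lambda>x. F n x - f x)) * hn z"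
      by simp
  qed
  then show *: "(\<lambda>n. ip (F n) z) \<longlonglongrightarrow> ip f z" by (rule LIM_zero_cancel)
  show "(\<lambda>n. ip z (F n)) \<longlonglongrightarrow> ip z f"
    using tendsto_cnj[OF *] assms by (simp add: ip_cnj[of _ z])
qed

text \<open>Riesz representation for a bounded linear functional that is given by its graph \<open>S\<close> over a
  subspace; the representing vector minimizes \<open>\<parallel>x\<parallel>\<^sup>2 - 2 Re \<lambda>\<close> over \<open>(x, \<lambda>)\<close> in the graph.\<close>

lemma riesz_graph:
  fixes S :: "(('a \<Rightarrow> complex) \<times> complex) set"
  assumes S: "fst ` S \<subseteq> H" "S \<noteq> {}"
    and S_add: "\<And>x \<alpha> y \<beta>. (x, \<alpha>) \<in> S \<Longrightarrow> (y, \<beta>) \<in> S \<Longrightarrow> (\<lambda>z. x z + y z, \<alpha> + \<beta>) \<in> S"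
    and S_scale: "\<And>x \<alpha> t. (x, \<alpha>) \<in> S \<Longrightarrow> (\<lambda>z. t * x z, t * \<alpha>) \<in> S"
    and bound: "\<And>x \<alpha>. (x, \<alpha>) \<in> S \<Longrightarrow> cmod \<alpha> \<le> C * hn x" and C: "C \<ge> 0"
  shows "\<exists>y\<in>H. hn y \<le> C \<and> (\<forall>x \<alpha>. (x, \<alpha>) \<in> S \<longrightarrow> ip x y = \<alpha>)"
proof -
  define \<Phi> where "\<Phi> p = (hn (fst p))\<^sup>2 - 2 * Re (snd p)" for p :: "('a \<Rightarrow> complex) \<times> complex"
  define m where "m = Inf (\<Phi> ` S)"
  have SH: "x \<in> H" if "(x, \<alpha>) \<in> S" for x \<alpha> using S that by force
  have lower: "- (C\<^sup>2) \<le> \<Phi> p" if "p \<in> S" for p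
  proof -
    obtain x \<alpha> where p: "p = (x, \<alpha>)" by force
    have "Re \<alpha> \<le> C * hn x" using bound that p complex_Re_le_cmod order_trans by blast
    moreover have "0 \<le> (hn x - C)\<^sup>2" by simp
    ultimately show ?thesis by (simp add: \<Phi>_def p power2_eq_square algebra_simps)
  qed
  have bdd: "bdd_below (\<Phi> ` S)" using lower by (intro bdd_belowI[of _ "- (C\<^sup>2)"]) auto
  have m_le: "m \<le> \<Phi> p" if "p \<in> S" for p
    unfolding m_def using that bdd by (intro cInf_lower) auto
  have "\<exists>p\<in>S. \<Phi> p < m + 1 / real (Suc n)" for n
    using cInf_lessD[of "\<Phi> ` S" "m + 1 / real (Suc n)"] S(2) by (auto simp: m_def)
  then obtain P where P: "\<And>n. P n \<in> S" "\<And>n. \<Phi> (P n) < m + 1 / real (Suc n)" by metis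
  define x \<alpha> where "x n = fst (P n)" and "\<alpha> n = snd (P n)" for n
  have xS: "(x n, \<alpha> n) \<in> S" for n using P by (simp add: x_def \<alpha>_def)
  have xH: "x n \<in> H" for n using SH xS by blast
  have \<Phi>x: "(hn (x n))\<^sup>2 - 2 * Re (\<alpha> n) < m + 1 / real (Suc n)" for n
    using P(2)[of n] by (simp add: \<Phi>_def x_def \<alpha>_def)
  \<comment> \<open>Parallelogram law: the midpoint of two near-minimizers is again in the graph, so
    its value is at least \<open>m\<close>, which forces the two to be close.\<close>
  have close: "(hn (\<lambda>z. x i z - x j z))\<^sup>2 \<le> 2 / real (Suc i) + 2 / real (Suc j)" for i j
  proof -
    have "m \<le> (hn (\<lambda>z. 1/2 * (x i z + x j z)))\<^sup>2 - 2 * Re (1/2 * (\<alpha> i + \<alpha> j))"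
      using m_le[OF S_scale[OF S_add[OF xS xS], of "1/2" i j]] unfolding \<Phi>_def by (simp only: fst_conv snd_conv)
    moreover have "(hn (\<lambda>z. 1/2 * (x i z + x j z)))\<^sup>2 = (hn (\<lambda>z. x i z + x j z))\<^sup>2 / 4"
      unfolding hn_scale[OF add_mem[OF xH xH], of "1/2" i j] power_mult_distrib
      by (simp add: power2_eq_square)
    moreover have "Re (1/2 * (\<alpha> i + \<alpha> j)) = (Re (\<alpha> i) + Re (\<alpha> j)) / 2" by simp
    ultimately have "m \<le> (hn (\<lambda>z. x i z + x j z))\<^sup>2 / 4 - 2 * ((Re (\<alpha> i) + Re (\<alpha> j)) / 2)"
      by (simp only:)
    moreover have "4 * m \<le> A - 4 * a - 4 * b" if "m \<le> A / 4 - 2 * ((a + b) / 2)" for A a b :: real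
      using that by (simp add: field_simps)
    ultimately have "4 * m \<le> (hn (\<lambda>z. x i z + x j z))\<^sup>2 - 4 * Re (\<alpha> i) - 4 * Re (\<alpha> j)"
      by blast
    then show ?thesis
      using \<Phi>x[of i] \<Phi>x[of j] hn_add_sq[OF xH xH, of i j] hn_diff_sq[OF xH xH, of i j] by simp
  qed
  have "\<forall>e>0. \<exists>N. \<forall>m\<ge>N. \<forall>n\<ge>N. hn (\<lambda>z. x m z - x n z) < e"
  proof (intro allI impI)
    fix e :: real assume e: "e > 0"
    obtain N :: nat where N: "4 / e\<^sup>2 < real N" using reals_Archimedean2 by blast
    have "hn (\<lambda>z. x i z - x j z) < e" if "i \<ge> N" "j \<ge> N" for i j
    proof (rule power2_less_imp_less)
      have N0: "real N > 0" using N e by (smt (verit) divide_nonneg_pos zero_le_power2 zero_less_power)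
      have "2 / real (Suc i) \<le> 2 / real N" "2 / real (Suc j) \<le> 2 / real N"
        using that N0 by (auto intro!: divide_left_mono mult_pos_pos)
      moreover have "4 / real N < e\<^sup>2" using N N0 e by (simp add: field_simps)
      ultimately show "(hn (\<lambda>z. x i z - x j z))\<^sup>2 < e\<^sup>2" using close[of i j] by simp
    qed (use e in simp)
    then show "\<exists>N. \<forall>m\<ge>N. \<forall>n\<ge>N. hn (\<lambda>z. x m z - x n z) < e" by (intro exI[of _ N]) simp
  qed
  from complete[OF xH this] obtain y where y: "y \<in> H" "(\<lambda>n. hn (\<lambda>z. x n z - y z)) \<longlonglongrightarrow> 0" ..
  \<comment> \<open>First variation: adding \<open>t * z\<close> to a near-minimizer cannot push the
    value below \<open>m\<close>. In the limit this is a non-negative quadratic in \<open>t\<close>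
    without constant term, so its linear part vanishes.\<close>
  have rep: "ip z y = \<beta>" if z: "(z, \<beta>) \<in> S" for z \<beta>
  proof -
    have zH: "z \<in> H" using SH z by blast
    have "(cmod (ip z y - \<beta>))\<^sup>2 \<le> 0 * (hn z)\<^sup>2"
    proof (rule quadratic_discriminant_bound)
      fix t
      have "0 \<le> 1 / real (Suc n) + 2 * Re (t * (ip z (x n) - \<beta>)) + (cmod t)\<^sup>2 * (hn z)\<^sup>2" for n
      proof -
        have "(\<lambda>w. x n w + t * z w, \<alpha> n + t * \<beta>) \<in> S" by (intro S_add S_scale xS z)
        from m_le[OF this] have "m \<le> (hn (\<lambda>w. x n w + t * z w))\<^sup>2 - 2 * Re (\<alpha> n) - 2 * Re (t * \<beta>)"
          by (simp add: \<Phi>_def)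
        moreover have "(hn (\<lambda>w. x n w + t * z w))\<^sup>2 = (hn (x n))\<^sup>2 + (cmod t)\<^sup>2 * (hn z)\<^sup>2 + 2 * Re (cnj t * ip (x n) z)"
          using hn_add_sq[OF xH scale_mem[OF zH], of n t]
          by (simp add: hn_scale zH power_mult_distrib ip_scale_right xH)
        moreover have "Re (cnj t * ip (x n) z) = Re (t * ip z (x n))"
          by (simp add: ip_cnj[OF xH zH])
        ultimately show ?thesis using \<Phi>x[of n] by (simp add: right_diff_distrib)
      qed
      moreover have "(\<lambda>n. 1 / real (Suc n) + 2 * Re (t * (ip z (x n) - \<beta>)) + (cmod t)\<^sup>2 * (hn z)\<^sup>2)
          \<longlonglongrightarrow> 0 + 2 * Re (t * (ip z y - \<beta>)) + (cmod t)\<^sup>2 * (hn z)\<^sup>2"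
        using LIMSEQ_inverse_real_of_nat
        by (intro tendsto_intros ip_tendsto(1)[OF xH y zH]) (simp add: inverse_eq_divide)
      ultimately show "0 \<le> 0 + 2 * Re (t * (ip z y - \<beta>)) + (cmod t)\<^sup>2 * (hn z)\<^sup>2"
        by (intro LIMSEQ_le_const) auto
    qed
    then show ?thesis by simp
  qed
  \<comment> \<open>The limit \<open>y\<close> need not belong to the domain of the graph, so the
    bound is applied to \<open>x n\<close> and carried over by continuity.\<close>
  have "hn y \<le> C"
  proof -
    have "cmod (ip (x n) y) \<le> C * hn (\<lambda>z. x n z - y z) + C * hn y" for n
    proof -
      have "cmod (ip (x n) y) \<le> C * hn (x n)" using rep[OF xS] bound[OF xS] by simp
      moreover have "C * hn (x n) \<le> C * (hn (\<lambda>z. x n z - y z) + hn y)"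
        using hn_triangle[OF diff_mem[OF xH y(1)] y(1), of n] C by (intro mult_left_mono) simp_all
      ultimately show ?thesis by (simp add: algebra_simps)
    qed
    moreover have "(\<lambda>n. cmod (ip (x n) y)) \<longlonglongrightarrow> cmod (ip y y)"
      by (intro tendsto_norm ip_tendsto(2)[OF xH y y(1)])
    moreover have "(\<lambda>n. C * hn (\<lambda>z. x n z - y z) + C * hn y) \<longlonglongrightarrow> C * 0 + C * hn y"
      by (intro tendsto_intros y)
    ultimately have "cmod (ip y y) \<le> C * 0 + C * hn y"
      by (intro LIMSEQ_le) auto
    then have "(hn y)\<^sup>2 \<le> C * hn y" using ip_self(2)[OF y(1)] by (simp add: norm_power)
    then show ?thesis using hn_nonneg[OF y(1)] C by (cases "hn y = 0") (auto simp: power2_eq_square)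
  qed
  with rep y(1) show ?thesis by blast
qed

lemma riesz:
  assumes add: "\<And>f g. f \<in> H \<Longrightarrow> g \<in> H \<Longrightarrow> l (\<lambda>x. f x + g x) = l f + l g"
    and scale: "\<And>f c. f \<in> H \<Longrightarrow> l (\<lambda>x. c * f x) = c * l f"
    and bound: "\<And>f. f \<in> H \<Longrightarrow> cmod (l f) \<le> C * hn f" and C: "C \<ge> 0"
  shows "\<exists>y\<in>H. \<forall>f\<in>H. ip f y = l f"
proof -
  have iff: "(x, \<alpha>) \<in> (\<lambda>f. (f, l f)) ` H \<longleftrightarrow> x \<in> H \<and> \<alpha> = l x" for x \<alpha> by blast
  have "\<exists>y\<in>H. hn y \<le> C \<and> (\<forall>x \<alpha>. (x, \<alpha>) \<in> (\<lambda>f. (f, l f)) ` H \<longrightarrow> ip x y = \<alpha>)"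
    by (rule riesz_graph; (unfold iff)?) (use zero_mem C in \<open>auto simp: add scale bound add_mem scale_mem\<close>)
  then show ?thesis unfolding iff by blast
qed

text \<open>Cauchy-Schwarz between \<open>f\<close> and combinations of kernel functions, on which
  \<open>f\<close> acts by its point values. The converse is \<open>mem_if_psd\<close>.\<close>

lemma psd_of_mem:
  assumes "f \<in> H"
  shows "psd_kernel X (\<lambda>x y. of_real ((hn f)\<^sup>2) * K x y - f x * cnj (f y))"
proof (rule psd_kernelI)
  fix F c assume F: "finite F" "F \<subseteq> X"
  define h where "h = (\<lambda>x. \<Sum>i\<in>F. c i * kf i x)"
  have h: "h \<in> H" unfolding h_def using F by (auto intro: sum_mem kf_mem)
  have *: "ip f h = (\<Sum>x\<in>F. cnj (c x) * f x)"
    unfolding h_def using F assms by (subst ip_sum_right) (auto simp: kf_mem ip_kf subset_iff)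
  have "(cmod (ip f h))\<^sup>2 \<le> (hn f * hn h)\<^sup>2"
    using ip_Cauchy_Schwarz[OF assms h] by (intro power_mono) auto
  then have "(cmod (ip f h))\<^sup>2 \<le> (hn f)\<^sup>2 * Re (qform F c K)"
    using hn_kernel_sum[of F "\<lambda>x. x" c] F by (simp add: power_mult_distrib h_def)
  moreover have "qform F c (\<lambda>x y. of_real ((hn f)\<^sup>2) * K x y - f x * cnj (f y)) =
     of_real ((hn f)\<^sup>2) * of_real (Re (qform F c K)) - of_real ((cmod (ip f h))\<^sup>2)"
    unfolding qform_diff qform_scale qform_rank1 *[symmetric] complex_norm_square
    by (simp only: qform_real[OF psd_K F, symmetric])
  ultimately show "qform F c (\<lambda>x y. of_real ((hn f)\<^sup>2) * K x y - f x * cnj (f y)) \<in> \<real>\<^sub>\<ge>\<^sub>0"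
    by (simp only: of_real_mult[symmetric] of_real_diff[symmetric] nonneg_Reals_of_real_iff diff_ge_0_iff_ge)
qed

text \<open>\<open>g\<close> is the Riesz vector of the functional that sends the combination of the
  \<open>kf i\<close> with coefficients \<open>c i\<close> to the sum of
  \<open>c i * cnj (g i)\<close>. Positivity is exactly boundedness by \<open>C\<close>. The kernel
  functions may be linearly dependent, so the functional is given by its graph and boundedness takes
  care of uniqueness.\<close>

lemma mem_if_psd:
  assumes psd: "psd_kernel X (\<lambda>x y. of_real (C\<^sup>2) * K x y - g x * cnj (g y))"
    and C: "C \<ge> 0" and off: "\<And>x. x \<notin> X \<Longrightarrow> g x = 0"
  shows "g \<in> H" "hn g \<le> C"
proof -
  define S where "S = {(\<lambda>x. \<Sum>i\<in>F. c i * kf i x, \<Sum>i\<in>F. c i * cnj (g i)) | F c. finite F \<and> F \<subseteq> X}"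
  have "\<exists>y\<in>H. hn y \<le> C \<and> (\<forall>x \<alpha>. (x, \<alpha>) \<in> S \<longrightarrow> ip x y = \<alpha>)"
  proof (rule riesz_graph)
    show "fst ` S \<subseteq> H" by (auto simp: S_def intro!: sum_mem kf_mem)
    show "S \<noteq> {}" by (auto simp: S_def)
    show "0 \<le> C" by fact
    show "(\<lambda>z. t * x z, t * \<alpha>) \<in> S" if S: "(x, \<alpha>) \<in> S" for x \<alpha> t
    proof -
      obtain F c where F: "finite F" "F \<subseteq> X" "x = (\<lambda>x. \<Sum>i\<in>F. c i * kf i x)" "\<alpha> = (\<Sum>i\<in>F. c i * cnj (g i))"
        using S by (auto simp: S_def)
      then show ?thesis unfolding S_def
        by (intro CollectI exI[of _ F] exI[of _ "\<lambda>i. t * c i"]) (simp add: sum_distrib_left mult.assoc)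
    qed
    show "(\<lambda>z. x z + y z, \<alpha> + \<beta>) \<in> S" if S: "(x, \<alpha>) \<in> S" "(y, \<beta>) \<in> S" for x \<alpha> y \<beta>
    proof -
      obtain F c where F: "finite F" "F \<subseteq> X" "x = (\<lambda>x. \<Sum>i\<in>F. c i * kf i x)" "\<alpha> = (\<Sum>i\<in>F. c i * cnj (g i))"
        using S by (auto simp: S_def)
      obtain G d where G: "finite G" "G \<subseteq> X" "y = (\<lambda>x. \<Sum>i\<in>G. d i * kf i x)" "\<beta> = (\<Sum>i\<in>G. d i * cnj (g i))"
        using S by (auto simp: S_def)
      define e where "e i = (if i \<in> F then c i else 0) + (if i \<in> G then d i else 0)" for i
      have e: "(\<Sum>i\<in>F. c i * u i) + (\<Sum>i\<in>G. d i * u i) = (\<Sum>i\<in>F \<union> G. e i * u i)" for u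
      proof -
        have "(\<Sum>i\<in>F. c i * u i) = (\<Sum>i\<in>F \<union> G. (if i \<in> F then c i else 0) * u i)"
          using F G by (intro sum.mono_neutral_cong_left) auto
        moreover have "(\<Sum>i\<in>G. d i * u i) = (\<Sum>i\<in>F \<union> G. (if i \<in> G then d i else 0) * u i)"
          using F G by (intro sum.mono_neutral_cong_left) auto
        ultimately show ?thesis by (simp add: e_def sum.distrib distrib_right)
      qed
      show ?thesis unfolding S_def
        using F G e by (intro CollectI exI[of _ "F \<union> G"] exI[of _ e]) auto
    qed
    show "cmod \<alpha> \<le> C * hn x" if S: "(x, \<alpha>) \<in> S" for x \<alpha>
    proof -
      obtain F c where F: "finite F" "F \<subseteq> X" "x = (\<lambda>x. \<Sum>i\<in>F. c i * kf i x)" "\<alpha> = (\<Sum>i\<in>F. c i * cnj (g i))"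
        using S by (auto simp: S_def)
      have x: "x \<in> H" unfolding F(3) using F by (auto intro: sum_mem kf_mem)
      have *: "(\<Sum>i\<in>F. cnj (c i) * g i) = cnj \<alpha>" by (simp add: F)
      have "qform F c (\<lambda>x y. of_real (C\<^sup>2) * K x y - g x * cnj (g y)) =
        of_real (C\<^sup>2) * of_real ((hn x)\<^sup>2) - of_real ((cmod (cnj \<alpha>))\<^sup>2)"
        unfolding qform_diff qform_scale qform_rank1 * complex_norm_square
        using hn_kernel_sum[of F "\<lambda>x. x" c] F qform_real[OF psd_K F(1,2), of c] by simp
      moreover have "qform F c (\<lambda>x y. of_real (C\<^sup>2) * K x y - g x * cnj (g y)) \<in> \<real>\<^sub>\<ge>\<^sub>0"
        by (rule psd_qform[OF psd F(1,2)])
      ultimately have "(cmod (cnj \<alpha>))\<^sup>2 \<le> C\<^sup>2 * (hn x)\<^sup>2"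
        by (simp only: of_real_mult[symmetric] of_real_diff[symmetric] nonneg_Reals_of_real_iff diff_ge_0_iff_ge)
      then have "(cmod \<alpha>)\<^sup>2 \<le> (C * hn x)\<^sup>2" by (simp add: power_mult_distrib)
      then show ?thesis by (rule power2_le_imp_le) (use C hn_nonneg[OF x] in auto)
    qed
  qed
  then obtain y where y: "y \<in> H" "hn y \<le> C" "\<And>x \<alpha>. (x, \<alpha>) \<in> S \<Longrightarrow> ip x y = \<alpha>" by blast
  have "y x = g x" for x
  proof (cases "x \<in> X")
    case True
    have "(\<lambda>z. \<Sum>i\<in>{x}. 1 * kf i z, \<Sum>i\<in>{x}. 1 * cnj (g i)) \<in> S"
      unfolding S_def using True by (intro CollectI exI[of _ "{x}"] exI[of _ "\<lambda>_. 1"]) auto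
    then have "(kf x, cnj (g x)) \<in> S" by simp
    from y(3)[OF this] show ?thesis using ip_kf_left[OF y(1) True] by simp
  next
    case False
    then show ?thesis using off vanishes_off[OF y(1)] by simp
  qed
  then have "y = g" by auto
  with y show "g \<in> H" "hn g \<le> C" by auto
qed

text \<open>The operator of multiplication by \<open>\<phi>\<close> has norm at most \<open>c\<close>, expressed on kernel functions.\<close>

definition mult_bound :: "('a \<Rightarrow> complex) \<Rightarrow> real \<Rightarrow> bool" where
  "mult_bound \<phi> c \<longleftrightarrow> c \<ge> 0 \<and> psd_kernel X (\<lambda>x y. K x y * (of_real (c\<^sup>2) - \<phi> x * cnj (\<phi> y)))"

text \<open>With N the squared norm of \<open>f\<close> and all products of the form
  \<open>u x * cnj (u y)\<close> written \<open>|u|\<^sup>2\<close>: \<open>N c\<^sup>2 K - |\<phi>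
  f|\<^sup>2 = N K (c\<^sup>2 - |\<phi>|\<^sup>2) + |\<phi>|\<^sup>2 (N K - |f|\<^sup>2)\<close>.
  Both terms are psd, and \<open>mem_if_psd\<close> applies.\<close>

lemma mult_bound_mult:
  assumes mult_bound: "mult_bound \<phi> c" and f: "f \<in> H"
  shows "(\<lambda>x. \<phi> x * f x) \<in> H" "hn (\<lambda>x. \<phi> x * f x) \<le> c * hn f"
proof -
  have c: "c * hn f \<ge> 0" using mult_bound hn_nonneg[OF f] by (simp add: mult_bound_def)
  have "psd_kernel X (\<lambda>x y. of_real ((hn f)\<^sup>2) * (K x y * (of_real (c\<^sup>2) - \<phi> x * cnj (\<phi> y))) +
     \<phi> x * cnj (\<phi> y) * (of_real ((hn f)\<^sup>2) * K x y - f x * cnj (f y)))"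
    using mult_bound by (intro psd_add psd_scale psd_congruence psd_of_mem f) (auto simp: mult_bound_def)
  then have psd: "psd_kernel X (\<lambda>x y. of_real ((c * hn f)\<^sup>2) * K x y - (\<phi> x * f x) * cnj (\<phi> y * f y))"
    by (rule psd_cong_imp) (simp add: power_mult_distrib algebra_simps)
  have off: "\<And>x. x \<notin> X \<Longrightarrow> \<phi> x * f x = 0" using vanishes_off[OF f] by simp
  from mem_if_psd[OF psd c off] show "(\<lambda>x. \<phi> x * f x) \<in> H" "hn (\<lambda>x. \<phi> x * f x) \<le> c * hn f" by blast+
qed

lemma mult_bound_mult_norm:
  assumes "mult_bound \<phi> c"
  shows "mult_norm H ip \<phi> \<le> ennreal c"
proof -
  have "ennreal (hn (\<lambda>x. \<phi> x * f x)) \<le> ennreal c" if "f \<in> H" "hn f \<le> 1" for f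
    using mult_bound_mult(2)[OF assms that(1)] mult_left_mono[OF that(2), of c] assms
    by (intro ennreal_leI) (simp add: mult_bound_def)
  moreover have "\<phi> \<in> multipliers H" using mult_bound_mult(1)[OF assms] by (simp add: multipliers_def)
  ultimately show ?thesis by (auto simp: mult_norm_def intro: SUP_least)
qed

lemma mult_bound_cong:
  assumes "mult_bound \<phi> c" "\<And>x. x \<in> X \<Longrightarrow> \<psi> x = \<phi> x"
  shows "mult_bound \<psi> c"
  using assms unfolding mult_bound_def by (auto elim!: psd_cong_imp)

lemma mult_bound_mono:
  assumes "mult_bound \<phi> c" "c \<le> d"
  shows "mult_bound \<phi> d"
proof -
  have "c\<^sup>2 \<le> d\<^sup>2" using assms by (auto simp: mult_bound_def intro: power_mono)
  then have "psd_kernel X (\<lambda>x y. K x y * (of_real (c\<^sup>2) - \<phi> x * cnj (\<phi> y)) + of_real (d\<^sup>2 - c\<^sup>2) * K x y)"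
    using assms psd_K by (intro psd_add psd_scale) (auto simp: mult_bound_def)
  then show ?thesis
    using assms unfolding mult_bound_def by (auto elim!: psd_cong_imp simp: algebra_simps)
qed

lemma mult_bound_const: "mult_bound (\<lambda>x. t) (cmod t)"
  using psd_zero by (auto simp: mult_bound_def complex_norm_square simp del: of_real_power elim!: psd_cong_imp)

text \<open>The same telescoping as in \<open>mult_bound_mult\<close>, with \<open>\<psi>\<close>
  and its bound in place of \<open>f\<close> and its norm.\<close>

lemma mult_bound_prod:
  assumes "mult_bound \<phi> c" "mult_bound \<psi> d"
  shows "mult_bound (\<lambda>x. \<phi> x * \<psi> x) (c * d)"
proof -
  have "psd_kernel X (\<lambda>x y. of_real (d\<^sup>2) * (K x y * (of_real (c\<^sup>2) - \<phi> x * cnj (\<phi> y))) +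
     \<phi> x * cnj (\<phi> y) * (K x y * (of_real (d\<^sup>2) - \<psi> x * cnj (\<psi> y))))"
    using assms by (intro psd_add psd_scale psd_congruence) (auto simp: mult_bound_def)
  then show ?thesis
    using assms unfolding mult_bound_def
    by (auto elim!: psd_cong_imp simp: power_mult_distrib algebra_simps)
qed

lemma mult_bound_limit:
  assumes "\<And>n::nat. mult_bound \<phi> (c n)" "c \<longlonglongrightarrow> d"
  shows "mult_bound \<phi> d"
proof -
  have "psd_kernel X (\<lambda>x y. K x y * (of_real (d\<^sup>2) - \<phi> x * cnj (\<phi> y)))"
  proof (rule psd_limit[where k = "\<lambda>n x y. K x y * (of_real ((c n)\<^sup>2) - \<phi> x * cnj (\<phi> y))"])
    show "psd_kernel X (\<lambda>x y. K x y * (of_real ((c n)\<^sup>2) - \<phi> x * cnj (\<phi> y)))" for n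
      using assms(1) by (simp only: mult_bound_def)
  qed (intro tendsto_intros assms(2))
  moreover have "d \<ge> 0" using assms by (intro LIMSEQ_le_const[OF assms(2)]) (auto simp: mult_bound_def)
  ultimately show ?thesis by (simp add: mult_bound_def)
qed

text \<open>With \<open>c, d > 0\<close>: \<open>(\<phi>+\<psi>)(\<phi>+\<psi>)* \<le> (1 + d/c) \<phi>\<phi>* + (1 + c/d) \<psi>\<psi>*\<close>,
  the defect being the square of \<open>\<surd>(d/c) \<phi> - \<surd>(c/d) \<psi>\<close>.\<close>

lemma mult_bound_add:
  assumes "mult_bound \<phi> c" "mult_bound \<psi> d"
  shows "mult_bound (\<lambda>x. \<phi> x + \<psi> x) (c + d)"
proof -
  have pos: "mult_bound (\<lambda>x. \<phi> x + \<psi> x) (c + d)" if m: "mult_bound \<phi> c" "mult_bound \<psi> d" and p: "c > 0" "d > 0" for c d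
  proof -
    define s where "s = complex_of_real (sqrt (d / c))"
    define u where "u = complex_of_real (sqrt (c / d))"
    have su: "s * s = of_real (d / c)" "u * u = of_real (c / d)" "s * u = 1" "cnj s = s" "cnj u = u"
      using p by (auto simp: s_def u_def of_real_mult[symmetric] real_sqrt_mult[symmetric] simp del: of_real_mult)
    have "psd_kernel X (\<lambda>x y. (of_real (1 + d / c) * (K x y * (of_real (c\<^sup>2) - \<phi> x * cnj (\<phi> y))) +
       of_real (1 + c / d) * (K x y * (of_real (d\<^sup>2) - \<psi> x * cnj (\<psi> y)))) +
       (s * \<phi> x - u * \<psi> x) * cnj (s * \<phi> y - u * \<psi> y) * K x y)"
      using m p psd_K by (intro psd_add psd_scale psd_congruence) (auto simp: mult_bound_def)
    moreover have "K x y * (of_real ((c + d)\<^sup>2) - (\<phi> x + \<psi> x) * cnj (\<phi> y + \<psi> y)) =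
       (of_real (1 + d / c) * (K x y * (of_real (c\<^sup>2) - \<phi> x * cnj (\<phi> y))) +
       of_real (1 + c / d) * (K x y * (of_real (d\<^sup>2) - \<psi> x * cnj (\<psi> y)))) +
       (s * \<phi> x - u * \<psi> x) * cnj (s * \<phi> y - u * \<psi> y) * K x y" for x y
    proof -
      have "(s * \<phi> x - u * \<psi> x) * cnj (s * \<phi> y - u * \<psi> y) =
        of_real (d / c) * \<phi> x * cnj (\<phi> y) + of_real (c / d) * \<psi> x * cnj (\<psi> y)
         - \<phi> x * cnj (\<psi> y) - \<psi> x * cnj (\<phi> y)"
        using su(3) unfolding su(1,2)[symmetric] by (simp add: su(4,5)) algebra
      moreover have "complex_of_real (c\<^sup>2) * of_real (1 + d / c) + of_real (d\<^sup>2) * of_real (1 + c / d) = of_real ((c + d)\<^sup>2)"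
        using p unfolding of_real_mult[symmetric] of_real_add[symmetric] of_real_eq_iff
        by (simp add: field_simps power2_eq_square)
      ultimately show ?thesis by (simp del: of_real_power of_real_add add: of_real_add[of 1] algebra_simps) (algebra)
    qed
    ultimately show ?thesis using p by (auto simp: mult_bound_def)
  qed
  show ?thesis
  proof -
    have c: "c \<ge> 0" "d \<ge> 0" using assms by (auto simp: mult_bound_def)
    \<comment> \<open>The weights \<open>d / c\<close> and \<open>c / d\<close> require positive
      bounds, so zero bounds are reached as limits.\<close>
    have "mult_bound (\<lambda>x. \<phi> x + \<psi> x) ((c + 1 / real (Suc n)) + (d + 1 / real (Suc n)))" for n
      using c by (intro pos mult_bound_mono[OF assms(1)] mult_bound_mono[OF assms(2)]) (auto intro: add_nonneg_pos)
    moreover have "(\<lambda>n. (c + 1 / real (Suc n)) + (d + 1 / real (Suc n))) \<longlonglongrightarrow> (c + 0) + (d + 0)"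
      using LIMSEQ_inverse_real_of_nat by (intro tendsto_intros) (simp_all add: inverse_eq_divide)
    ultimately show ?thesis using mult_bound_limit by fastforce
  qed
qed

lemma mult_bound_scale: "mult_bound \<phi> c \<Longrightarrow> mult_bound (\<lambda>x. t * \<phi> x) (cmod t * c)"
  using mult_bound_prod[OF mult_bound_const] .

lemma mult_bound_diff: "mult_bound \<phi> c \<Longrightarrow> mult_bound \<psi> d \<Longrightarrow> mult_bound (\<lambda>x. \<phi> x - \<psi> x) (c + d)"
  using mult_bound_add[of \<phi> c "\<lambda>x. (-1) * \<psi> x" d] mult_bound_scale[of \<psi> d "-1"] by simp

lemma mult_bound_power: "mult_bound \<phi> c \<Longrightarrow> mult_bound (\<lambda>x. \<phi> x ^ n) (c ^ n)"
  using mult_bound_const[of 1] by (induction n) (auto intro: mult_bound_prod)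

text \<open>The bound on the inverse is the estimate \<open>\<parallel>(1-u)\<^sup>*h\<parallel> \<ge> (1-\<theta>) \<parallel>h\<parallel>\<close>: apply the
  inequality behind \<open>mult_bound_add\<close> to \<open>1 = (1 - u) + u\<close>.\<close>

lemma mult_bound_inverse:
  assumes u: "mult_bound u \<theta>" and \<theta>: "\<theta> < 1" and ne: "\<And>x. x \<in> X \<Longrightarrow> u x \<noteq> 1"
  shows "mult_bound (\<lambda>x. 1 / (1 - u x)) (1 / (1 - \<theta>))"
proof -
  have pos: "mult_bound (\<lambda>x. 1 / (1 - u x)) (1 / (1 - t))" if u: "mult_bound u t" and t: "0 < t" "t < 1" for t
  proof -
    \<comment> \<open>The weights satisfy \<open>s * v = 1\<close>, \<open>1 + s\<^sup>2 = C\<close>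
      and \<open>1 + v\<^sup>2 = 1 / t\<close>. The bound \<open>t\<^sup>2\<close> for
      \<open>u\<close> then leaves exactly \<open>1 - t = 1 / C\<close> on the left.\<close>
    define s where "s = complex_of_real (sqrt (t / (1 - t)))"
    define v where "v = complex_of_real (sqrt ((1 - t) / t))"
    define C where "C = 1 / (1 - t)"
    have sv: "s * s = of_real (C - 1)" "v * v = of_real (1 / t - 1)" "s * v = 1" "cnj s = s" "cnj v = v"
      using t by (auto simp: s_def v_def C_def of_real_mult[symmetric] real_sqrt_mult[symmetric] field_simps simp del: of_real_mult of_real_divide)
    have "psd_kernel X (\<lambda>x y. (1 / (1 - u x)) * cnj (1 / (1 - u y)) * (of_real C *
       (of_real (1 / t) * (K x y * (of_real (t\<^sup>2) - u x * cnj (u y))) +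
       (s * (1 - u x) - v * u x) * cnj (s * (1 - u y) - v * u y) * K x y)))"
      using u t psd_K by (intro psd_congruence psd_scale psd_add) (auto simp: mult_bound_def C_def)
    moreover have "K x y * (of_real (C\<^sup>2) - (1 / (1 - u x)) * cnj (1 / (1 - u y))) =
       (1 / (1 - u x)) * cnj (1 / (1 - u y)) * (of_real C *
       (of_real (1 / t) * (K x y * (of_real (t\<^sup>2) - u x * cnj (u y))) +
       (s * (1 - u x) - v * u x) * cnj (s * (1 - u y) - v * u y) * K x y))"
      if "x \<in> X" "y \<in> X" for x y
    proof -
      define p q where "p = 1 - u x" and "q = 1 - cnj (u y)"
      have "cnj (1 - u y) \<noteq> 0" using ne[OF that(2)] by (simp only: complex_cnj_zero_iff) simp
      then have pq: "p \<noteq> 0" "q \<noteq> 0" "u x = 1 - p" "cnj (u y) = 1 - q"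
        using ne[OF that(1)] by (auto simp: p_def q_def)
      have sq: "(s * p - v * (1 - p)) * (s * q - v * (1 - q)) =
          of_real (C - 1) * p * q + of_real (1 / t - 1) * (1 - p) * (1 - q) - p * (1 - q) - (1 - p) * q"
        using sv(3) unfolding sv(1,2)[symmetric] by algebra
      have C: "of_real C * (1 - of_real t) = (1 :: complex)"
        using t by (simp add: C_def)
      have t': "of_real (1 / t) * of_real (t\<^sup>2) = complex_of_real t"
        using t by (simp add: power2_eq_square)
      have t'': "of_real (1 / t - 1) = of_real (1 / t) - (1 :: complex)" "of_real (C - 1) = of_real C - (1 :: complex)"
        by simp_all
      have "of_real (1 / t) * (K x y * (of_real (t\<^sup>2) - (1 - p) * (1 - q))) + (s * p - v * (1 - p)) * (s * q - v * (1 - q)) * K x y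
        = K x y * (of_real C * (p * q) - (1 - of_real t))"
      proof -
        have "T * (k * (t2 - (1 - p) * (1 - q))) + ((c - 1) * p * q + (T - 1) * (1 - p) * (1 - q) - p * (1 - q) - (1 - p) * q) * k
           = k * (c * (p * q) - (1 - tt))" if "T * t2 = tt" for T t2 c k tt :: complex
          unfolding that[symmetric] by (simp add: algebra_simps)
        from this[OF t'] show ?thesis unfolding sq t'' .
      qed
      then have *: "of_real C * (of_real (1 / t) * (K x y * (of_real (t\<^sup>2) - (1 - p) * (1 - q))) + (s * p - v * (1 - p)) * (s * q - v * (1 - q)) * K x y)
        = K x y * ((of_real C)\<^sup>2 * (p * q) - 1)"
      proof -
        have "c * (k * (c * (p * q) - r)) = k * (c\<^sup>2 * (p * q) - 1)" if "c * r = 1" for c k r :: complex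
          using that by algebra
        from this[OF C] show ?thesis unfolding \<open>_ = K x y * (of_real C * (p * q) - (1 - of_real t))\<close> .
      qed
      have "K x y * (of_real (C\<^sup>2) - 1 / p * (1 / q)) = 1 / p * (1 / q) * (K x y * ((of_real C)\<^sup>2 * (p * q) - 1))"
        using pq(1,2) by (simp add: field_simps)
      then have "K x y * (of_real (C\<^sup>2) - 1 / p * (1 / q)) = 1 / p * (1 / q) * (of_real C * (of_real (1 / t) * (K x y * (of_real (t\<^sup>2) - (1 - p) * (1 - q))) + (s * p - v * (1 - p)) * (s * q - v * (1 - q)) * K x y))"
        by (simp only: *)
      moreover have "cnj (1 / (1 - u y)) = 1 / q" "cnj (s * (1 - u y) - v * u y) = s * q - v * (1 - q)"
        by (simp_all add: q_def sv(4,5))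
      ultimately show ?thesis
        by (simp only: pq(3,4) diff_diff_eq2 add_diff_cancel_left')
    qed
    ultimately have "psd_kernel X (\<lambda>x y. K x y * (of_real (C\<^sup>2) - (1 / (1 - u x)) * cnj (1 / (1 - u y))))"
      by (rule psd_cong_imp)
    then show ?thesis using t by (simp add: mult_bound_def C_def)
  qed
  have \<theta>0: "\<theta> \<ge> 0" using u by (simp add: mult_bound_def)
  \<comment> \<open>\<open>e n\<close> decreases to \<open>\<theta>\<close> inside the open interval
    from \<open>\<theta>\<close> to 1; this covers \<open>\<theta> = 0\<close>, which the weights in
    \<open>pos\<close> exclude.\<close>
  define e where "e n = \<theta> + (1 - \<theta>) * (1 / real (Suc (Suc n)))" for n
  have e: "e n > \<theta>" "e n < 1" for n
  proof -
    have "(1 - \<theta>) * (1 / real (Suc (Suc n))) < (1 - \<theta>) * 1"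
      using \<theta> by (intro mult_strict_left_mono) auto
    then show "e n > \<theta>" "e n < 1" using \<theta> by (auto simp: e_def)
  qed
  have "(\<lambda>n. 1 / real (Suc (Suc n))) \<longlonglongrightarrow> 0"
    using LIMSEQ_Suc[OF LIMSEQ_inverse_real_of_nat] by (simp add: inverse_eq_divide)
  then have "e \<longlonglongrightarrow> \<theta> + (1 - \<theta>) * 0" unfolding e_def by (intro tendsto_intros)
  then have "(\<lambda>n. 1 / (1 - e n)) \<longlonglongrightarrow> 1 / (1 - \<theta>)" using \<theta> by (intro tendsto_intros) auto
  then show ?thesis
  proof (rule mult_bound_limit[rotated])
    show "mult_bound (\<lambda>x. 1 / (1 - u x)) (1 / (1 - e n))" for n
      using e[of n] \<theta>0 by (intro pos mult_bound_mono[OF u]) auto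
  qed
qed

lemma mult_bound_pointwise:
  assumes "mult_bound \<phi> c" "x \<in> X" "K x x \<noteq> 0"
  shows "cmod (\<phi> x) \<le> c"
proof -
  have "K x x * (of_real (c\<^sup>2) - \<phi> x * cnj (\<phi> x)) \<in> \<real>\<^sub>\<ge>\<^sub>0"
    using assms by (intro psd_diag[of X]) (auto simp: mult_bound_def)
  moreover have "K x x = of_real (Re (K x x))" "Re (K x x) > 0"
    using psd_diag[OF psd_K assms(2)] assms(3) by (auto simp: complex_nonneg_Reals_iff complex_eq_iff)
  moreover from calculation have "complex_of_real (Re (K x x)) * (of_real (c\<^sup>2) - of_real ((cmod (\<phi> x))\<^sup>2)) \<in> \<real>\<^sub>\<ge>\<^sub>0"
    unfolding complex_norm_square by metis
  then have "Re (K x x) * (c\<^sup>2 - (cmod (\<phi> x))\<^sup>2) \<ge> 0"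
    by (simp only: of_real_mult[symmetric] of_real_diff[symmetric] nonneg_Reals_of_real_iff)
  then have "(cmod (\<phi> x))\<^sup>2 \<le> c\<^sup>2" using calculation(3) by (simp add: zero_le_mult_iff)
  then show ?thesis by (rule power2_le_imp_le) (use assms(1) in \<open>simp add: mult_bound_def\<close>)
qed

end

section \<open>Power series with complete Pick coefficients\<close>

locale regular_coeffs =
  fixes a :: "nat \<Rightarrow> real"
  assumes a_pos: "\<And>n. a n > 0" and a_0: "a 0 = 1"
    and a_ratio: "(\<lambda>n. a n / a (Suc n)) \<longlonglongrightarrow> 1"
begin

definition \<kappa> :: "complex \<Rightarrow> complex" where
  "\<kappa> x = (\<Sum>n. of_real (a n) * x ^ n)"

text \<open>\<open>b\<close> is determined by \<open>\<kappa> x = 1 / (1 - \<Sum>n. b n * x ^ n)\<close>.\<close>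

definition b :: "nat \<Rightarrow> real" where
  "b n = (if n = 0 then 0 else - fps_nth (inverse (Abs_fps a)) n)"

definition \<beta> :: "complex \<Rightarrow> complex" where
  "\<beta> x = (\<Sum>n. of_real (b n) * x ^ n)"

lemma power_kernel_eq: "power_kernel a z w = \<kappa> (cinner_prod z w)"
  by (simp add: power_kernel_def \<kappa>_def)

lemma summable_a:
  assumes "cmod x < 1"
  shows "summable (\<lambda>n. norm (of_real (a n) * x ^ n))"
proof (rule abs_summable_in_conv_radius)
  have "conv_radius (\<lambda>n. complex_of_real (a n)) = ereal 1"
    using a_ratio a_pos by (intro conv_radius_ratio_limit) (auto intro!: always_eventually simp: less_imp_neq[symmetric] abs_of_pos)
  then show "ereal (cmod x) < conv_radius (\<lambda>n. complex_of_real (a n))"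
    using assms by simp
qed

lemma summable_a_real:
  assumes "0 \<le> x" "x < 1"
  shows "summable (\<lambda>n. a n * x ^ n)"
  using summable_a[of "of_real x"] assms a_pos by (simp add: norm_mult norm_power abs_of_pos)

lemma b_0: "b 0 = 0" by (simp add: b_def)

lemma b_recursion:
  assumes "n > 0"
  shows "a n = (\<Sum>i<n. a i * b (n - i))"
proof -
  define A where "A = Abs_fps a"
  have "A * inverse A = 1"
    using a_0 by (intro inverse_mult_eq_1') (simp add: A_def)
  then have "(\<Sum>i=0..n. a i * fps_nth (inverse A) (n - i)) = 0"
    using assms fps_mult_nth[of A "inverse A" n] by (simp add: A_def)
  moreover have "{0..n} = insert n {..<n}" by auto
  moreover have "(\<Sum>i<n. a i * b (n - i)) = - (\<Sum>i<n. a i * fps_nth (inverse A) (n - i))"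
    unfolding sum_negf[symmetric] by (intro sum.cong) (auto simp: b_def A_def)
  moreover have "fps_nth (inverse A) 0 = 1" by (simp add: A_def a_0)
  ultimately show ?thesis by simp
qed

text \<open>The Cauchy product form of \<open>b_recursion\<close>. Convergence of the series of
  \<open>b\<close> is a hypothesis because, before the signs of the \<open>b n\<close> are known, it
  is available only near 0.\<close>

lemma kappa_beta:
  assumes x: "cmod x < 1" and s: "summable (\<lambda>n. norm (of_real (b n) * x ^ n))"
  shows "\<kappa> x * (1 - \<beta> x) = 1"
proof -
  define d where "d n = (if n = 0 then 1 else 0) - b n" for n
  have e: "of_real (d n) * x ^ n = (if n = 0 then 1 else 0) - of_real (b n) * x ^ n" for n
    by (simp add: d_def)
  have s1: "summable (\<lambda>n. if n = 0 then 1 else 0 :: complex)" by (rule summable_single)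
  have sums1: "(\<Sum>n. if n = 0 then 1 else 0 :: complex) = 1"
    using sums_single[of 0 "\<lambda>_. 1 :: complex"] by (simp add: sums_iff)
  have d1: "(\<Sum>n. of_real (d n) * x ^ n) = 1 - \<beta> x"
    unfolding e \<beta>_def using suminf_diff[OF s1 summable_norm_cancel[OF s]] sums1 by simp
  have "summable (\<lambda>n. norm (of_real (d n) * x ^ n))"
  proof (rule summable_comparison_test')
    show "summable (\<lambda>n. (if n = 0 then 1 else 0) + norm (of_real (b n) * x ^ n))"
      by (intro summable_add summable_single s)
    show "norm (norm (of_real (d n) * x ^ n)) \<le> (if n = 0 then 1 else 0) + norm (of_real (b n) * x ^ n)" if "n \<ge> 0" for n
      unfolding e using norm_triangle_ineq4[of "if n = 0 then 1 else 0" "of_real (b n) * x ^ n"] by (auto split: if_splits)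
  qed
  then have "\<kappa> x * (1 - \<beta> x) = (\<Sum>k. \<Sum>i\<le>k. (of_real (a i) * x ^ i) * (of_real (d (k - i)) * x ^ (k - i)))"
    unfolding d1[symmetric] \<kappa>_def by (intro Cauchy_product summable_a x)
  also have "(\<lambda>k. \<Sum>i\<le>k. (of_real (a i) * x ^ i) * (of_real (d (k - i)) * x ^ (k - i))) = (\<lambda>k. if k = 0 then 1 else 0)"
  proof
    fix k
    have "(\<Sum>i\<le>k. (of_real (a i) * x ^ i) * (of_real (d (k - i)) * x ^ (k - i))) = of_real (\<Sum>i\<le>k. a i * d (k - i)) * x ^ k"
      unfolding of_real_sum sum_distrib_right
      by (intro sum.cong refl) (simp add: power_add[symmetric] mult_ac)
    moreover have "(\<Sum>i\<le>k. a i * d (k - i)) = (if k = 0 then 1 else 0)"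
    proof (cases "k = 0")
      case False
      have "{..k} = insert k {..<k}" by auto
      moreover have "(\<Sum>i<k. a i * d (k - i)) = - (\<Sum>i<k. a i * b (k - i))"
        unfolding sum_negf[symmetric] by (intro sum.cong) (auto simp: d_def)
      ultimately show ?thesis using b_recursion[of k] False by (simp add: d_def b_0)
    qed (simp add: a_0 d_def b_0)
    ultimately show "(\<Sum>i\<le>k. (of_real (a i) * x ^ i) * (of_real (d (k - i)) * x ^ (k - i))) = (if k = 0 then 1 else 0)"
      by simp
  qed
  finally show ?thesis using sums1 by simp
qed

text \<open>If the sum of \<open>a i * s ^ i\<close> over \<open>i \<ge> 1\<close> is at most 1, the
  recursion propagates \<open>\<bar>b n\<bar> * s ^ n \<le> 1\<close> by strong induction.\<close>

lemma b_small_radius: "\<exists>s>0. s < 1 \<and> (\<forall>n. \<bar>b n\<bar> * s ^ n \<le> 1)"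
proof -
  define M where "M = (\<Sum>n. a n * (1/2) ^ n)"
  have sm: "summable (\<lambda>n. a n * (1/2) ^ n)" by (rule summable_a_real) auto
  have M: "(\<Sum>n\<in>I. a n * (1/2) ^ n) \<le> M" if "finite I" for I
    unfolding M_def using that a_pos by (intro sum_le_suminf sm) (auto intro: less_imp_le)
  have M1: "M \<ge> 1" using M[of "{0}"] by (simp add: a_0)
  \<comment> \<open>For \<open>i \<ge> 1\<close>, \<open>r ^ i \<le> r\<close>, so halving
    \<open>r\<close> bounds the sum in \<open>small\<close> by \<open>r * M = 1\<close>.\<close>
  define r where "r = 1 / M"
  have r: "0 < r" "r \<le> 1" using M1 by (auto simp: r_def)
  define s where "s = r / 2"
  have s: "s > 0" "s < 1" using r by (auto simp: s_def)
  have small: "(\<Sum>i\<in>I. a i * s ^ i) \<le> 1" if I: "finite I" "0 \<notin> I" for I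
  proof -
    have "a i * s ^ i \<le> r * (a i * (1/2) ^ i)" if i: "i \<in> I" for i
    proof -
      have "i \<noteq> 0" using i I by metis
      then have "r ^ i \<le> r ^ 1" using r by (intro power_decreasing) auto
      then have "r ^ i * (a i * (1/2) ^ i) \<le> r * (a i * (1/2) ^ i)"
        using a_pos[of i] by (intro mult_right_mono) auto
      then show ?thesis by (simp add: s_def power_divide mult_ac)
    qed
    then have "(\<Sum>i\<in>I. a i * s ^ i) \<le> (\<Sum>i\<in>I. r * (a i * (1/2) ^ i))" by (rule sum_mono)
    also have "\<dots> = r * (\<Sum>i\<in>I. a i * (1/2) ^ i)" by (simp add: sum_distrib_left)
    also have "\<dots> \<le> r * M" using M[OF I(1)] r by (intro mult_left_mono) auto
    also have "\<dots> = 1" using M1 by (simp add: r_def)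
    finally show ?thesis .
  qed
  have "\<bar>b n\<bar> * s ^ n \<le> 1" for n
  proof (induction n rule: less_induct)
    case (less n)
    show ?case
    proof (cases "n = 0")
      case False
      have split: "{..<n} = insert 0 {0<..<n}" using False by auto
      have "a n = b n + (\<Sum>i\<in>{0<..<n}. a i * b (n - i))"
        using b_recursion[of n] False unfolding split by (simp add: a_0)
      then have "\<bar>b n\<bar> \<le> a n + \<bar>\<Sum>i\<in>{0<..<n}. a i * b (n - i)\<bar>" using a_pos[of n] by linarith
      also have "\<bar>\<Sum>i\<in>{0<..<n}. a i * b (n - i)\<bar> \<le> (\<Sum>i\<in>{0<..<n}. a i * \<bar>b (n - i)\<bar>)"
        using sum_abs[of "\<lambda>i. a i * b (n - i)" "{0<..<n}"] a_pos by (simp add: abs_mult abs_of_pos)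
      finally have "\<bar>b n\<bar> * s ^ n \<le> (a n + (\<Sum>i\<in>{0<..<n}. a i * \<bar>b (n - i)\<bar>)) * s ^ n"
        using s by (intro mult_right_mono) auto
      also have "\<dots> = a n * s ^ n + (\<Sum>i\<in>{0<..<n}. a i * s ^ i * (\<bar>b (n - i)\<bar> * s ^ (n - i)))"
        unfolding distrib_right sum_distrib_right
        by (intro arg_cong2[of _ _ _ _ "(+)"] refl sum.cong) (auto simp: power_add[symmetric])
      also have "\<dots> \<le> a n * s ^ n + (\<Sum>i\<in>{0<..<n}. a i * s ^ i * 1)"
        using less s a_pos by (intro add_left_mono sum_mono mult_left_mono) (auto intro: less_imp_le)
      also have "\<dots> = (\<Sum>i\<in>insert n {0<..<n}. a i * s ^ i)" by simp
      also have "\<dots> \<le> 1" using False by (intro small) auto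
      finally show ?thesis .
    qed (simp add: b_0)
  qed
  with s show ?thesis by blast
qed

lemma summable_b_small:
  assumes s: "0 < s" "\<And>n. \<bar>b n\<bar> * s ^ n \<le> 1" and x: "cmod x < s"
  shows "summable (\<lambda>n. norm (of_real (b n) * x ^ n))"
proof (rule summable_comparison_test')
  show "summable (\<lambda>n. (cmod x / s) ^ n)" using s x by (intro summable_geometric) simp
  show "norm (norm (of_real (b n) * x ^ n)) \<le> (cmod x / s) ^ n" if "n \<ge> 0" for n
  proof -
    have "norm (of_real (b n) * x ^ n) = (\<bar>b n\<bar> * s ^ n) * (cmod x / s) ^ n"
      using s by (simp add: norm_mult norm_power power_divide)
    also have "\<dots> \<le> 1 * (cmod x / s) ^ n" using s by (intro mult_right_mono) auto
    finally show ?thesis by simp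
  qed
qed

text \<open>Averaging the psd condition over the \<open>N\<close>-th roots of unity isolates \<open>b n\<close> up to a tail
  \<open>\<Sum>m\<ge>N\<close> of the series.\<close>

lemma b_nonneg:
  assumes psd: "psd_kernel (ball (0 :: complex ^ 'd::finite) 1) (\<lambda>x y. 1 - 1 / power_kernel a x y)"
  shows "b n \<ge> 0"
proof -
  obtain s where s: "0 < s" "s < 1" "\<And>n. \<bar>b n\<bar> * s ^ n \<le> 1" using b_small_radius by blast
  \<comment> \<open>The test points have norm \<open>t\<close>, and their inner products have
    modulus \<open>q = t\<^sup>2\<close>, which must lie in the disc where the series of
    \<open>b\<close> is known to converge.\<close>
  define t where "t = s / 2"
  have t: "0 < t" "t < s" "t < 1" using s by (auto simp: t_def)
  define q where "q = t\<^sup>2"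
  have q: "0 < q" "q < s" "q < 1"
  proof -
    have "t * t < 1 * s" using t by (intro mult_strict_mono) auto
    then show "0 < q" "q < s" "q < 1" using t s by (auto simp: q_def power2_eq_square)
  qed
  have sb: "summable (\<lambda>m. norm (of_real (b m) * complex_of_real q ^ m))"
    using q by (intro summable_b_small[OF s(1,3)]) auto
  then have sb': "summable (\<lambda>m. \<bar>b m\<bar> * q ^ m)" using q by (simp add: norm_mult norm_power)
  obtain k :: 'd where True by blast
  have main: "0 \<le> b n * q ^ n + (\<Sum>m. \<bar>b (m + N)\<bar> * q ^ (m + N))" if N: "N > n" for N
  proof -
    define \<omega> where "\<omega> = cis (2 * pi / real N)"
    have \<omega>j: "\<omega> ^ j = cis (2 * pi * real j / real N)" for j
      unfolding \<omega>_def Complex.DeMoivre by (rule arg_cong[of _ _ cis]) simp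
    have \<omega>1: "\<omega> ^ j * cnj (\<omega> ^ j) = 1" for j by (simp add: \<omega>j cis_cnj cis_mult)
    \<comment> \<open>\<open>N\<close> equally spaced points on a circle in one coordinate line; any
      coordinate \<open>k\<close> serves.\<close>
    define z where "z j = (\<chi> i. if i = k then of_real t * \<omega> ^ j else 0)" for j
    have zip: "cinner_prod (z j) (z l) = of_real q * (\<omega> ^ j * cnj (\<omega> ^ l))" for j l
      by (simp add: cinner_prod_def z_def if_distrib if_distribR sum.delta q_def power2_eq_square cong: if_cong)
    have zball: "z j \<in> ball 0 1" for j
    proof -
      have "norm (z j) = t"
      proof -
        have "(norm (z j $ i))\<^sup>2 = (if i = k then t\<^sup>2 else 0)" for i
          using t by (simp add: z_def norm_mult norm_power \<omega>_def)
        then show ?thesis using t by (simp add: norm_vec_def L2_set_def)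
      qed
      then show ?thesis using t by simp
    qed
    \<comment> \<open>The character sum: for \<open>m < N\<close> it is \<open>N\<close> at
      \<open>m = n\<close> and zero otherwise. From \<open>N\<close> on only the bound by
      \<open>N\<close> is used, and those indices form the tail.\<close>
    define S where "S m = (\<Sum>j<N. cnj (\<omega> ^ j) ^ n * (\<omega> ^ j) ^ m)" for m
    have Sle: "cmod (S m) \<le> N" for m
      unfolding S_def using sum_norm_le[of "{..<N}" "\<lambda>j. cnj (\<omega> ^ j) ^ n * (\<omega> ^ j) ^ m" "\<lambda>_. 1"]
      by (simp add: norm_mult norm_power \<omega>_def)
    have Sn: "S n = of_nat N"
    proof -
      have "cnj (\<omega> ^ j) * \<omega> ^ j = 1" for j using \<omega>1[of j] by (simp only: mult.commute)
      then show ?thesis unfolding S_def power_mult_distrib[symmetric] by (simp only:) simp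
    qed
    have S0: "S m = 0" if m: "m < N" "m \<noteq> n" for m
    proof -
      define v where "v = cnj \<omega> ^ n * \<omega> ^ m"
      have "S m = (\<Sum>j<N. v ^ j)"
        unfolding S_def v_def by (intro sum.cong refl) (simp add: power_mult_distrib power_mult[symmetric] mult.commute)
      moreover have "v ^ N = 1"
      proof -
        have "\<omega> ^ N = 1" using N by (simp add: \<omega>j)
        moreover have "v ^ N = cnj (\<omega> ^ N) ^ n * (\<omega> ^ N) ^ m"
          unfolding v_def power_mult_distrib complex_cnj_power power_mult[symmetric] by (simp only: mult.commute)
        ultimately show ?thesis by simp
      qed
      moreover have "v \<noteq> 1"
      proof
        assume "v = 1"
        then have "\<omega> ^ n * v = \<omega> ^ n" by simp
        moreover have "\<omega> ^ n * v = (\<omega> ^ n * cnj (\<omega> ^ n)) * \<omega> ^ m" by (simp add: v_def)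
        ultimately have "\<omega> ^ m = \<omega> ^ n" unfolding \<omega>1 by simp
        moreover have "inj_on (\<lambda>k. cis (2 * pi * real k / real N)) {..<N}"
          using Complex.bij_betw_roots_unity[of N] N by (simp add: bij_betw_def)
        ultimately show False using m N unfolding \<omega>j inj_on_def by auto
      qed
      ultimately show ?thesis by (simp add: sum_gp_strict)
    qed
    have "qform {..<N} (\<lambda>j. (\<omega> ^ j) ^ n) (\<lambda>i j. 1 - 1 / power_kernel a (z i) (z j)) \<in> \<real>\<^sub>\<ge>\<^sub>0"
      using zball by (intro psd_family[OF psd]) auto
    moreover have "qform {..<N} (\<lambda>j. (\<omega> ^ j) ^ n) (\<lambda>i j. 1 - 1 / power_kernel a (z i) (z j)) =
        (\<Sum>m. of_real (b m * q ^ m * (cmod (S m))\<^sup>2))"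
    proof -
      have x: "cmod (of_real q * (\<omega> ^ i * cnj (\<omega> ^ j))) = q" for i j
        using q by (simp add: norm_mult norm_power \<omega>_def)
      have sm: "summable (\<lambda>n. norm (of_real (b n) * (of_real q * (\<omega> ^ i * cnj (\<omega> ^ j))) ^ n))" for i j
        using x q by (intro summable_b_small[OF s(1,3)]) auto
      have "1 - 1 / power_kernel a (z i) (z j) = (\<Sum>m. of_real (b m) * (of_real q * (\<omega> ^ i * cnj (\<omega> ^ j))) ^ m)" for i j
      proof -
        have "\<kappa> (of_real q * (\<omega> ^ i * cnj (\<omega> ^ j))) * (1 - \<beta> (of_real q * (\<omega> ^ i * cnj (\<omega> ^ j)))) = 1"
          using x q sm by (intro kappa_beta) auto
        then have "1 - 1 / \<kappa> (of_real q * (\<omega> ^ i * cnj (\<omega> ^ j))) = \<beta> (of_real q * (\<omega> ^ i * cnj (\<omega> ^ j)))"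
        proof -
          have "1 - 1 / u = w" if "u * (1 - w) = 1" for u w :: complex
            using that by (cases "u = 0") (auto simp: field_simps)
          then show ?thesis using \<open>_ * (1 - _) = 1\<close> by blast
        qed
        then show ?thesis unfolding power_kernel_eq zip by (simp add: \<beta>_def)
      qed
      then have "qform {..<N} (\<lambda>j. (\<omega> ^ j) ^ n) (\<lambda>i j. 1 - 1 / power_kernel a (z i) (z j)) =
        (\<Sum>i<N. \<Sum>j<N. \<Sum>m. cnj ((\<omega> ^ i) ^ n) * (\<omega> ^ j) ^ n * (of_real (b m) * (of_real q * (\<omega> ^ i * cnj (\<omega> ^ j))) ^ m))"
        unfolding qform_def using summable_norm_cancel[OF sm] by (simp only: suminf_mult)
      also have "\<dots> = (\<Sum>m. \<Sum>i<N. \<Sum>j<N. cnj ((\<omega> ^ i) ^ n) * (\<omega> ^ j) ^ n * (of_real (b m) * (of_real q * (\<omega> ^ i * cnj (\<omega> ^ j))) ^ m))"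
        using summable_norm_cancel[OF sm]
        by (intro sums_unique sums_sum summable_sums summable_mult)
      also have "(\<lambda>m. \<Sum>i<N. \<Sum>j<N. cnj ((\<omega> ^ i) ^ n) * (\<omega> ^ j) ^ n * (of_real (b m) * (of_real q * (\<omega> ^ i * cnj (\<omega> ^ j))) ^ m))
         = (\<lambda>m. of_real (b m * q ^ m * (cmod (S m))\<^sup>2))"
      proof
        fix m
        have "of_real (b m * q ^ m * (cmod (S m))\<^sup>2) = of_real (b m * q ^ m) * (S m * cnj (S m))"
          by (simp only: of_real_mult complex_norm_square)
        also have "S m * cnj (S m) = (\<Sum>i<N. \<Sum>j<N. cnj ((\<omega> ^ i) ^ n) * (\<omega> ^ i) ^ m * ((\<omega> ^ j) ^ n * cnj (\<omega> ^ j) ^ m))"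
          unfolding S_def cnj_sum sum_product by simp
        finally show "(\<Sum>i<N. \<Sum>j<N. cnj ((\<omega> ^ i) ^ n) * (\<omega> ^ j) ^ n * (of_real (b m) * (of_real q * (\<omega> ^ i * cnj (\<omega> ^ j))) ^ m))
           = of_real (b m * q ^ m * (cmod (S m))\<^sup>2)"
          by (simp add: sum_distrib_left power_mult_distrib mult_ac)
      qed
      finally show ?thesis .
    qed
    ultimately have nn: "(\<Sum>m. complex_of_real (b m * q ^ m * (cmod (S m))\<^sup>2)) \<in> \<real>\<^sub>\<ge>\<^sub>0" by simp
    have bd: "\<bar>b m * q ^ m * (cmod (S m))\<^sup>2\<bar> \<le> (real N)\<^sup>2 * (\<bar>b m\<bar> * q ^ m)" for m
    proof -
      have "(cmod (S m))\<^sup>2 \<le> (real N)\<^sup>2" using Sle[of m] by (intro power_mono) auto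
      then have "\<bar>b m\<bar> * q ^ m * (cmod (S m))\<^sup>2 \<le> \<bar>b m\<bar> * q ^ m * (real N)\<^sup>2"
        using q by (intro mult_left_mono) auto
      then show ?thesis using q by (simp add: abs_mult mult_ac)
    qed
    have sS: "summable (\<lambda>m. b m * q ^ m * (cmod (S m))\<^sup>2)"
      using bd by (intro summable_comparison_test'[OF summable_mult[OF sb', of "(real N)\<^sup>2"], of 0]) (simp only: real_norm_def)
    have sb'': "summable (\<lambda>m. \<bar>b (m + N)\<bar> * q ^ (m + N))"
      using summable_ignore_initial_segment[OF sb', of N] .
    have "0 \<le> (\<Sum>m. b m * q ^ m * (cmod (S m))\<^sup>2)"
      using nn unfolding suminf_of_real[OF sS, symmetric] by (simp only: nonneg_Reals_of_real_iff)
    also have "\<dots> = (\<Sum>m. b (m + N) * q ^ (m + N) * (cmod (S (m + N)))\<^sup>2) + (\<Sum>m<N. b m * q ^ m * (cmod (S m))\<^sup>2)"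
      by (rule suminf_split_initial_segment[OF sS])
    also have "(\<Sum>m<N. b m * q ^ m * (cmod (S m))\<^sup>2) = (\<Sum>m\<in>{n}. b m * q ^ m * (cmod (S m))\<^sup>2)"
      using N S0 by (intro sum.mono_neutral_right) auto
    also have "\<dots> = (real N)\<^sup>2 * (b n * q ^ n)" by (simp add: Sn)
    also have "(\<Sum>m. b (m + N) * q ^ (m + N) * (cmod (S (m + N)))\<^sup>2) \<le> (\<Sum>m. (real N)\<^sup>2 * (\<bar>b (m + N)\<bar> * q ^ (m + N)))"
      by (intro suminf_le summable_mult sb'' summable_ignore_initial_segment[OF sS] order_trans[OF abs_ge_self bd])
    also have "\<dots> = (real N)\<^sup>2 * (\<Sum>m. \<bar>b (m + N)\<bar> * q ^ (m + N))"
      by (rule suminf_mult[OF sb''])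
    finally have "0 \<le> (real N)\<^sup>2 * (b n * q ^ n + (\<Sum>m. \<bar>b (m + N)\<bar> * q ^ (m + N)))"
      by (simp add: distrib_left add.commute)
    then show ?thesis using N by (simp add: zero_le_mult_iff)
  qed
  have "(\<lambda>N. \<Sum>m. \<bar>b (m + N)\<bar> * q ^ (m + N)) \<longlonglongrightarrow> 0"
    using suminf_exist_split2[OF sb'] by simp
  then have "(\<lambda>N. b n * q ^ n + (\<Sum>m. \<bar>b (m + N)\<bar> * q ^ (m + N))) \<longlonglongrightarrow> b n * q ^ n + 0"
    by (intro tendsto_intros)
  then have "0 \<le> b n * q ^ n + 0"
    by (rule LIMSEQ_le_const) (use main in \<open>auto intro!: exI[of _ "Suc n"]\<close>)
  moreover have "q ^ n > 0" using q by simp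
  ultimately show ?thesis by (simp add: zero_le_mult_iff)
qed

end

section \<open>Non-negative coefficients \<open>b\<close> and the resulting bounds for the
  kernel\<close>

locale pick_coeffs = regular_coeffs +
  assumes b_nn: "\<And>n. b n \<ge> 0"
begin

text \<open>Comparison with \<open>a\<close> extends the convergence of \<open>\<beta>\<close> from
  a small disc to the whole unit disc.\<close>

lemma b_le_a: "b n \<le> a n"
proof (cases "n = 0")
  case False
  have split: "{..<n} = insert 0 {0<..<n}" using False by auto
  have "a n = b n + (\<Sum>i\<in>{0<..<n}. a i * b (n - i))"
    using b_recursion[of n] False unfolding split by (simp add: a_0)
  moreover have "(\<Sum>i\<in>{0<..<n}. a i * b (n - i)) \<ge> 0"
    using a_pos b_nn by (intro sum_nonneg mult_nonneg_nonneg) (auto intro: less_imp_le)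
  ultimately show ?thesis by linarith
qed (simp add: b_0 a_0)

lemma b_1: "b 1 = a 1"
  using b_recursion[of 1] by (simp add: a_0)

lemma summable_b:
  assumes "cmod x < 1"
  shows "summable (\<lambda>n. norm (of_real (b n) * x ^ n))"
proof (rule summable_comparison_test'[OF summable_a[OF assms], where N = 0])
  show "norm (norm (of_real (b n) * x ^ n)) \<le> norm (of_real (a n) * x ^ n)" for n
    using b_nn[of n] b_le_a[of n] by (simp add: norm_mult mult_right_mono)
qed

lemma kappa_mult_beta: "cmod x < 1 \<Longrightarrow> \<kappa> x * (1 - \<beta> x) = 1"
  using kappa_beta summable_b by blast

lemma kappa_eq: "cmod x < 1 \<Longrightarrow> \<kappa> x = 1 / (1 - \<beta> x)"
  using kappa_mult_beta[of x] by (metis mult_zero_right nonzero_eq_divide_eq zero_neq_one)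

lemma kappa_nonzero: "cmod x < 1 \<Longrightarrow> \<kappa> x \<noteq> 0"
  using kappa_mult_beta[of x] by auto

lemma beta_eq: "cmod x < 1 \<Longrightarrow> \<beta> x = 1 - 1 / \<kappa> x"
  using kappa_mult_beta[of x] kappa_nonzero[of x] by (simp add: field_simps)

lemma summable_b_real:
  assumes "0 \<le> x" "x < 1"
  shows "summable (\<lambda>n. b n * x ^ n)"
  using summable_b[of "of_real x"] assms b_nn by (simp add: norm_mult norm_power)

lemma kappa_real:
  assumes "0 \<le> x" "x < 1"
  shows "\<kappa> (of_real x) = of_real (\<Sum>n. a n * x ^ n)" "1 \<le> (\<Sum>n. a n * x ^ n)"
proof -
  note s = summable_a_real[OF assms]
  show "\<kappa> (of_real x) = of_real (\<Sum>n. a n * x ^ n)"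
    using suminf_of_real[OF s, where 'a = complex] by (simp add: \<kappa>_def)
  have "(\<Sum>n\<in>{0}. a n * x ^ n) \<le> (\<Sum>n. a n * x ^ n)"
    using assms a_pos by (intro sum_le_suminf s) (auto intro!: mult_nonneg_nonneg intro: less_imp_le)
  then show "1 \<le> (\<Sum>n. a n * x ^ n)" by (simp add: a_0)
qed

lemma beta_real:
  assumes "0 \<le> x" "x < 1"
  shows "\<beta> (of_real x) = of_real (\<Sum>n. b n * x ^ n)" "(\<Sum>n. b n * x ^ n) < 1"
proof -
  show *: "\<beta> (of_real x) = of_real (\<Sum>n. b n * x ^ n)"
    using suminf_of_real[OF summable_b_real[OF assms], where 'a = complex] by (simp add: \<beta>_def)
  have "complex_of_real (\<Sum>n. b n * x ^ n) = of_real (1 - 1 / (\<Sum>n. a n * x ^ n))"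
    using beta_eq[of "of_real x"] assms unfolding * kappa_real[OF assms] by simp
  then have "(\<Sum>n. b n * x ^ n) = 1 - 1 / (\<Sum>n. a n * x ^ n)" by (simp only: of_real_eq_iff)
  then show "(\<Sum>n. b n * x ^ n) < 1" using kappa_real(2)[OF assms] by simp
qed

text \<open>On the interval from 0 to 1, \<open>\<beta> = 1 - 1 / \<kappa>\<close> stays below 1;
  finite partial sums inherit the bound as \<open>x\<close> tends to 1.\<close>

lemma sum_b_le_1:
  assumes "finite I"
  shows "(\<Sum>n\<in>I. b n) \<le> 1"
proof -
  have ev: "\<forall>\<^sub>F x in at_left (1::real). (\<Sum>n\<in>I. b n * x ^ n) \<le> 1"
  proof (rule eventually_at_leftI[of 0])
    fix x :: real assume "x \<in> {0<..<1}"
    then have x: "0 \<le> x" "x < 1" by auto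
    have "(\<Sum>n\<in>I. b n * x ^ n) \<le> (\<Sum>n. b n * x ^ n)"
      using b_nn x by (intro sum_le_suminf summable_b_real assms) auto
    then show "(\<Sum>n\<in>I. b n * x ^ n) \<le> 1" using beta_real(2)[OF x] by simp
  qed simp
  have "((\<lambda>x. \<Sum>n\<in>I. b n * x ^ n) \<longlongrightarrow> (\<Sum>n\<in>I. b n * 1 ^ n)) (at_left 1)"
    by (intro tendsto_intros)
  from tendsto_upperbound[OF this ev] show ?thesis by simp
qed

lemma norm_beta_le: 
  assumes "cmod x < 1"
  shows "cmod (\<beta> x) < 1"
proof -
  have "cmod (\<beta> x) \<le> (\<Sum>n. norm (of_real (b n) * x ^ n))"
    unfolding \<beta>_def by (rule summable_norm[OF summable_b[OF assms]])
  also have "\<dots> = (\<Sum>n. b n * cmod x ^ n)" using b_nn by (simp add: norm_mult norm_power)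
  also have "\<dots> < 1" using assms by (intro beta_real) auto
  finally show ?thesis .
qed

lemma Re_kappa_nonneg: "cmod x < 1 \<Longrightarrow> Re (\<kappa> x) \<ge> 0"
  using norm_beta_le[of x] complex_Re_le_cmod[of "\<beta> x"]
  by (simp add: kappa_eq Re_divide divide_nonneg_nonneg)

text \<open>The estimate that makes potentials small away from their mass. In
  \<open>Re (\<beta> x)\<close> the linear term \<open>a 1 * Re x\<close> is kept exactly and every
  other term is bounded by its coefficient; these coefficients sum to at most
  \<open>1 - a 1\<close>. This gives
  \<open>Re (1 - \<beta> x) \<ge> a 1 * (1 - Re x)\<close>.\<close>

lemma norm_kappa_le:
  assumes x: "cmod x < 1"
  shows "cmod (\<kappa> x) \<le> 1 / (a 1 * (1 - Re x))"
proof -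
  have s: "(\<lambda>n. Re (of_real (b n) * x ^ n)) sums Re (\<beta> x)"
    unfolding \<beta>_def using summable_norm_cancel[OF summable_b[OF x]] by (intro sums_Re summable_sums)
  have "(\<Sum>n<N. Re (of_real (b n) * x ^ n)) \<le> a 1 * Re x + (1 - a 1)" if N: "N > 1" for N
  proof -
    have split: "{..<N} = insert 1 ({..<N} - {1})" using N by auto
    have "Re (of_real (b n) * x ^ n) \<le> b n" for n
    proof -
      have "Re (x ^ n) \<le> 1"
        using complex_Re_le_cmod[of "x ^ n"] x by (simp add: norm_power) (meson norm_ge_zero order_trans power_le_one less_imp_le)
      then show ?thesis using b_nn[of n] mult_left_mono[of "Re (x ^ n)" 1 "b n"] by simp
    qed
    then have "(\<Sum>n\<in>{..<N} - {1}. Re (of_real (b n) * x ^ n)) \<le> (\<Sum>n\<in>{..<N} - {1}. b n)" by (intro sum_mono)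
    moreover have "a 1 + (\<Sum>n\<in>{..<N} - {1}. b n) \<le> 1"
    proof -
      have "(\<Sum>n\<in>insert 1 ({..<N} - {1}). b n) = b 1 + (\<Sum>n\<in>{..<N} - {1}. b n)"
        by (rule sum.insert) auto
      then show ?thesis using sum_b_le_1[of "insert 1 ({..<N} - {1})"] b_1 by simp
    qed
    moreover have "(\<Sum>n<N. Re (of_real (b n) * x ^ n)) = a 1 * Re x + (\<Sum>n\<in>{..<N} - {1}. Re (of_real (b n) * x ^ n))"
      by (subst split, subst sum.insert) (simp_all add: b_1[unfolded One_nat_def])
    ultimately show ?thesis by linarith
  qed
  then have "Re (\<beta> x) \<le> a 1 * Re x + (1 - a 1)"
    by (intro LIMSEQ_le_const2[OF s[unfolded sums_def]]) (auto intro!: exI[of _ 2])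
  then have "a 1 * (1 - Re x) \<le> Re (1 - \<beta> x)" by (simp add: algebra_simps)
  also have "\<dots> \<le> cmod (1 - \<beta> x)" by (rule complex_Re_le_cmod)
  finally have "a 1 * (1 - Re x) \<le> cmod (1 - \<beta> x)" .
  moreover have "a 1 * (1 - Re x) > 0"
    using a_pos[of 1] x complex_Re_le_cmod[of x] by simp
  ultimately show ?thesis
    unfolding kappa_eq[OF x] norm_divide norm_one by (intro frac_le) auto
qed

lemma kappa_continuous_on: "continuous_on (ball 0 1) \<kappa>"
proof -
  have "isCont \<kappa> x" if x: "x \<in> ball 0 1" for x
  proof -
    obtain r where r: "cmod x < r" "r < 1" using dense[of "cmod x" 1] x by auto
    then have "r > 0" using norm_ge_zero[of x] by linarith
    then show ?thesis
      unfolding \<kappa>_def[abs_def] using r summable_norm_cancel[OF summable_a[of "of_real r"]]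
      by (intro isCont_powser[where K = "of_real r"]) auto
  qed
  then show ?thesis by (auto intro: continuous_at_imp_continuous_on)
qed

end

section \<open>Signed and complex measures\<close>

locale signed_measure =
  fixes M :: "'a measure" and \<rho> :: "'a set \<Rightarrow> real"
  assumes sums: "\<And>A::nat \<Rightarrow> 'a set. range A \<subseteq> sets M \<Longrightarrow> disjoint_family A \<Longrightarrow> (\<lambda>n. \<rho> (A n)) sums \<rho> (\<Union>n. A n)"
begin

lemma signed_measure_uminus: "signed_measure M (\<lambda>A. - \<rho> A)"
  by unfold_locales (use sums in \<open>auto intro: sums_minus\<close>)

lemma rho_empty: "\<rho> {} = 0"
  using sums[of "\<lambda>_. {}"] by (auto simp: disjoint_family_on_def sums_iff summable_const_iff)

lemma rho_Un:
  assumes "A \<in> sets M" "B \<in> sets M" "A \<inter> B = {}"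
  shows "\<rho> (A \<union> B) = \<rho> A + \<rho> B"
proof -
  have "(\<lambda>n. \<rho> (binaryset A B n)) sums \<rho> (\<Union>n. binaryset A B n)"
    using assms by (intro sums) (auto simp: range_binaryset_eq disjoint_family_on_def binaryset_def)
  moreover have "(\<lambda>n. \<rho> (binaryset A B n)) sums (\<rho> A + \<rho> B)"
    by (rule binaryset_sums) (rule rho_empty)
  ultimately show ?thesis by (simp add: UN_binaryset_eq sums_iff)
qed

lemma rho_Diff:
  assumes "A \<in> sets M" "B \<in> sets M" "B \<subseteq> A"
  shows "\<rho> (A - B) = \<rho> A - \<rho> B"
  using rho_Un[of B "A - B"] assms by (simp add: Un_absorb1)

definition pos :: "'a set \<Rightarrow> ennreal" where
  "pos A = (SUP B\<in>{B \<in> sets M. B \<subseteq> A}. ennreal (\<rho> B))"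

lemma pos_upper: "B \<in> sets M \<Longrightarrow> B \<subseteq> A \<Longrightarrow> ennreal (\<rho> B) \<le> pos A"
  unfolding pos_def by (intro SUP_upper) auto

lemma pos_least: "(\<And>B. B \<in> sets M \<Longrightarrow> B \<subseteq> A \<Longrightarrow> ennreal (\<rho> B) \<le> c) \<Longrightarrow> pos A \<le> c"
  unfolding pos_def by (intro SUP_least) auto

lemma pos_empty: "pos {} = 0"
  using rho_empty by (intro antisym pos_least) auto

lemma pos_Un_le:
  assumes "A \<in> sets M" "B \<in> sets M" "A \<inter> B = {}"
  shows "pos (A \<union> B) \<le> pos A + pos B"
proof (rule pos_least)
  fix C assume C: "C \<in> sets M" "C \<subseteq> A \<union> B"
  have "C = (C \<inter> A) \<union> (C \<inter> B)" using C by auto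
  then have "\<rho> C = \<rho> (C \<inter> A) + \<rho> (C \<inter> B)"
    using rho_Un[of "C \<inter> A" "C \<inter> B"] assms C by auto
  then have "ennreal (\<rho> C) \<le> ennreal (\<rho> (C \<inter> A)) + ennreal (\<rho> (C \<inter> B))"
    by (simp add: ennreal_plus_if) (auto simp: ennreal_leI)
  also have "\<dots> \<le> pos A + pos B" using assms C by (intro add_mono pos_upper) auto
  finally show "ennreal (\<rho> C) \<le> pos A + pos B" .
qed

lemma pos_Un_ge:
  assumes "A \<in> sets M" "B \<in> sets M" "A \<inter> B = {}"
  shows "pos A + pos B \<le> pos (A \<union> B)"
proof -
  have ne: "{C \<in> sets M. C \<subseteq> X} \<noteq> {}" for X by auto
  have "ennreal (\<rho> C) + ennreal (\<rho> D) \<le> pos (A \<union> B)"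
    if "C \<in> sets M" "C \<subseteq> A" "D \<in> sets M" "D \<subseteq> B" for C D
  proof -
    have "ennreal (\<rho> C) \<le> pos (A \<union> B)" "ennreal (\<rho> D) \<le> pos (A \<union> B)" "ennreal (\<rho> (C \<union> D)) \<le> pos (A \<union> B)"
      using that by (auto intro!: pos_upper)
    moreover have "\<rho> (C \<union> D) = \<rho> C + \<rho> D" using that assms by (intro rho_Un) auto
    \<comment> \<open>If a charge is negative its truncation is 0, and the other set alone gives the
      bound.\<close>
    ultimately show ?thesis by (cases "\<rho> C \<ge> 0"; cases "\<rho> D \<ge> 0") (auto simp: ennreal_neg)
  qed
  note 1 = this
  have "ennreal (\<rho> C) + pos B \<le> pos (A \<union> B)" if "C \<in> sets M" "C \<subseteq> A" for C
  proof -
    have "ennreal (\<rho> C) + pos B = (SUP D\<in>{D \<in> sets M. D \<subseteq> B}. ennreal (\<rho> C) + ennreal (\<rho> D))"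
      unfolding pos_def by (rule ennreal_SUP_add_right[OF ne])
    also have "\<dots> \<le> pos (A \<union> B)"
      using 1 that by (intro SUP_least) auto
    finally show ?thesis .
  qed
  moreover have "pos A + pos B = (SUP C\<in>{C \<in> sets M. C \<subseteq> A}. ennreal (\<rho> C) + pos B)"
    unfolding pos_def by (rule ennreal_SUP_add_left[OF ne, symmetric])
  ultimately show ?thesis by (auto intro: SUP_least)
qed

lemma pos_Un: "A \<in> sets M \<Longrightarrow> B \<in> sets M \<Longrightarrow> A \<inter> B = {} \<Longrightarrow> pos (A \<union> B) = pos A + pos B"
  using pos_Un_le pos_Un_ge by (intro antisym)

lemma pos_mono: "A \<subseteq> B \<Longrightarrow> pos A \<le> pos B"
  by (intro pos_least pos_upper) auto

text \<open>\<open>positive_part\<close> is built with \<open>measure_of\<close>, which takes the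
  given supremum as its value only for a countably additive set function.\<close>

lemma pos_countably_additive: "countably_additive (sets M) pos"
  unfolding countably_additive_def
proof safe
  fix A :: "nat \<Rightarrow> 'a set"
  assume A: "range A \<subseteq> sets M" "disjoint_family A"
  have Am: "A i \<in> sets M" for i using A by auto
  have fin: "(\<Sum>i<n. pos (A i)) = pos (\<Union>i<n. A i)" for n
  proof (induction n)
    case (Suc n)
    have "A i \<inter> A n = {}" if "i < n" for i using disjoint_family_onD[OF A(2), of i n] that by simp
    then have "(\<Union>i<n. A i) \<inter> A n = {}" by blast
    then have "pos ((\<Union>i<n. A i) \<union> A n) = pos (\<Union>i<n. A i) + pos (A n)"
      using Am by (intro pos_Un) auto
    then show ?case using Suc by (simp add: lessThan_Suc Un_commute)
  qed (simp add: pos_empty)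
  show "(\<Sum>i. pos (A i)) = pos (\<Union>i. A i)"
  proof (rule antisym)
    show "(\<Sum>i. pos (A i)) \<le> pos (\<Union>i. A i)"
      unfolding suminf_eq_SUP fin by (intro SUP_least pos_mono) auto
    show "pos (\<Union>i. A i) \<le> (\<Sum>i. pos (A i))"
    proof (rule pos_least)
      fix B assume B: "B \<in> sets M" "B \<subseteq> (\<Union>i. A i)"
      have "disjoint_family (\<lambda>n. B \<inter> A n)"
        using A(2) by (auto simp: disjoint_family_on_def)
      then have "(\<lambda>n. \<rho> (B \<inter> A n)) sums \<rho> (\<Union>n. B \<inter> A n)"
        using B Am by (intro sums) auto
      moreover have "(\<Union>n. B \<inter> A n) = B" using B by auto
      ultimately have "(\<lambda>n. ennreal (\<Sum>i<n. \<rho> (B \<inter> A i))) \<longlonglongrightarrow> ennreal (\<rho> B)"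
        unfolding sums_def by (intro tendsto_ennrealI) simp
      moreover have "ennreal (\<Sum>i<n. \<rho> (B \<inter> A i)) \<le> (\<Sum>i. pos (A i))" for n
      proof -
        have "ennreal (\<Sum>i<n. \<rho> (B \<inter> A i)) \<le> (\<Sum>i<n. ennreal (\<rho> (B \<inter> A i)))"
        proof (induction n)
          case (Suc n)
          have "ennreal (s + t) \<le> ennreal s + ennreal t" for s t
            by (cases "s \<ge> 0"; cases "t \<ge> 0") (auto simp: ennreal_neg simp flip: ennreal_plus intro: ennreal_leI)
          from this[of "\<Sum>i<n. \<rho> (B \<inter> A i)"] Suc show ?case
            by (auto intro: order_trans[OF _ add_right_mono])
        qed simp
        also have "\<dots> \<le> (\<Sum>i<n. pos (A i))" using B Am by (intro sum_mono pos_upper) auto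
        also have "\<dots> \<le> (\<Sum>i. pos (A i))" by (intro sum_le_suminf) auto
        finally show ?thesis .
      qed
      ultimately show "ennreal (\<rho> B) \<le> (\<Sum>i. pos (A i))" by (intro LIMSEQ_le_const2) auto
    qed
  qed
qed

text \<open>If \<open>pos S = \<infinity>\<close>, one can split off a piece of charge at least 1 in absolute value and keep
  \<open>pos = \<infinity>\<close> on the rest; iterating contradicts convergence of the charges of disjoint pieces.\<close>

lemma pos_split:
  assumes "S \<in> sets M" "pos S = \<infinity>"
  shows "\<exists>T. T \<in> sets M \<and> T \<subseteq> S \<and> pos T = \<infinity> \<and> \<bar>\<rho> (S - T)\<bar> \<ge> 1"
proof -
  have "\<exists>B. B \<in> sets M \<and> B \<subseteq> S \<and> ennreal (\<bar>\<rho> S\<bar> + 1) < ennreal (\<rho> B)"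
  proof (rule ccontr)
    assume "\<not> ?thesis"
    then have "pos S \<le> ennreal (\<bar>\<rho> S\<bar> + 1)" by (intro pos_least) (auto simp: not_less)
    then show False using assms by (auto simp: top_unique)
  qed
  then obtain B where B: "B \<in> sets M" "B \<subseteq> S" "ennreal (\<bar>\<rho> S\<bar> + 1) < ennreal (\<rho> B)" by blast
  then have \<rho>B: "\<bar>\<rho> S\<bar> + 1 < \<rho> B" by (subst (asm) ennreal_less_iff) auto
  have d: "\<rho> (S - B) = \<rho> S - \<rho> B" using B assms by (intro rho_Diff)
  have "pos (B \<union> (S - B)) \<le> pos B + pos (S - B)" using B assms by (intro pos_Un_le) auto
  moreover have "B \<union> (S - B) = S" using B by auto
  ultimately have "pos B = \<infinity> \<or> pos (S - B) = \<infinity>"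
    using assms by (auto simp: top_unique)
  then show ?thesis
  proof
    assume "pos B = \<infinity>"
    then show ?thesis using B d \<rho>B by (intro exI[of _ B]) auto
  next
    assume "pos (S - B) = \<infinity>"
    moreover have "S - (S - B) = B" using B by auto
    ultimately show ?thesis using B assms \<rho>B by (intro exI[of _ "S - B"]) auto
  qed
qed

lemma pos_finite: "pos A < \<infinity>"
proof -
  have "pos (space M) \<noteq> \<infinity>"
  proof
    assume "pos (space M) = \<infinity>"
    then have "\<exists>T. \<forall>n. (T n \<in> sets M \<and> pos (T n) = \<infinity>) \<and> (T (Suc n) \<subseteq> T n \<and> \<bar>\<rho> (T n - T (Suc n))\<bar> \<ge> 1)"
      using pos_split by (intro dependent_nat_choice) (blast, metis)
    then obtain T where T: "\<And>n. T n \<in> sets M" "\<And>n. T (Suc n) \<subseteq> T n" "\<And>n. \<bar>\<rho> (T n - T (Suc n))\<bar> \<ge> 1"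
      by blast
    have dec: "T n \<subseteq> T m" if "m \<le> n" for m n using T(2) that by (rule lift_Suc_antimono_le)
    have "(T m - T (Suc m)) \<inter> (T n - T (Suc n)) = {}" if "m < n" for m n
      using dec[of "Suc m" n] that by auto
    then have "disjoint_family (\<lambda>n. T n - T (Suc n))"
      unfolding disjoint_family_on_def by (metis Int_commute linorder_neqE_nat)
    then have "(\<lambda>n. \<rho> (T n - T (Suc n))) sums \<rho> (\<Union>n. T n - T (Suc n))"
      using T by (intro sums) auto
    then have "(\<lambda>n. \<bar>\<rho> (T n - T (Suc n))\<bar>) \<longlonglongrightarrow> \<bar>0\<bar>"
      by (intro tendsto_rabs summable_LIMSEQ_zero sums_summable)
    then have "1 \<le> \<bar>0 :: real\<bar>" by (rule LIMSEQ_le_const) (use T in auto)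
    then show False by simp
  qed
  moreover have "pos A \<le> pos (space M)" by (intro pos_least pos_upper sets.sets_into_space)
  ultimately show ?thesis by (auto simp: top.not_eq_extremum top_unique less_top)
qed

lemma sets_positive_part [simp]: "sets (positive_part M \<rho>) = sets M"
  and space_positive_part [simp]: "space (positive_part M \<rho>) = space M"
  by (simp_all add: positive_part_def)

lemma emeasure_positive_part:
  assumes "A \<in> sets M"
  shows "emeasure (positive_part M \<rho>) A = pos A"
  unfolding positive_part_def pos_def[symmetric]
proof (rule emeasure_measure_of_sigma)
  show "sigma_algebra (space M) (sets M)" by (rule sets.sigma_algebra_axioms)
  show "positive (sets M) pos" by (simp add: positive_def pos_empty)
qed (use assms pos_countably_additive in auto)

lemma finite_positive_part: "finite_measure (positive_part M \<rho>)"
  using pos_finite[of "space M"] by (intro finite_measureI) (auto simp: emeasure_positive_part)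

lemma measure_positive_part_least:
  assumes "A \<in> sets M" "\<And>B. B \<in> sets M \<Longrightarrow> B \<subseteq> A \<Longrightarrow> \<rho> B \<le> c"
  shows "measure (positive_part M \<rho>) A \<le> c"
proof -
  have "c \<ge> 0" using assms(2)[of "{}"] rho_empty by simp
  moreover have "pos A \<le> ennreal c" using assms by (intro pos_least ennreal_leI)
  ultimately show ?thesis
    unfolding measure_def emeasure_positive_part[OF assms(1)] by (rule enn2real_leI)
qed

lemma measure_positive_part_upper:
  assumes "A \<in> sets M" "B \<in> sets M" "B \<subseteq> A"
  shows "\<rho> B \<le> measure (positive_part M \<rho>) A"
proof -
  have "ennreal (\<rho> B) \<le> ennreal (measure (positive_part M \<rho>) A)"
    using pos_upper[OF assms(2,3)] finite_measure.emeasure_eq_measure[OF finite_positive_part]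
      emeasure_positive_part[OF assms(1)] by simp
  then show ?thesis by (simp only: ennreal_le_iff[OF measure_nonneg])
qed

end

text \<open>For \<open>B \<subseteq> A\<close>, \<open>\<rho> B = \<rho> A - \<rho> (A - B)\<close>:
  complementation in \<open>A\<close> turns the upper bounds for one part into least upper bounds
  for the other.\<close>

lemma (in signed_measure) Jordan_decomposition:
  assumes A: "A \<in> sets M"
  shows "\<rho> A = measure (positive_part M \<rho>) A - measure (positive_part M (\<lambda>A. - \<rho> A)) A"
proof -
  interpret N: signed_measure M "\<lambda>A. - \<rho> A" by (rule signed_measure_uminus)
  have "measure (positive_part M \<rho>) A \<le> measure (positive_part M (\<lambda>A. - \<rho> A)) A + \<rho> A"
  proof (rule measure_positive_part_least[OF A])
    fix B assume "B \<in> sets M" "B \<subseteq> A"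
    then show "\<rho> B \<le> measure (positive_part M (\<lambda>A. - \<rho> A)) A + \<rho> A"
      using N.measure_positive_part_upper[OF A, of "A - B"] rho_Diff[OF A, of B] A by auto
  qed
  moreover have "measure (positive_part M (\<lambda>A. - \<rho> A)) A \<le> measure (positive_part M \<rho>) A - \<rho> A"
  proof (rule N.measure_positive_part_least[OF A])
    fix B assume "B \<in> sets M" "B \<subseteq> A"
    then show "- \<rho> B \<le> measure (positive_part M \<rho>) A - \<rho> A"
      using measure_positive_part_upper[OF A, of "A - B"] rho_Diff[OF A, of B] A by auto
  qed
  ultimately show ?thesis by simp
qed

section \<open>Complex measures: limits of integrals, and finite measures as a special case\<close>

lemma complex_measure_signed:
  assumes "complex_measure M \<nu>"
  shows "signed_measure M (\<lambda>A. Re (\<nu> A))" "signed_measure M (\<lambda>A. Im (\<nu> A))"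
  using assms by (auto simp: complex_measure_def signed_measure_def intro: sums_Re sums_Im)

lemma integral_tendsto_indicator:
  fixes f :: "nat \<Rightarrow> 'a \<Rightarrow> complex"
  assumes "finite_measure N" and sets: "sets N = sets M" and A: "A \<in> sets M"
    and f: "\<And>n. f n \<in> borel_measurable M"
    and bound: "\<And>n x. x \<in> space M \<Longrightarrow> cmod (f n x) \<le> C"
    and lim: "\<And>x. x \<in> space M \<Longrightarrow> (\<lambda>n. f n x) \<longlonglongrightarrow> indicator A x"
  shows "(\<lambda>n. \<integral>x. f n x \<partial>N) \<longlonglongrightarrow> of_real (measure N A)"
proof -
  interpret finite_measure N by fact
  note space = sets_eq_imp_space_eq[OF sets]
  have "(\<lambda>n. \<integral>x. f n x \<partial>N) \<longlonglongrightarrow> (\<integral>x. indicator A x \<partial>N)"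
  proof (rule integral_dominated_convergence[where w = "\<lambda>_. C"])
    show "indicator A \<in> borel_measurable N" using A sets by auto
    show "f n \<in> borel_measurable N" for n using f sets by (simp cong: measurable_cong_sets)
    show "AE x in N. (\<lambda>n. f n x) \<longlonglongrightarrow> indicator A x" using lim space by auto
    show "AE x in N. cmod (f n x) \<le> C" for n using bound space by auto
  qed simp
  moreover have "(\<integral>x. indicator A x \<partial>N) = complex_of_real (measure N A)"
  proof -
    have "A \<inter> space N = A" using sets.sets_into_space[OF A] space by auto
    moreover have "(\<integral>x. indicator A x \<partial>N) = (\<integral>x. complex_of_real (indicator A x) \<partial>N)"
      by (intro Bochner_Integration.integral_cong) (auto simp: indicator_def)
    ultimately show ?thesis by simp
  qed
  ultimately show ?thesis by simp
qed

text \<open>Dominated convergence in each of the four Jordan parts. A bounded sequence of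
  polynomials with this limit on the sphere and limit 0 in the ball shows that a Henkin measure
  vanishes on \<open>A\<close>.\<close>

lemma complex_measure_integral_tendsto_indicator:
  fixes f :: "nat \<Rightarrow> 'a \<Rightarrow> complex"
  assumes \<nu>: "complex_measure M \<nu>" and A: "A \<in> sets M"
    and f: "\<And>n. f n \<in> borel_measurable M"
    and bound: "\<And>n x. x \<in> space M \<Longrightarrow> cmod (f n x) \<le> C"
    and lim: "\<And>x. x \<in> space M \<Longrightarrow> (\<lambda>n. f n x) \<longlonglongrightarrow> indicator A x"
  shows "(\<lambda>n. complex_measure_integral M \<nu> (f n)) \<longlonglongrightarrow> \<nu> A"
proof -
  interpret R: signed_measure M "\<lambda>A. Re (\<nu> A)" using complex_measure_signed[OF \<nu>] by simp
  interpret I: signed_measure M "\<lambda>A. Im (\<nu> A)" using complex_measure_signed[OF \<nu>] by simp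
  interpret R': signed_measure M "\<lambda>A. - Re (\<nu> A)" by (rule R.signed_measure_uminus)
  interpret I': signed_measure M "\<lambda>A. - Im (\<nu> A)" by (rule I.signed_measure_uminus)
  have eq: "(of_real (measure (positive_part M (\<lambda>A. Re (\<nu> A))) A) - of_real (measure (positive_part M (\<lambda>A. - Re (\<nu> A))) A))
     + \<i> * (of_real (measure (positive_part M (\<lambda>A. Im (\<nu> A))) A) - of_real (measure (positive_part M (\<lambda>A. - Im (\<nu> A))) A)) = \<nu> A"
    using R.Jordan_decomposition[OF A] I.Jordan_decomposition[OF A] by (simp add: complex_eq_iff)
  have "(\<lambda>n. complex_measure_integral M \<nu> (f n)) \<longlonglongrightarrow>
     (of_real (measure (positive_part M (\<lambda>A. Re (\<nu> A))) A) - of_real (measure (positive_part M (\<lambda>A. - Re (\<nu> A))) A))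
     + \<i> * (of_real (measure (positive_part M (\<lambda>A. Im (\<nu> A))) A) - of_real (measure (positive_part M (\<lambda>A. - Im (\<nu> A))) A))"
    unfolding complex_measure_integral_def
    by (intro tendsto_intros integral_tendsto_indicator[OF _ _ A f bound lim]
      R.finite_positive_part I.finite_positive_part R'.finite_positive_part I'.finite_positive_part
      R.sets_positive_part I.sets_positive_part R'.sets_positive_part I'.sets_positive_part)
  then show ?thesis unfolding eq .
qed

text \<open>Monotonicity makes the positive part of the real part equal to \<open>\<mu>\<close>; the
  other three Jordan parts are zero.\<close>

lemma complex_measure_of_finite_measure:
  assumes "finite_measure \<mu>" and sets: "sets \<mu> = sets M"
  shows "complex_measure M (\<lambda>A. of_real (measure \<mu> A))"
    and "complex_measure_integral M (\<lambda>A. of_real (measure \<mu> A)) f = (\<integral>x. f x \<partial>\<mu>)"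
proof -
  interpret finite_measure \<mu> by fact
  show cm: "complex_measure M (\<lambda>A. of_real (measure \<mu> A))"
    unfolding complex_measure_def
    using finite_measure_UNION sets by (auto intro!: sums_of_real)
  interpret R: signed_measure M "measure \<mu>" using complex_measure_signed[OF cm] by simp
  interpret R': signed_measure M "\<lambda>A. - measure \<mu> A" by (rule R.signed_measure_uminus)
  interpret Z: signed_measure M "\<lambda>A. 0" using complex_measure_signed[OF cm] by simp
  have "positive_part M (measure \<mu>) = \<mu>"
  proof (rule measure_eqI)
    fix A assume "A \<in> sets (positive_part M (measure \<mu>))"
    then have A: "A \<in> sets M" by simp
    have "measure (positive_part M (measure \<mu>)) A = measure \<mu> A"
      using A sets by (intro antisym R.measure_positive_part_least R.measure_positive_part_upper)
        (auto intro: finite_measure_mono)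
    then show "emeasure (positive_part M (measure \<mu>)) A = emeasure \<mu> A"
      by (simp add: emeasure_eq_measure finite_measure.emeasure_eq_measure[OF R.finite_positive_part])
  qed (simp add: sets)
  moreover have zero: "(\<integral>x. f x \<partial>positive_part M \<rho>) = 0" if "signed_measure M \<rho>" "\<And>A. A \<in> sets M \<Longrightarrow> \<rho> A \<le> 0" for \<rho>
  proof -
    interpret S: signed_measure M \<rho> by fact
    have "measure (positive_part M \<rho>) (space M) \<le> 0"
      using that by (intro S.measure_positive_part_least) auto
    then have "emeasure (positive_part M \<rho>) (space (positive_part M \<rho>)) = 0"
      by (simp add: finite_measure.emeasure_eq_measure[OF S.finite_positive_part] measure_le_0_iff)
    then have "AE x in positive_part M \<rho>. f x = 0"
      by (intro AE_I'[of "space (positive_part M \<rho>)"]) (auto simp: null_sets_def)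
    then show ?thesis by (rule integral_eq_zero_AE)
  qed
  ultimately show "complex_measure_integral M (\<lambda>A. of_real (measure \<mu> A)) f = (\<integral>x. f x \<partial>\<mu>)"
    using zero[OF R'.signed_measure_axioms] zero[OF Z.signed_measure_axioms]
    by (simp add: complex_measure_integral_def)
qed

section \<open>Weak limits of finitely supported measures\<close>

lemma compact_cantor_space: "compact (UNIV :: (nat \<Rightarrow> bool) set)"
proof -
  have "compact_space (euclidean :: bool topology)"
    by (simp add: compact_space_def compactin_euclidean_iff finite_imp_compact)
  then have "compact_space (product_topology (\<lambda>_. euclidean :: bool topology) (UNIV :: nat set))"
    by (simp add: compact_space_product_topology)
  then have "compact_space (euclidean :: (nat \<Rightarrow> bool) topology)"
    by (simp add: euclidean_product_topology)
  then show ?thesis by (simp add: compact_space_def compactin_euclidean_iff)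
qed

text \<open>One formula for two maps on the Cantor space: \<open>q = 1/2\<close> gives binary
  expansions, which are onto an interval, and \<open>q = 1/3\<close> gives an embedding into the
  line. \<open>e\<close> tells which bits of \<open>s\<close> are read.\<close>

definition digit_sum :: "real \<Rightarrow> (nat \<Rightarrow> nat) \<Rightarrow> (nat \<Rightarrow> bool) \<Rightarrow> real" where
  "digit_sum q e s = (\<Sum>n. if s (e n) then q ^ n else 0)"

lemma summable_digits:
  assumes "0 \<le> q" "q < (1::real)"
  shows "summable (\<lambda>n. if s (e n) then q ^ n else 0)"
  by (rule summable_comparison_test'[where g = "\<lambda>n. q ^ n" and N = 0])
    (use assms in \<open>auto intro: summable_geometric\<close>)

lemma continuous_digit_sum:
  assumes "0 \<le> q" "q < 1"
  shows "continuous_on UNIV (digit_sum q e)"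
proof (rule uniform_limit_theorem)
  show "uniform_limit UNIV (\<lambda>n s. \<Sum>i<n. if s (e i) then q ^ i else 0) (digit_sum q e) sequentially"
    unfolding digit_sum_def[abs_def]
    by (rule Weierstrass_m_test[where M = "\<lambda>n. q ^ n"]) (use assms in \<open>auto intro: summable_geometric\<close>)
  have "continuous_on UNIV (\<lambda>s :: nat \<Rightarrow> bool. if s (e i) then q ^ i else 0)" for i
  proof -
    have "continuous_on UNIV ((\<lambda>b. if b then q ^ i else 0) \<circ> (\<lambda>s :: nat \<Rightarrow> bool. s (e i)))"
      by (intro continuous_on_compose continuous_on_product_coordinates Topological_Spaces.continuous_on_discrete)
    then show ?thesis by (simp add: o_def)
  qed
  then show "\<forall>\<^sub>F n in sequentially. continuous_on UNIV (\<lambda>s. \<Sum>i<n. if s (e i) then q ^ i else 0)"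
    by (intro always_eventually allI continuous_on_sum) auto
qed simp

text \<open>The first differing digit contributes \<open>(1/3) ^ n\<close>, while all later digits
  together contribute at most half of that.\<close>

lemma inj_digit_sum: "inj (digit_sum (1/3) (\<lambda>n. n))"
proof (rule injI, rule ccontr)
  fix s t assume eq: "digit_sum (1/3) (\<lambda>n. n) s = digit_sum (1/3) (\<lambda>n. n) t" and ne: "s \<noteq> t"
  define n where "n = (LEAST n. s n \<noteq> t n)"
  have n: "s n \<noteq> t n" unfolding n_def by (rule LeastI_ex) (use ne in auto)
  have less: "s m = t m" if "m < n" for m using not_less_Least[of m "\<lambda>n. s n \<noteq> t n"] that by (auto simp: n_def)
  define h where "h m = (if s m then (1/3) ^ m else 0) - (if t m then (1/3) ^ m else (0::real))" for m
  have sh: "summable h" unfolding h_def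
    using summable_digits[of "1/3" s "\<lambda>n. n"] summable_digits[of "1/3" t "\<lambda>n. n"] by (intro summable_diff) auto
  have h0: "suminf h = 0"
    using suminf_diff[OF summable_digits[of "1/3" s "\<lambda>n. n"] summable_digits[of "1/3" t "\<lambda>n. n"]] eq
    by (simp add: h_def[abs_def] digit_sum_def)
  have geo: "summable (\<lambda>m. (1/3) ^ (m + Suc n) :: real)"
    using summable_ignore_initial_segment[OF summable_geometric[of "1/3 :: real"], of "Suc n"] by simp
  have hb: "\<bar>h m\<bar> \<le> (1/3) ^ m" for m by (auto simp: h_def)
  have "\<bar>\<Sum>m. h (m + Suc n)\<bar> \<le> (\<Sum>m. (1/3) ^ (m + Suc n))"
  proof -
    have s: "summable (\<lambda>m. \<bar>h (m + Suc n)\<bar>)"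
      by (rule summable_comparison_test'[OF geo, of 0]) (simp only: real_norm_def abs_abs hb)
    have "\<bar>\<Sum>m. h (m + Suc n)\<bar> \<le> (\<Sum>m. \<bar>h (m + Suc n)\<bar>)" by (rule summable_rabs[OF s])
    also have "\<dots> \<le> (\<Sum>m. (1/3) ^ (m + Suc n))" by (intro suminf_le s geo hb)
    finally show ?thesis .
  qed
  also have "(\<Sum>m. (1/3) ^ (m + Suc n) :: real) = (1/3) ^ n / 2"
  proof -
    have "(\<Sum>m. (1/3) ^ (m + Suc n) :: real) = (\<Sum>m. (1/3) ^ Suc n * (1/3) ^ m)"
      by (simp add: power_add mult_ac)
    also have "\<dots> = (1/3) ^ Suc n * (\<Sum>m. (1/3) ^ m)"
      by (rule suminf_mult) (auto intro: summable_geometric)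
    also have "(\<Sum>m. (1/3 :: real) ^ m) = 3 / 2" by (subst suminf_geometric) auto
    finally show ?thesis by simp
  qed
  finally have "\<bar>\<Sum>m. h (m + Suc n)\<bar> \<le> (1/3) ^ n / 2" .
  moreover have "suminf h = (\<Sum>m. h (m + Suc n)) + (\<Sum>m<Suc n. h m)"
    by (rule suminf_split_initial_segment[OF sh])
  moreover have "(\<Sum>m<n. h m) = 0" using less by (intro sum.neutral) (auto simp: h_def)
  moreover have "\<bar>h n\<bar> = (1/3) ^ n" using n by (auto simp: h_def)
  moreover have "(1/3 :: real) ^ n > 0" by simp
  ultimately show False using h0 unfolding sum.lessThan_Suc by linarith
qed

text \<open>The partial sums are rescaled floors of \<open>2 ^ N * x\<close>. The factor 2 arises
  because the leading digit has weight \<open>q ^ 0 = 1\<close> instead of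
  \<open>1/2\<close>.\<close>

lemma binary_expansion:
  assumes x: "0 \<le> x" "x < (1::real)" and s: "\<And>n. s (e n) = odd \<lfloor>2 ^ Suc n * x\<rfloor>"
  shows "digit_sum (1/2) e s = 2 * x"
proof -
  have step: "2 * real_of_int \<lfloor>y\<rfloor> + (if odd \<lfloor>2 * y\<rfloor> then 1 else 0) = real_of_int \<lfloor>2 * y\<rfloor>" for y :: real
  proof -
    have "\<lfloor>2 * y\<rfloor> = 2 * \<lfloor>y\<rfloor> \<or> \<lfloor>2 * y\<rfloor> = 2 * \<lfloor>y\<rfloor> + 1" by linarith
    then show ?thesis by auto
  qed
  have partial: "(\<Sum>n<N. if s (e n) then (1/2) ^ n else 0) = 2 * (real_of_int \<lfloor>2 ^ N * x\<rfloor> / 2 ^ N)" for N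
  proof (induction N)
    case 0
    have "\<lfloor>x\<rfloor> = 0" using x by (simp add: floor_eq_iff)
    then show ?case by simp
  next
    case (Suc N)
    have "real_of_int \<lfloor>2 ^ Suc N * x\<rfloor> = 2 * real_of_int \<lfloor>2 ^ N * x\<rfloor> + (if s (e N) then 1 else 0)"
      using step[of "2 ^ N * x"] by (simp add: s mult.assoc)
    then show ?case using Suc by (simp add: field_simps)
  qed
  have "(\<lambda>N. real_of_int \<lfloor>2 ^ N * x\<rfloor> / 2 ^ N) \<longlonglongrightarrow> x"
  proof (rule tendsto_sandwich)
    show "\<forall>\<^sub>F N in sequentially. x - (1/2) ^ N \<le> real_of_int \<lfloor>2 ^ N * x\<rfloor> / 2 ^ N"
    proof (intro always_eventually allI)
      fix N
      have "2 ^ N * x - 1 \<le> real_of_int \<lfloor>2 ^ N * x\<rfloor>" by linarith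
      then have "(2 ^ N * x - 1) / 2 ^ N \<le> real_of_int \<lfloor>2 ^ N * x\<rfloor> / 2 ^ N"
        by (intro divide_right_mono) auto
      then show "x - (1/2) ^ N \<le> real_of_int \<lfloor>2 ^ N * x\<rfloor> / 2 ^ N"
        by (simp add: diff_divide_distrib power_one_over)
    qed
    show "\<forall>\<^sub>F N in sequentially. real_of_int \<lfloor>2 ^ N * x\<rfloor> / 2 ^ N \<le> x"
    proof (intro always_eventually allI)
      fix N
      have "real_of_int \<lfloor>2 ^ N * x\<rfloor> \<le> 2 ^ N * x" by linarith
      then show "real_of_int \<lfloor>2 ^ N * x\<rfloor> / 2 ^ N \<le> x" by (simp add: field_simps)
    qed
    have "(\<lambda>N. x - (1/2) ^ N) \<longlonglongrightarrow> x - 0"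
      by (intro tendsto_intros LIMSEQ_realpow_zero) auto
    then show "(\<lambda>N. x - (1/2) ^ N) \<longlonglongrightarrow> x" by simp
  qed simp
  then have "(\<lambda>N. \<Sum>n<N. if s (e n) then (1/2) ^ n else 0) \<longlonglongrightarrow> 2 * x"
    unfolding partial by (intro tendsto_intros)
  then show ?thesis unfolding digit_sum_def by (simp add: sums_def[symmetric] sums_unique[symmetric])
qed

text \<open>The Hausdorff-Alexandroff argument: \<open>v\<close> maps the Cantor space continuously
  onto a set that contains the ball, and \<open>c\<close> embeds the Cantor space in the line.
  \<open>C\<close> is the copy under \<open>c\<close> of the preimage of \<open>A\<close> under
  \<open>v\<close>.\<close>

lemma compact_image_of_Cantor_subset:
  fixes A :: "(complex ^ 'd::finite) set"
  assumes A: "compact A" "A \<subseteq> cball 0 1"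
  shows "\<exists>(C :: real set) \<phi>. compact C \<and> continuous_on C \<phi> \<and> \<phi> ` C = A"
proof -
  obtain idx :: "'d \<Rightarrow> nat" where idx: "inj idx"
    using finite_imp_inj_to_nat_seg[OF finite[of "UNIV :: 'd set"]] by blast
  \<comment> \<open>\<open>prod_encode\<close> splits one bit sequence into countably many. Even
    \<open>j\<close> serve real parts and odd \<open>j\<close> serve imaginary parts of the
    coordinates.\<close>
  define B where "B j = digit_sum (1/2) (\<lambda>n. prod_encode (n, j))" for j
  define v :: "(nat \<Rightarrow> bool) \<Rightarrow> complex ^ 'd" where
    "v s = (\<chi> i. of_real (2 * B (2 * idx i) s - 2) + \<i> * of_real (2 * B (2 * idx i + 1) s - 2))" for s
  have contB: "continuous_on UNIV (B j)" for j unfolding B_def by (rule continuous_digit_sum) auto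
  then have contv: "continuous_on UNIV v"
    unfolding v_def[abs_def] by (intro continuous_intros) auto
  have surj: "z \<in> range v" if "z \<in> cball 0 1" for z :: "complex ^ 'd"
  proof -
    \<comment> \<open>The affine map takes values between -1 and 1 to values between 1/4 and 3/4,
      hence below 1 as \<open>binary_expansion\<close> requires.\<close>
    define X where "X j = ((if even j then Re (z $ inv idx (j div 2)) else Im (z $ inv idx (j div 2))) + 2) / 4" for j
    have "cmod (z $ i) \<le> 1" for i
      using Finite_Cartesian_Product.norm_nth_le[of z i] that by simp
    then have "\<bar>Re (z $ i)\<bar> \<le> 1" "\<bar>Im (z $ i)\<bar> \<le> 1" for i
      using abs_Re_le_cmod[of "z $ i"] abs_Im_le_cmod[of "z $ i"] order_trans by blast+
    then have b: "- 1 \<le> Re (z $ i)" "Re (z $ i) \<le> 1" "- 1 \<le> Im (z $ i)" "Im (z $ i) \<le> 1" for i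
      by (auto simp: abs_le_iff minus_le_iff)
    have X: "0 \<le> X j" "X j < 1" for j
      using b[of "inv idx (j div 2)"] by (auto simp: X_def)
    define s where "s k = odd \<lfloor>2 ^ Suc (fst (prod_decode k)) * X (snd (prod_decode k))\<rfloor>" for k
    have B: "B j s = 2 * X j" for j
      unfolding B_def by (rule binary_expansion) (use X in \<open>auto simp: s_def\<close>)
    have "2 * B (2 * idx i) s - 2 = Re (z $ i)" "2 * B (2 * idx i + 1) s - 2 = Im (z $ i)" for i
      unfolding B by (simp_all add: X_def inv_f_f[OF idx] field_simps)
    then have "v s = z" unfolding v_def vec_eq_iff by (simp only: vec_lambda_beta complex_eq_iff) simp
    then show ?thesis by blast
  qed
  define c where "c = digit_sum (1/3) (\<lambda>n. n)"
  have contc: "continuous_on UNIV c" unfolding c_def by (rule continuous_digit_sum) auto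
  have injc: "inj c" unfolding c_def by (rule inj_digit_sum)
  define T where "T = v -` A"
  have "closed T" unfolding T_def
    by (rule closed_vimage[OF compact_imp_closed[OF A(1)] contv])
  then have T: "compact T" using compact_Int_closed[OF compact_cantor_space, of T] by simp
  have "continuous_on (c ` T) (inv c)"
    using T injc by (intro continuous_on_inv continuous_on_subset[OF contc]) auto
  then have "continuous_on (c ` T) (v \<circ> inv c)"
    by (intro continuous_on_compose continuous_on_subset[OF contv]) auto
  moreover have "compact (c ` T)" by (intro compact_continuous_image continuous_on_subset[OF contc] T) auto
  moreover have "(v \<circ> inv c) ` c ` T = A"
  proof -
    have "(v \<circ> inv c) ` c ` T = v ` T" using injc by (simp add: image_comp o_def)
    also have "\<dots> = A" using surj A(2) by (auto simp: T_def)
    finally show ?thesis .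
  qed
  ultimately show ?thesis by blast
qed

text \<open>Lift the point masses along a continuous surjection from a compact
  subset of the line, and use Helly's selection theorem there.\<close>

lemma finite_measures_weak_limit:
  fixes A :: "(complex ^ 'd::finite) set" and F :: "nat \<Rightarrow> (complex ^ 'd) set"
    and c :: "nat \<Rightarrow> complex ^ 'd \<Rightarrow> real"
  assumes A: "compact A" "A \<subseteq> sphere 0 1"
    and F: "\<And>n. finite (F n)" "\<And>n. F n \<subseteq> A"
    and c: "\<And>n w. w \<in> F n \<Longrightarrow> c n w \<ge> 0" "\<And>n. (\<Sum>w\<in>F n. c n w) = 1"
  shows "\<exists>r \<mu>. strict_mono r \<and> prob_space \<mu> \<and> sets \<mu> = sets (borel_sphere :: (complex ^ 'd) measure) \<and>
     emeasure \<mu> (sphere 0 1 - A) = 0 \<and>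
     (\<forall>f :: complex ^ 'd \<Rightarrow> complex. continuous_on (sphere 0 1) f \<longrightarrow>
        (\<lambda>n. \<Sum>w\<in>F (r n). of_real (c (r n) w) * f w) \<longlonglongrightarrow> (\<integral>x. f x \<partial>\<mu>))"
proof -
  have "A \<subseteq> cball 0 1" using A(2) by (auto simp: sphere_def)
  then obtain C :: "real set" and \<phi> where C: "compact C" "continuous_on C \<phi>" "\<phi> ` C = A"
    using compact_image_of_Cantor_subset[OF A(1)] by blast
  have "F 0 \<noteq> {}" using c(2)[of 0] by auto
  then obtain w0 where w0: "w0 \<in> A" using F(2) by blast
  have "C \<noteq> {}" using C(3) w0 by auto
  \<comment> \<open>An arbitrary section of \<open>\<phi>\<close>. It is applied only to point
    measures, on which every map is measurable.\<close>
  define sel where "sel w = (SOME x. x \<in> C \<and> \<phi> x = w)" for w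
  have sel: "sel w \<in> C" "\<phi> (sel w) = w" if "w \<in> A" for w
  proof -
    have "\<exists>x. x \<in> C \<and> \<phi> x = w" using that C(3) by auto
    then show "sel w \<in> C" "\<phi> (sel w) = w" unfolding sel_def by (metis (mono_tags, lifting) someI_ex)+
  qed
  define \<mu> where "\<mu> n = distr (point_measure (F n) (\<lambda>w. c n w)) borel sel" for n
  have pm: "prob_space (point_measure (F n) (\<lambda>w. c n w))" for n
    using F c by (intro prob_space_point_measure) auto
  have real_dist: "real_distribution (\<mu> n)" for n
    unfolding \<mu>_def real_distribution_def real_distribution_axioms_def
    by (auto intro!: prob_space.prob_space_distr[OF pm] simp: measurable_def sets_point_measure space_point_measure)
  have int\<mu>: "(\<integral>x. g x \<partial>\<mu> n) = (\<Sum>w\<in>F n. c n w *\<^sub>R g (sel w))"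
    if "g \<in> borel_measurable borel" for g :: "real \<Rightarrow> 'b::{banach, second_countable_topology}" and n
    unfolding \<mu>_def using that F c
    by (subst integral_distr) (auto simp: measurable_def sets_point_measure space_point_measure lebesgue_integral_point_measure_finite)
  obtain b where b: "\<And>x. x \<in> C \<Longrightarrow> \<bar>x\<bar> < b" "b > 0"
    using compact_imp_bounded[OF C(1)] by (auto simp: bounded_pos_less)
  have "tight \<mu>"
    unfolding tight_def
  proof (intro conjI allI impI)
    fix e :: real assume e: "e > 0"
    have "measure (\<mu> n) {-b<..b} = 1" for n
    proof -
      have "measure (\<mu> n) {-b<..b} = measure (point_measure (F n) (\<lambda>w. c n w)) (space (point_measure (F n) (\<lambda>w. c n w)))"
      proof -
        have "sel -` {-b<..b} \<inter> space (point_measure (F n) (\<lambda>w. c n w)) = space (point_measure (F n) (\<lambda>w. c n w))"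
          using b(1) sel(1) F(2)[of n] by (auto simp: space_point_measure) (smt (verit, best) subsetD abs_less_iff minus_less_iff)+
        then show ?thesis unfolding \<mu>_def
          by (subst measure_distr) (auto simp: measurable_def sets_point_measure space_point_measure)
      qed
      then show ?thesis using prob_space.prob_space[OF pm] by simp
    qed
    then show "\<exists>a b. a < b \<and> (\<forall>n. 1 - e < measure (\<mu> n) {a<..b})"
      using e b(2) by (intro exI[of _ "-b"] exI[of _ b]) auto
  qed (rule real_dist)
  from tight_imp_convergent_subsubsequence[OF this strict_mono_id]
  obtain r L where r: "strict_mono r" and L: "real_distribution L" and weak: "weak_conv_m (\<mu> \<circ> r) L"
    by (auto simp: id_def o_def)
  interpret L: real_distribution L by fact
  have conv: "(\<lambda>n. \<integral>x. g x \<partial>\<mu> (r n)) \<longlonglongrightarrow> (\<integral>x. g x \<partial>L)"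
    if "continuous_on UNIV g" "\<And>x. norm (g x) \<le> B"
    for g :: "real \<Rightarrow> 'b::{banach, second_countable_topology}" and B
    using weak_conv_imp_integral_bdd_continuous_conv[OF _ L weak, of g B] real_dist that
    by (auto simp: continuous_on_eq_continuous_at)
  have Cclosed: "closed C" using C(1) by (rule compact_imp_closed)
  have AE_C: "AE x in L. x \<in> C"
  proof -
    \<comment> \<open>A bounded continuous function whose zero set is \<open>C\<close>: its
      integrals vanish along the sequence, hence in the limit, so the limit lives on
      \<open>C\<close>.\<close>
    define g where "g x = min 1 (infdist x C)" for x :: real
    have g: "continuous_on UNIV g" unfolding g_def by (intro continuous_intros)
    have gb: "norm (g x) \<le> 1" for x by (simp add: g_def infdist_nonneg)
    have gm: "g \<in> borel_measurable borel" using g by (rule borel_measurable_continuous_onI)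
    have "(\<integral>x. g x \<partial>\<mu> n) = 0" for n
      unfolding int\<mu>[OF gm] using sel(1) F(2)[of n] by (intro sum.neutral) (auto simp: g_def subset_iff)
    then have "(\<integral>x. g x \<partial>L) = 0" using conv[OF g gb] by (simp add: LIMSEQ_const_iff)
    moreover have "integrable L g"
      using gb gm by (intro L.integrable_const_bound[of _ 1]) auto
    ultimately have "AE x in L. g x = 0"
      by (subst (asm) integral_nonneg_eq_0_iff_AE) (auto simp: g_def infdist_nonneg)
    then show ?thesis
    proof eventually_elim
      case (elim x)
      then have "infdist x C = 0" by (auto simp: g_def min_def split: if_splits)
      then show ?case using in_closed_iff_infdist_zero[OF Cclosed \<open>C \<noteq> {}\<close>] by simp
    qed
  qed
  \<comment> \<open>The default value \<open>w0\<close> is taken only on a null set of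
    \<open>L\<close> and keeps \<open>\<psi>\<close> in \<open>A\<close> everywhere.\<close>
  define \<psi> where "\<psi> x = (if x \<in> C then \<phi> x else w0)" for x
  have \<psi>A: "\<psi> x \<in> A" for x using C(3) w0 by (auto simp: \<psi>_def)
  have "\<psi> \<in> borel_measurable borel" unfolding \<psi>_def[abs_def]
    using Cclosed C(2) by (intro borel_measurable_continuous_on_if) auto
  then have \<psi>m: "\<psi> \<in> measurable L borel_sphere"
    using \<psi>A A(2) by (intro measurable_restrict_space2) auto
  define \<nu> where "\<nu> = distr L borel_sphere \<psi>"
  have "prob_space \<nu>" unfolding \<nu>_def by (rule L.prob_space_distr[OF \<psi>m])
  moreover have "sets \<nu> = sets borel_sphere" by (simp add: \<nu>_def)
  moreover have "emeasure \<nu> (sphere 0 1 - A) = 0"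
  proof -
    have "A \<in> sets borel" using A(1) by (intro borel_closed compact_imp_closed)
    then have "sphere 0 1 - A \<in> sets borel_sphere"
      by (auto simp: sets_restrict_space_iff)
    moreover have "\<psi> -` (sphere 0 1 - A) \<inter> space L = {}" using \<psi>A by auto
    ultimately show ?thesis unfolding \<nu>_def using \<psi>m by (subst emeasure_distr) auto
  qed
  moreover have "(\<lambda>n. \<Sum>w\<in>F (r n). of_real (c (r n) w) * f w) \<longlonglongrightarrow> (\<integral>x. f x \<partial>\<nu>)"
    if f: "continuous_on (sphere 0 1) f" for f :: "complex ^ 'd \<Rightarrow> complex"
  proof -
    have cf: "continuous_on C (f \<circ> \<phi>)"
      using C A(2) by (intro continuous_on_compose continuous_on_subset[OF f]) auto
    obtain B where B: "B \<ge> 0" "\<And>x. x \<in> C \<Longrightarrow> norm ((f \<circ> \<phi>) x) \<le> B"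
      using compact_imp_bounded[OF compact_continuous_image[OF cf C(1)]]
      by (auto simp: bounded_pos intro: less_imp_le)
    \<comment> \<open>\<open>f \<circ> \<phi>\<close> is defined only on \<open>C\<close>, whereas
      weak convergence tests bounded continuous functions on the whole line.\<close>
    obtain g where g: "continuous_on UNIV g" "\<And>x. x \<in> C \<Longrightarrow> g x = (f \<circ> \<phi>) x" "\<And>x. x \<in> UNIV \<Longrightarrow> norm (g x) \<le> B"
      using Tietze[OF cf _ B, of UNIV] Cclosed by auto
    have gm: "g \<in> borel_measurable borel" using g(1) by (rule borel_measurable_continuous_onI)
    have "(\<integral>x. g x \<partial>\<mu> n) = (\<Sum>w\<in>F n. of_real (c n w) * f w)" for n
      unfolding int\<mu>[OF gm] using F(2)[of n] sel g(2) by (intro sum.cong) (auto simp: scaleR_conv_of_real subset_iff)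
    moreover have "(\<integral>x. g x \<partial>L) = (\<integral>x. f x \<partial>\<nu>)"
    proof -
      have fm: "f \<in> borel_measurable borel_sphere" using f by (rule borel_measurable_continuous_on_restrict)
      have "(\<integral>x. f x \<partial>\<nu>) = (\<integral>x. f (\<psi> x) \<partial>L)"
        unfolding \<nu>_def by (rule integral_distr[OF \<psi>m fm])
      also have "\<dots> = (\<integral>x. g x \<partial>L)"
      proof (rule integral_cong_AE)
        show "(\<lambda>x. f (\<psi> x)) \<in> borel_measurable L" by (rule measurable_compose[OF \<psi>m fm])
        show "g \<in> borel_measurable L" using gm by simp
        show "AE x in L. f (\<psi> x) = g x" using AE_C by eventually_elim (simp add: \<psi>_def g(2))
      qed
      finally show ?thesis by simp
    qed
    ultimately show ?thesis using conv[of g B] g by simp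
  qed
  ultimately show ?thesis using r by blast
qed

section \<open>Potentials and energy\<close>

lemma cinner_prod_norm_le: "cmod (cinner_prod z w) \<le> norm z * norm w"
proof -
  have "cmod (cinner_prod z w) \<le> (\<Sum>i\<in>UNIV. \<bar>cmod (z $ i)\<bar> * \<bar>cmod (w $ i)\<bar>)"
    unfolding cinner_prod_def by (rule order_trans[OF norm_sum]) (simp add: norm_mult)
  also have "\<dots> \<le> norm z * norm w"
    unfolding norm_vec_def by (rule L2_set_mult_ineq)
  finally show ?thesis .
qed

lemma cinner_prod_scaleR: "cinner_prod (r *\<^sub>R z) (s *\<^sub>R w) = of_real (r * s) * cinner_prod z w"
  unfolding cinner_prod_def sum_distrib_left
  unfolding vector_scaleR_component by (intro sum.cong refl) (simp add: scaleR_conv_of_real mult_ac)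

lemma cinner_prod_scaleR_right: "cinner_prod z (r *\<^sub>R w) = of_real r * cinner_prod z w"
  using cinner_prod_scaleR[of 1 z r w] by simp

lemma cinner_prod_commute: "cinner_prod w z = cnj (cinner_prod z w)"
  by (simp add: cinner_prod_def mult.commute)

lemma cinner_prod_self: "cinner_prod z z = of_real ((norm z)\<^sup>2)"
  by (simp add: cinner_prod_def norm_vec_def L2_set_def sum_nonneg complex_norm_square[symmetric] del: of_real_power)

lemma norm_diff_cinner_prod: "(norm (z - w))\<^sup>2 = (norm z)\<^sup>2 + (norm w)\<^sup>2 - 2 * Re (cinner_prod z w)"
proof -
  have "cinner_prod (z - w) (z - w) = cinner_prod z z + cinner_prod w w - (cinner_prod z w + cinner_prod w z)"
    by (simp add: cinner_prod_def algebra_simps sum.distrib sum_subtractf)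
  then have "Re (cinner_prod (z - w) (z - w)) = Re (cinner_prod z z) + Re (cinner_prod w w) - 2 * Re (cinner_prod z w)"
    by (simp add: cinner_prod_commute[of w z])
  then show ?thesis by (simp only: cinner_prod_self Re_complex_of_real)
qed

lemma continuous_on_cinner_prod [continuous_intros]:
  "continuous_on S f \<Longrightarrow> continuous_on S g \<Longrightarrow> continuous_on S (\<lambda>x. cinner_prod (f x) (g x))"
  unfolding cinner_prod_def by (intro continuous_intros)

lemma continuous_on_polynomial_fun:
  "polynomial_fun p \<Longrightarrow> continuous_on S p"
  unfolding polynomial_fun_def by (auto intro!: continuous_intros)

text \<open>Words of length \<open>n\<close> instead of multi-indices: the expansion of
  \<open>cinner_prod z w ^ n\<close> then carries no multinomial coefficients.\<close>

definition word_monom :: "nat \<Rightarrow> (nat \<Rightarrow> 'd) \<Rightarrow> complex ^ 'd::finite \<Rightarrow> complex" where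
  "word_monom n \<alpha> z = (\<Prod>k<n. z $ \<alpha> k)"

lemma cinner_prod_power:
  "cinner_prod z w ^ n = (\<Sum>\<alpha>\<in>Pi\<^sub>E {..<n} (\<lambda>_. UNIV). word_monom n \<alpha> z * cnj (word_monom n \<alpha> w))"
proof -
  have "cinner_prod z w ^ n = (\<Prod>k<n. \<Sum>i\<in>UNIV. z $ i * cnj (w $ i))"
    by (simp add: cinner_prod_def)
  also have "\<dots> = (\<Sum>\<alpha>\<in>Pi\<^sub>E {..<n} (\<lambda>_. UNIV). \<Prod>k<n. z $ \<alpha> k * cnj (w $ \<alpha> k))"
    by (rule prod_sum_PiE) auto
  finally show ?thesis by (simp add: word_monom_def prod.distrib)
qed

lemma psd_cinner_prod: "psd_kernel X cinner_prod"
proof (rule psd_cong_imp)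
  show "psd_kernel X (\<lambda>z w. \<Sum>i\<in>UNIV. z $ i * cnj (w $ i))"
    by (intro psd_sum psd_rank1[of X "\<lambda>z. z $ i" for i])
qed (simp add: cinner_prod_def)

lemma continuous_on_word_monom: "continuous_on S (word_monom n \<alpha>)"
  unfolding word_monom_def[abs_def] by (intro continuous_intros)

section \<open>The kernel of the space and the potentials of finitely supported measures\<close>

locale cnp_space = regular_unitarily_invariant_space a H ip
  for a :: "nat \<Rightarrow> real"
    and H :: "(complex ^ 'd::finite \<Rightarrow> complex) set"
    and ip :: "(complex ^ 'd \<Rightarrow> complex) \<Rightarrow> (complex ^ 'd \<Rightarrow> complex) \<Rightarrow> complex" +
  assumes complete_pick: "complete_pick_kernel (ball (0 :: complex ^ 'd) 1) (power_kernel a)"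
begin

sublocale regular_coeffs a
  by unfold_locales (rule coeff_pos coeff_0 coeff_ratio)+

sublocale pick_coeffs a
  using complete_pick b_nonneg by unfold_locales (auto simp: complete_pick_kernel_def)

abbreviation K :: "complex ^ 'd \<Rightarrow> complex ^ 'd \<Rightarrow> complex" where "K \<equiv> power_kernel a"

lemma cinner_prod_lt_1: "norm z < 1 \<Longrightarrow> norm w \<le> 1 \<Longrightarrow> cmod (cinner_prod z w) < 1"
  by (rule le_less_trans[OF cinner_prod_norm_le]) (meson le_less_trans mult_left_le norm_ge_zero)

lemma cinner_prod_lt_1': "norm z \<le> 1 \<Longrightarrow> norm w < 1 \<Longrightarrow> cmod (cinner_prod z w) < 1"
  using cinner_prod_lt_1[of w z] by (simp add: cinner_prod_commute[of z w])

lemma K_hermitian: "x \<in> ball 0 1 \<Longrightarrow> y \<in> ball 0 1 \<Longrightarrow> K y x = cnj (K x y)"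
  by (rule psd_hermitian[OF psd_K])

lemma K_zero: "K 0 w = 1" "K w 0 = 1"
proof -
  have "\<kappa> 0 = 1" using kappa_real(1)[of 0] by (simp add: a_0)
  then show "K 0 w = 1" "K w 0 = 1" by (simp_all add: power_kernel_eq cinner_prod_def)
qed

lemma K_self: "norm z < 1 \<Longrightarrow> K z z = of_real (Re (K z z))" "norm z < 1 \<Longrightarrow> Re (K z z) \<ge> 1"
proof -
  assume "norm z < 1"
  then have z: "0 \<le> (norm z)\<^sup>2" "(norm z)\<^sup>2 < 1" by (auto simp: abs_square_less_1)
  show "K z z = of_real (Re (K z z))" "Re (K z z) \<ge> 1"
    unfolding power_kernel_eq cinner_prod_self kappa_real(1)[OF z] using kappa_real(2)[OF z] by simp_all
qed

lemma K_nonzero: "z \<in> ball 0 1 \<Longrightarrow> w \<in> ball 0 1 \<Longrightarrow> K z w \<noteq> 0"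
  using complete_pick by (auto simp: complete_pick_kernel_def)

lemma hn_kf_0: "hn (kf 0) = 1"
proof -
  have "(hn (kf 0))\<^sup>2 = 1" using hn_kf_sq[of 0] by (simp add: K_zero)
  then show ?thesis using hn_nonneg[OF kf_mem, of 0] by (simp add: power2_eq_1_iff)
qed

lemma continuous_on_K:
  assumes "continuous_on S f" "continuous_on S g"
    and "\<And>x. x \<in> S \<Longrightarrow> cmod (cinner_prod (f x) (g x)) < 1"
  shows "continuous_on S (\<lambda>x. K (f x) (g x))"
  unfolding power_kernel_eq
  by (rule continuous_on_compose2[OF kappa_continuous_on]) (use assms in \<open>auto intro: continuous_intros\<close>)

text \<open>By Cauchy-Schwarz the increment of \<open>f\<close> is at most its norm times the
  distance of two kernel functions, and the square \<open>e\<close> of that distance is continuous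
  because the kernel is.\<close>

lemma continuous_on_mem:
  assumes f: "f \<in> H"
  shows "continuous_on (ball 0 1) f"
  unfolding continuous_on_def
proof
  fix x :: "complex ^ 'd" assume x: "x \<in> ball 0 1"
  define e where "e y = Re (K x x) + Re (K y y) - 2 * Re (K y x)" for y
  have ce: "continuous_on (ball 0 1) e"
    unfolding e_def using x by (intro continuous_intros continuous_on_K) (auto intro: cinner_prod_lt_1)
  have bound: "cmod (f y - f x) \<le> hn f * sqrt (e y)" if y: "y \<in> ball 0 1" for y
  proof -
    have "f y - f x = ip f (\<lambda>z. kf y z - kf x z)"
      using f x y by (simp add: ip_diff_right kf_mem ip_kf)
    moreover have "(hn (\<lambda>z. kf y z - kf x z))\<^sup>2 = e y"
      unfolding hn_diff_sq[OF kf_mem[OF y] kf_mem[OF x]] hn_kf_sq[OF x] hn_kf_sq[OF y]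
        ip_kf[OF kf_mem[OF y] x] kf_apply[OF x] e_def K_hermitian[OF x y] by simp
    moreover have "hn (\<lambda>z. kf y z - kf x z) \<ge> 0" using x y by (intro hn_nonneg diff_mem kf_mem)
    ultimately have "hn (\<lambda>z. kf y z - kf x z) = sqrt (e y)" by (metis real_sqrt_unique)
    then show ?thesis
      using ip_Cauchy_Schwarz[OF f diff_mem[OF kf_mem[OF y] kf_mem[OF x]]] \<open>f y - f x = _\<close> by simp
  qed
  have "(e \<longlongrightarrow> e x) (at x within ball 0 1)" using ce x by (simp add: continuous_on_def)
  moreover have "e x = 0" by (simp add: e_def)
  ultimately have "((\<lambda>y. hn f * sqrt (e y)) \<longlongrightarrow> hn f * sqrt 0) (at x within ball 0 1)"
    by (intro tendsto_intros) simp
  then have "((\<lambda>y. hn f * sqrt (e y)) \<longlongrightarrow> 0) (at x within ball 0 1)" by simp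
  then have "((\<lambda>y. f y - f x) \<longlongrightarrow> 0) (at x within ball 0 1)"
    by (rule Lim_null_comparison[rotated]) (use bound in \<open>auto simp: eventually_at_filter simp del: mem_ball\<close>)
  then show "(f \<longlongrightarrow> f x) (at x within ball 0 1)" by (rule LIM_zero_cancel)
qed

text \<open>The power series of the difference has the non-negative coefficients
  \<open>a n * (t ^ n - s ^ n)\<close>. This makes norms of potentials increase with the radius; the
  closed ball is needed since the masses sit on the sphere.\<close>

lemma psd_kappa_diff:
  assumes st: "0 \<le> s" "s \<le> t" "t < 1"
  shows "psd_kernel (cball (0 :: complex ^ 'd) 1) (\<lambda>z w. \<kappa> (of_real t * cinner_prod z w) - \<kappa> (of_real s * cinner_prod z w))"
proof (rule psd_limit[where k = "\<lambda>N z w. \<Sum>n<N. of_real (a n * (t ^ n - s ^ n)) * cinner_prod z w ^ n"])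
  show "psd_kernel (cball (0 :: complex ^ 'd) 1) (\<lambda>z w. \<Sum>n<N. of_real (a n * (t ^ n - s ^ n)) * cinner_prod z w ^ n)" for N
    using st a_pos by (intro psd_sum psd_scale psd_power psd_cinner_prod)
      (auto intro!: mult_nonneg_nonneg power_mono intro: less_imp_le)
  fix z w :: "complex ^ 'd" assume zw: "z \<in> cball 0 1" "w \<in> cball 0 1"
  define x where "x = cinner_prod z w"
  have "norm z * norm w \<le> 1 * 1" using zw by (intro mult_mono) auto
  then have "cmod x \<le> 1" using cinner_prod_norm_le[of z w] by (simp add: x_def)
  then have c: "cmod (of_real u * x) < 1" if "0 \<le> u" "u < 1" for u
    using that mult_left_le[of "cmod x" u] by (simp add: norm_mult)
  have *: "(\<lambda>n. of_real (a n) * (of_real u * x) ^ n) sums \<kappa> (of_real u * x)" if "0 \<le> u" "u < 1" for u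
    unfolding \<kappa>_def by (intro summable_sums summable_norm_cancel[OF summable_a] c that)
  have "(\<lambda>n. of_real (a n) * (of_real t * x) ^ n - of_real (a n) * (of_real s * x) ^ n) sums (\<kappa> (of_real t * x) - \<kappa> (of_real s * x))"
    using st by (intro sums_diff *) auto
  moreover have "of_real (a n) * (of_real t * x) ^ n - of_real (a n) * (of_real s * x) ^ n = of_real (a n * (t ^ n - s ^ n)) * x ^ n" for n
    by (simp add: power_mult_distrib algebra_simps)
  ultimately show "(\<lambda>N. \<Sum>n<N. of_real (a n * (t ^ n - s ^ n)) * cinner_prod z w ^ n)
     \<longlonglongrightarrow> \<kappa> (of_real t * cinner_prod z w) - \<kappa> (of_real s * cinner_prod z w)"
    by (simp add: sums_def x_def)
qed

lemma K_scaleR: "K (r *\<^sub>R z) (s *\<^sub>R w) = \<kappa> (of_real (r * s) * cinner_prod z w)"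
  by (simp add: power_kernel_eq cinner_prod_scaleR)

lemma scaleR_in_ball: "norm z \<le> 1 \<Longrightarrow> 0 \<le> r \<Longrightarrow> r < 1 \<Longrightarrow> r *\<^sub>R z \<in> ball 0 1"
  using mult_left_le[of "norm z" r] by simp

text \<open>The potential of the sum of the point masses \<open>c w\<close> at \<open>r *\<^sub>R w\<close>.\<close>

definition fpot :: "(complex ^ 'd) set \<Rightarrow> (complex ^ 'd \<Rightarrow> real) \<Rightarrow> real \<Rightarrow> complex ^ 'd \<Rightarrow> complex" where
  "fpot F c r = (\<lambda>z. \<Sum>w\<in>F. of_real (c w) * kf (r *\<^sub>R w) z)"

lemma fpot_mem:
  assumes "F \<subseteq> cball 0 1" "0 \<le> r" "r < 1"
  shows "fpot F c r \<in> H"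
  unfolding fpot_def using assms by (intro sum_mem kf_mem scaleR_in_ball) auto

lemma ip_fpot:
  assumes "F \<subseteq> cball 0 1" "0 \<le> r" "r < 1" "h \<in> H"
  shows "ip h (fpot F c r) = (\<Sum>w\<in>F. of_real (c w) * h (r *\<^sub>R w))"
proof -
  have m: "r *\<^sub>R w \<in> ball 0 1" if "w \<in> F" for w using assms that by (intro scaleR_in_ball) auto
  have "ip h (fpot F c r) = (\<Sum>w\<in>F. cnj (of_real (c w)) * ip h (kf (r *\<^sub>R w)))"
    unfolding fpot_def using m assms by (intro ip_sum_right kf_mem)
  also have "\<dots> = (\<Sum>w\<in>F. of_real (c w) * h (r *\<^sub>R w))"
    using m assms by (intro sum.cong refl) (simp add: ip_kf del: mem_ball)
  finally show ?thesis .
qed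

lemma hn_fpot_sq:
  assumes "finite F" "F \<subseteq> cball 0 1" "0 \<le> r" "r < 1"
  shows "(hn (fpot F c r))\<^sup>2 = Re (qform F (\<lambda>w. of_real (c w)) (\<lambda>z w. \<kappa> (of_real (r\<^sup>2) * cinner_prod z w)))"
proof -
  have m: "r *\<^sub>R w \<in> ball 0 1" if "w \<in> F" for w using assms that by (intro scaleR_in_ball) auto
  then have "(\<lambda>w. r *\<^sub>R w) ` F \<subseteq> ball 0 1" by auto
  from hn_kernel_sum[OF assms(1) this, of "\<lambda>w. of_real (c w)"] show ?thesis
    unfolding fpot_def K_scaleR by (simp add: power2_eq_square)
qed

lemma hn_fpot_mono:
  assumes "finite F" "F \<subseteq> cball 0 1" "0 \<le> r" "r \<le> s" "s < 1"
  shows "hn (fpot F c r) \<le> hn (fpot F c s)"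
proof (rule power2_le_imp_le)
  have "s\<^sup>2 < 1" "r\<^sup>2 \<le> s\<^sup>2" using assms by (auto simp: abs_square_less_1 intro: power_mono)
  then have "qform F (\<lambda>w. of_real (c w)) (\<lambda>z w. \<kappa> (of_real (s\<^sup>2) * cinner_prod z w) - \<kappa> (of_real (r\<^sup>2) * cinner_prod z w)) \<in> \<real>\<^sub>\<ge>\<^sub>0"
    using assms by (intro psd_qform[OF psd_kappa_diff]) auto
  then show "(hn (fpot F c r))\<^sup>2 \<le> (hn (fpot F c s))\<^sup>2"
    using assms by (simp add: hn_fpot_sq qform_diff complex_nonneg_Reals_iff)
  show "0 \<le> hn (fpot F c s)" using assms by (intro hn_nonneg fpot_mem) auto
qed

end

section \<open>Potentials and energy of a probability measure on the sphere\<close>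

locale cnp_sphere_measure = cnp_space a H ip + prob_space \<mu>
  for a and H :: "(complex ^ 'd::finite \<Rightarrow> complex) set" and ip and \<mu> :: "(complex ^ 'd) measure" +
  assumes sets_\<mu>: "sets \<mu> = sets (borel_sphere :: (complex ^ 'd) measure)"
begin

lemma space_\<mu>: "space \<mu> = sphere 0 1"
  using sets_eq_imp_space_eq[OF sets_\<mu>] by (simp add: space_restrict_space)

lemma measurable_\<mu>: "continuous_on (sphere 0 1) f \<Longrightarrow> f \<in> borel_measurable \<mu>"
  using borel_measurable_continuous_on_restrict[of "sphere 0 1" f] measurable_cong_sets[OF sets_\<mu> refl, of borel] by auto

lemma integrable_\<mu>:
  fixes f :: "complex ^ 'd \<Rightarrow> complex"
  assumes "continuous_on (sphere 0 1) f"
  shows "integrable \<mu> f"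
proof -
  obtain B where "\<And>x. x \<in> sphere 0 1 \<Longrightarrow> norm (f x) \<le> B"
    using compact_imp_bounded[OF compact_continuous_image[OF assms compact_sphere]]
    by (auto simp: bounded_iff simp del: mem_sphere mem_sphere_0)
  then show ?thesis
    using measurable_\<mu>[OF assms] by (intro integrable_const_bound[of _ B]) (auto simp: space_\<mu>)
qed

lemma integral_norm_le:
  fixes f :: "complex ^ 'd \<Rightarrow> complex"
  assumes "integrable \<mu> f" "\<And>x. x \<in> sphere 0 1 \<Longrightarrow> cmod (f x) \<le> C"
  shows "cmod (\<integral>x. f x \<partial>\<mu>) \<le> C"
proof -
  have "cmod (\<integral>x. f x \<partial>\<mu>) \<le> (\<integral>x. cmod (f x) \<partial>\<mu>)" by (rule integral_norm_bound)
  also have "\<dots> \<le> (\<integral>x. C \<partial>\<mu>)"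
    using assms by (intro integral_mono) (auto simp: space_\<mu>)
  finally show ?thesis by (simp add: prob_space)
qed

lemma continuous_on_dilate:
  assumes "h \<in> H" "0 \<le> r" "r < 1"
  shows "continuous_on (sphere 0 1) (\<lambda>z. h (r *\<^sub>R z))"
proof (rule continuous_on_compose2[OF continuous_on_mem[OF assms(1)]])
  show "(\<lambda>z. r *\<^sub>R z) ` sphere 0 1 \<subseteq> ball (0 :: complex ^ 'd) 1"
    using assms scaleR_in_ball[of _ r] by auto
qed (intro continuous_intros)

lemma pot_exists:
  assumes r: "0 \<le> r" "r < 1"
  shows "\<exists>U\<in>H. \<forall>h\<in>H. ip h U = (\<integral>z. h (r *\<^sub>R z) \<partial>\<mu>)"
proof (rule riesz[where C = "sqrt (Re (\<kappa> (of_real (r\<^sup>2))))"])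
  fix f g assume fg: "f \<in> H" "g \<in> H"
  show "(\<integral>z. f (r *\<^sub>R z) + g (r *\<^sub>R z) \<partial>\<mu>) = (\<integral>z. f (r *\<^sub>R z) \<partial>\<mu>) + (\<integral>z. g (r *\<^sub>R z) \<partial>\<mu>)"
    using fg r by (intro Bochner_Integration.integral_add integrable_\<mu> continuous_on_dilate)
next
  fix f c assume f: "f \<in> H"
  show "(\<integral>z. c * f (r *\<^sub>R z) \<partial>\<mu>) = c * (\<integral>z. f (r *\<^sub>R z) \<partial>\<mu>)" by simp
next
  have r2: "0 \<le> r\<^sup>2" "r\<^sup>2 < 1" using r by (auto simp: abs_square_less_1)
  show "0 \<le> sqrt (Re (\<kappa> (of_real (r\<^sup>2))))" using kappa_real[OF r2] by simp
  fix f assume f: "f \<in> H"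
  show "cmod (\<integral>z. f (r *\<^sub>R z) \<partial>\<mu>) \<le> sqrt (Re (\<kappa> (of_real (r\<^sup>2)))) * hn f"
  proof (rule integral_norm_le)
    show "integrable \<mu> (\<lambda>z. f (r *\<^sub>R z))" using f r by (intro integrable_\<mu> continuous_on_dilate)
    fix z :: "complex ^ 'd" assume z: "z \<in> sphere 0 1"
    then have rz: "r *\<^sub>R z \<in> ball 0 1" using r by (intro scaleR_in_ball) auto
    have "(hn (kf (r *\<^sub>R z)))\<^sup>2 = Re (\<kappa> (of_real (r\<^sup>2)))"
      using hn_kf_sq[OF rz] z by (simp add: K_scaleR cinner_prod_self power2_eq_square)
    then have "hn (kf (r *\<^sub>R z)) = sqrt (Re (\<kappa> (of_real (r\<^sup>2))))"
      using hn_nonneg[OF kf_mem[OF rz]] by (metis real_sqrt_unique)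
    then show "cmod (f (r *\<^sub>R z)) \<le> sqrt (Re (\<kappa> (of_real (r\<^sup>2)))) * hn f"
      using eval_bound[OF f rz] by (simp add: mult.commute)
  qed
qed

text \<open>The potential of \<open>\<mu>\<close> at radius \<open>r\<close>. As a Riesz vector it
  plays the part of an \<open>H\<close>-valued integral of kernel functions;
  \<open>pot_apply\<close> gives its values.\<close>

definition pot :: "real \<Rightarrow> complex ^ 'd \<Rightarrow> complex" where
  "pot r = (SOME U. U \<in> H \<and> (\<forall>h\<in>H. ip h U = (\<integral>z. h (r *\<^sub>R z) \<partial>\<mu>)))"

lemma pot:
  assumes "0 \<le> r" "r < 1"
  shows "pot r \<in> H" "\<And>h. h \<in> H \<Longrightarrow> ip h (pot r) = (\<integral>z. h (r *\<^sub>R z) \<partial>\<mu>)"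
proof -
  have "\<exists>U. U \<in> H \<and> (\<forall>h\<in>H. ip h U = (\<integral>z. h (r *\<^sub>R z) \<partial>\<mu>))" using pot_exists[OF assms] by blast
  from someI_ex[OF this] show "pot r \<in> H" "\<And>h. h \<in> H \<Longrightarrow> ip h (pot r) = (\<integral>z. h (r *\<^sub>R z) \<partial>\<mu>)"
    unfolding pot_def by blast+
qed

lemma pot_apply:
  assumes r: "0 \<le> r" "r < 1" and z: "z \<in> ball 0 1"
  shows "pot r z = (\<integral>w. K z (r *\<^sub>R w) \<partial>\<mu>)"
proof -
  have "pot r z = cnj (ip (kf z) (pot r))" using ip_kf_left[OF pot(1)[OF r] z] by simp
  also have "\<dots> = cnj (\<integral>w. kf z (r *\<^sub>R w) \<partial>\<mu>)" using pot(2)[OF r kf_mem[OF z]] by simp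
  also have "\<dots> = (\<integral>w. cnj (kf z (r *\<^sub>R w)) \<partial>\<mu>)" by simp
  also have "\<dots> = (\<integral>w. K z (r *\<^sub>R w) \<partial>\<mu>)"
  proof (rule Bochner_Integration.integral_cong)
    fix w assume "w \<in> space \<mu>"
    then have "r *\<^sub>R w \<in> ball 0 1" using r by (intro scaleR_in_ball) (auto simp: space_\<mu>)
    then show "cnj (kf z (r *\<^sub>R w)) = K z (r *\<^sub>R w)"
      using K_hermitian[OF _ z] by (simp add: kf_apply del: mem_ball)
  qed simp
  finally show ?thesis .
qed

text \<open>The mutual energy of the potentials at radii \<open>r\<close> and \<open>s\<close>
  depends only on \<open>t = r * s\<close>, so mutual energies and squared norms are values of one
  function.\<close>

definition mutual :: "real \<Rightarrow> complex" where
  "mutual t = (\<integral>z. \<integral>w. \<kappa> (of_real t * cinner_prod z w) \<partial>\<mu> \<partial>\<mu>)"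

lemma ip_pot:
  assumes "0 \<le> r" "r < 1" "0 \<le> s" "s < 1"
  shows "ip (pot s) (pot r) = mutual (r * s)"
proof -
  have "ip (pot s) (pot r) = (\<integral>z. pot s (r *\<^sub>R z) \<partial>\<mu>)" using assms by (intro pot)
  also have "\<dots> = mutual (r * s)"
    unfolding mutual_def
  proof (rule Bochner_Integration.integral_cong)
    fix z assume "z \<in> space \<mu>"
    then have "r *\<^sub>R z \<in> ball 0 1" using assms by (intro scaleR_in_ball) (auto simp: space_\<mu>)
    then show "pot s (r *\<^sub>R z) = (\<integral>w. \<kappa> (of_real (r * s) * cinner_prod z w) \<partial>\<mu>)"
      using assms by (simp only: pot_apply K_scaleR)
  qed simp
  finally show ?thesis .
qed

lemma hn_pot_sq: "0 \<le> r \<Longrightarrow> r < 1 \<Longrightarrow> (hn (pot r))\<^sup>2 = Re (mutual (r\<^sup>2))"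
  using ip_self(1)[OF pot(1)[of r]] ip_pot[of r r] by (simp only: power2_eq_square simp_thms)

lemma energy_eq: "energy a \<mu> = (SUP r\<in>{0..<1}. ennreal ((hn (pot r))\<^sup>2))"
  unfolding energy_def
proof (rule SUP_cong[OF refl])
  fix r :: real assume r: "r \<in> {0..<1}"
  then show "ennreal (Re (\<integral>z. \<integral>w. K (r *\<^sub>R z) (r *\<^sub>R w) \<partial>\<mu> \<partial>\<mu>)) = ennreal ((hn (pot r))\<^sup>2)"
    unfolding K_scaleR by (subst hn_pot_sq) (auto simp: mutual_def power2_eq_square)
qed

lemma integral_weighted_series:
  assumes t: "0 \<le> t" "t < 1"
    and f: "\<And>n. f n \<in> borel_measurable \<mu>" "\<And>n x. x \<in> sphere 0 1 \<Longrightarrow> cmod (f n x) \<le> 1"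
  shows "(\<lambda>n. of_real (a n * t ^ n) * (\<integral>x. f n x \<partial>\<mu>)) sums (\<integral>x. (\<Sum>n. of_real (a n * t ^ n) * f n x) \<partial>\<mu>)"
proof -
  have bound: "cmod (of_real (a n * t ^ n) * f n x) \<le> a n * t ^ n" if "x \<in> sphere 0 1" for n x
    using f(2)[OF that, of n] a_pos[of n] t mult_left_le[of "cmod (f n x)" "a n * t ^ n"]
    by (simp add: norm_mult norm_power abs_of_pos)
  have int: "integrable \<mu> (\<lambda>x. of_real (a n * t ^ n) * f n x)" for n
    using bound f(1) by (intro integrable_const_bound[of _ "a n * t ^ n"]) (auto simp: space_\<mu>)
  have "(\<lambda>n. (\<integral>x. of_real (a n * t ^ n) * f n x \<partial>\<mu>)) sums (\<integral>x. (\<Sum>n. of_real (a n * t ^ n) * f n x) \<partial>\<mu>)"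
  proof (rule sums_integral[OF int])
    show "AE x in \<mu>. summable (\<lambda>n. cmod (of_real (a n * t ^ n) * f n x))"
      by (rule AE_I2, rule summable_comparison_test'[OF summable_a_real[OF t], of 0]) (use bound in \<open>auto simp: space_\<mu>\<close>)
    show "summable (\<lambda>n. \<integral>x. cmod (of_real (a n * t ^ n) * f n x) \<partial>\<mu>)"
    proof (rule summable_comparison_test'[OF summable_a_real[OF t], of 0])
      fix n
      have "(\<integral>x. cmod (of_real (a n * t ^ n) * f n x) \<partial>\<mu>) \<le> (\<integral>x. a n * t ^ n \<partial>\<mu>)"
        using int bound by (intro integral_mono integrable_norm) (auto simp: space_\<mu>)
      then show "norm (\<integral>x. cmod (of_real (a n * t ^ n) * f n x) \<partial>\<mu>) \<le> a n * t ^ n"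
        by (simp add: prob_space)
    qed
  qed
  then show ?thesis by simp
qed

text \<open>The double integral of \<open>cinner_prod z w ^ n\<close>, by
  \<open>integral_cip_power_2\<close>, in a form that is visibly non-negative.\<close>

definition moment :: "nat \<Rightarrow> real" where
  "moment n = (\<Sum>\<alpha>\<in>Pi\<^sub>E {..<n} (\<lambda>_. UNIV). (cmod (\<integral>w. word_monom n \<alpha> w \<partial>\<mu>))\<^sup>2)"

lemma integral_cip_power:
  "(\<integral>w. cinner_prod z w ^ n \<partial>\<mu>) =
    (\<Sum>\<alpha>\<in>Pi\<^sub>E {..<n} (\<lambda>_. UNIV). word_monom n \<alpha> z * cnj (\<integral>w. word_monom n \<alpha> w \<partial>\<mu>))"
proof -
  have "integrable \<mu> (\<lambda>w. word_monom n \<alpha> z * cnj (word_monom n \<alpha> w))" for \<alpha>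
    by (intro integrable_\<mu> continuous_intros continuous_on_word_monom)
  then show ?thesis unfolding cinner_prod_power
    by (subst Bochner_Integration.integral_sum) auto
qed

lemma integral_cip_power_2: "(\<integral>z. \<integral>w. cinner_prod z w ^ n \<partial>\<mu> \<partial>\<mu>) = of_real (moment n)"
proof -
  have "integrable \<mu> (\<lambda>z. word_monom n \<alpha> z * c)" for \<alpha> c
    by (intro integrable_\<mu> continuous_intros continuous_on_word_monom)
  then have "(\<integral>z. \<integral>w. cinner_prod z w ^ n \<partial>\<mu> \<partial>\<mu>) =
     (\<Sum>\<alpha>\<in>Pi\<^sub>E {..<n} (\<lambda>_. UNIV). (\<integral>z. word_monom n \<alpha> z \<partial>\<mu>) * cnj (\<integral>w. word_monom n \<alpha> w \<partial>\<mu>))"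
    unfolding integral_cip_power by (subst Bochner_Integration.integral_sum) auto
  then show ?thesis unfolding moment_def of_real_sum complex_norm_square .
qed

text \<open>A power series in \<open>t\<close> with non-negative coefficients, hence increasing. The
  kernel is integrated termwise in \<open>w\<close> and then in \<open>z\<close>, dominated by the
  series of \<open>a n * t ^ n\<close>.\<close>

lemma mutual_sums:
  assumes t: "0 \<le> t" "t < 1"
  shows "(\<lambda>n. a n * t ^ n * moment n) sums Re (mutual t)"
proof -
  have cip: "cmod (cinner_prod z w ^ n) \<le> 1" if "z \<in> sphere 0 1" "w \<in> sphere 0 1" for z w :: "complex ^ 'd" and n
    using cinner_prod_norm_le[of z w] that by (simp add: norm_power power_le_one)
  have inner: "(\<integral>w. \<kappa> (of_real t * cinner_prod z w) \<partial>\<mu>) = (\<Sum>n. of_real (a n * t ^ n) * (\<integral>w. cinner_prod z w ^ n \<partial>\<mu>))"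
    if z: "z \<in> sphere 0 1" for z
  proof -
    have "(\<lambda>n. of_real (a n * t ^ n) * (\<integral>w. cinner_prod z w ^ n \<partial>\<mu>)) sums (\<integral>w. (\<Sum>n. of_real (a n * t ^ n) * cinner_prod z w ^ n) \<partial>\<mu>)"
      using cip z by (intro integral_weighted_series t measurable_\<mu> continuous_intros)
    then show ?thesis unfolding \<kappa>_def by (simp add: sums_iff power_mult_distrib mult.assoc)
  qed
  have "(\<lambda>n. of_real (a n * t ^ n) * (\<integral>z. \<integral>w. cinner_prod z w ^ n \<partial>\<mu> \<partial>\<mu>)) sums
     (\<integral>z. (\<Sum>n. of_real (a n * t ^ n) * (\<integral>w. cinner_prod z w ^ n \<partial>\<mu>)) \<partial>\<mu>)"
  proof (rule integral_weighted_series[OF t])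
    show "(\<lambda>z. \<integral>w. cinner_prod z w ^ n \<partial>\<mu>) \<in> borel_measurable \<mu>" for n
      unfolding integral_cip_power by (intro measurable_\<mu> continuous_intros continuous_on_word_monom)
    show "cmod (\<integral>w. cinner_prod z w ^ n \<partial>\<mu>) \<le> 1" if "z \<in> sphere 0 1" for n z
      using cip that by (intro integral_norm_le integrable_\<mu> continuous_intros)
  qed
  also have "(\<integral>z. (\<Sum>n. of_real (a n * t ^ n) * (\<integral>w. cinner_prod z w ^ n \<partial>\<mu>)) \<partial>\<mu>) = mutual t"
    unfolding mutual_def by (rule Bochner_Integration.integral_cong) (auto simp: inner space_\<mu>)
  finally have "(\<lambda>n. Re (of_real (a n * t ^ n) * of_real (moment n))) sums Re (mutual t)"
    unfolding integral_cip_power_2 by (rule sums_Re)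
  then show ?thesis by simp
qed

lemma moment_nonneg: "moment n \<ge> 0"
  unfolding moment_def by (intro sum_nonneg) auto

lemma mutual_mono:
  assumes "0 \<le> s" "s \<le> t" "t < 1"
  shows "Re (mutual s) \<le> Re (mutual t)"
proof (rule sums_le[OF _ mutual_sums mutual_sums])
  show "a n * s ^ n * moment n \<le> a n * t ^ n * moment n" for n
    using assms a_pos[of n] moment_nonneg by (intro mult_right_mono mult_left_mono power_mono) auto
qed (use assms in auto)

text \<open>For \<open>r \<le> s\<close>, monotonicity of \<open>mutual\<close> gives \<open>\<parallel>pot s - pot r\<parallel>\<^sup>2 \<le> \<parallel>pot s\<parallel>\<^sup>2 - \<parallel>pot r\<parallel>\<^sup>2\<close>.\<close>

lemma pot_Cauchy:
  assumes fin: "energy a \<mu> < \<infinity>" and e: "e > 0"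
  shows "\<exists>r. 0 \<le> r \<and> r < 1 \<and> (\<forall>s. r \<le> s \<longrightarrow> s < 1 \<longrightarrow> hn (\<lambda>z. pot s z - pot r z) \<le> e)"
proof -
  define S where "S = (\<lambda>r. (hn (pot r))\<^sup>2) ` {0..<1}"
  have "(hn (pot r))\<^sup>2 \<le> enn2real (energy a \<mu>)" if "r \<in> {0..<1}" for r
  proof -
    have "ennreal ((hn (pot r))\<^sup>2) \<le> energy a \<mu>" unfolding energy_eq using that by (intro SUP_upper)
    also have "energy a \<mu> = ennreal (enn2real (energy a \<mu>))" using fin by simp
    finally show ?thesis by (simp only: ennreal_le_iff[OF enn2real_nonneg])
  qed
  then have bdd: "bdd_above S" unfolding S_def by (intro bdd_aboveI2)
  have ne: "S \<noteq> {}" by (auto simp: S_def)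
  have "Sup S - e\<^sup>2 < Sup S" using e by simp
  then obtain r where r: "0 \<le> r" "r < 1" "Sup S - e\<^sup>2 < (hn (pot r))\<^sup>2"
    using less_cSupD[OF ne, of "Sup S - e\<^sup>2"] by (auto simp: S_def)
  have "hn (\<lambda>z. pot s z - pot r z) \<le> e" if s: "r \<le> s" "s < 1" for s
  proof (rule power2_le_imp_le)
    have s0: "0 \<le> s" using r s by simp
    have "(hn (pot s))\<^sup>2 \<le> Sup S" using s s0 bdd by (intro cSup_upper) (auto simp: S_def)
    moreover have "(hn (pot r))\<^sup>2 \<le> Re (ip (pot s) (pot r))"
    proof -
      have "r\<^sup>2 \<le> r * s" "r * s < 1" using r s s0 mult_strict_mono[of r 1 s 1]
        by (auto simp: power2_eq_square mult_left_mono)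
      then show ?thesis using r s s0 by (simp add: hn_pot_sq ip_pot mutual_mono)
    qed
    ultimately show "(hn (\<lambda>z. pot s z - pot r z))\<^sup>2 \<le> e\<^sup>2"
      using hn_diff_sq[OF pot(1)[OF s0 s(2)] pot(1)[OF r(1,2)]] r(3) by simp
  qed (use e in simp)
  then show ?thesis using r by blast
qed

text \<open>The form in which finite energy is used below. The difference of the two integrals is
  the inner product of \<open>g\<close> with \<open>pot s - pot r\<close>, so uniformity in
  \<open>g\<close> is Cauchy-Schwarz.\<close>

lemma finite_energy_uniform:
  assumes fin: "energy a \<mu> < \<infinity>" and e: "e > 0"
  shows "\<exists>r. 0 \<le> r \<and> r < 1 \<and> (\<forall>s g. r \<le> s \<longrightarrow> s < 1 \<longrightarrow> g \<in> H \<longrightarrow>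
     cmod ((\<integral>z. g (s *\<^sub>R z) \<partial>\<mu>) - (\<integral>z. g (r *\<^sub>R z) \<partial>\<mu>)) \<le> e * hn g)"
proof -
  obtain r where r: "0 \<le> r" "r < 1" "\<And>s. r \<le> s \<Longrightarrow> s < 1 \<Longrightarrow> hn (\<lambda>z. pot s z - pot r z) \<le> e"
    using pot_Cauchy[OF assms] by blast
  have "cmod ((\<integral>z. g (s *\<^sub>R z) \<partial>\<mu>) - (\<integral>z. g (r *\<^sub>R z) \<partial>\<mu>)) \<le> e * hn g"
    if s: "r \<le> s" "s < 1" and g: "g \<in> H" for s g
  proof -
    have s0: "0 \<le> s" using r s by simp
    note ps = pot(1)[OF s0 s(2)] and pr = pot(1)[OF r(1,2)]
    have "(\<integral>z. g (s *\<^sub>R z) \<partial>\<mu>) - (\<integral>z. g (r *\<^sub>R z) \<partial>\<mu>) = ip g (\<lambda>z. pot s z - pot r z)"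
      using ip_diff_right[OF ps pr g] pot(2)[OF s0 s(2) g] pot(2)[OF r(1,2) g] by simp
    then have "cmod ((\<integral>z. g (s *\<^sub>R z) \<partial>\<mu>) - (\<integral>z. g (r *\<^sub>R z) \<partial>\<mu>)) \<le> hn g * hn (\<lambda>z. pot s z - pot r z)"
      using ip_Cauchy_Schwarz[OF g diff_mem[OF ps pr]] by simp
    also have "\<dots> \<le> hn g * e" using r(3)[OF s] hn_nonneg[OF g] by (intro mult_left_mono)
    finally show ?thesis by (simp add: mult.commute)
  qed
  then show ?thesis using r(1,2) by blast
qed

end

section \<open>Potentials on sets that carry no measure of finite energy\<close>

context cnp_space
begin

text \<open>If finite combinations of point masses on \<open>A\<close> had bounded energy at radii tending to 1,
  a weak limit would have finite energy.\<close>

lemma fpot_norm_large: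
  fixes A :: "(complex ^ 'd) set"
  assumes A: "compact A" "A \<subseteq> sphere 0 1"
    and inf: "\<And>\<mu>. prob_space \<mu> \<Longrightarrow> sets \<mu> = sets (borel_sphere :: (complex ^ 'd) measure) \<Longrightarrow>
      emeasure \<mu> (sphere 0 1 - A) = 0 \<Longrightarrow> energy a \<mu> = \<infinity>"
  shows "\<exists>r. 0 < r \<and> r < 1 \<and> (\<forall>F c. finite F \<longrightarrow> F \<subseteq> A \<longrightarrow> (\<forall>w\<in>F. c w \<ge> 0) \<longrightarrow> sum c F = 1 \<longrightarrow> C \<le> hn (fpot F c r))"
proof (rule ccontr)
  assume contr: "\<not> ?thesis"
  define r where "r n = 1 - 1 / real (n + 2)" for n
  have r: "0 < r n" "r n < 1" for n by (auto simp: r_def)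
  have "\<exists>F c. finite F \<and> F \<subseteq> A \<and> (\<forall>w\<in>F. c w \<ge> 0) \<and> sum c F = 1 \<and> hn (fpot F c (r n)) < C" for n
    using contr r[of n] by (auto simp: not_le)
  then obtain F c where F: "\<And>n. finite (F n)" "\<And>n. F n \<subseteq> A"
    and c: "\<And>n w. w \<in> F n \<Longrightarrow> c n w \<ge> 0" "\<And>n. sum (c n) (F n) = 1"
    and lt: "\<And>n. hn (fpot (F n) (c n) (r n)) < C"
    by metis
  obtain q \<mu> where q: "strict_mono q" and \<mu>: "prob_space \<mu>" "sets \<mu> = sets (borel_sphere :: (complex ^ 'd) measure)"
      "emeasure \<mu> (sphere 0 1 - A) = 0"
    and lim: "\<And>f :: complex ^ 'd \<Rightarrow> complex. continuous_on (sphere 0 1) f \<Longrightarrow>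
        (\<lambda>n. \<Sum>w\<in>F (q n). of_real (c (q n) w) * f w) \<longlonglongrightarrow> (\<integral>x. f x \<partial>\<mu>)"
    using finite_measures_weak_limit[of A F c, OF A F c] by blast
  interpret \<mu>: prob_space \<mu> by fact
  interpret cnp_sphere_measure a H ip \<mu> by unfold_locales (rule \<mu>(2))
  have AB: "A \<subseteq> cball 0 1" using A(2) by (auto simp: sphere_def)
  have rlim: "r \<longlonglongrightarrow> 1"
  proof -
    have "(\<lambda>n. 1 / real (n + 2)) \<longlonglongrightarrow> 0"
      using LIMSEQ_ignore_initial_segment[OF lim_1_over_n, of 2] by simp
    then have "(\<lambda>n. 1 - 1 / real (n + 2)) \<longlonglongrightarrow> 1 - 0" by (intro tendsto_intros)
    then show ?thesis by (simp add: r_def[abs_def])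
  qed
  \<comment> \<open>The potential of the limit measure is its own test function. Weak convergence
    turns its inner products with the finite potentials at radius \<open>s\<close> into its squared
    norm, and monotonicity in the radius bounds those finite potentials by \<open>C\<close> as soon
    as \<open>s < r (q n)\<close>.\<close>
  have bound: "hn (pot s) \<le> C" if s: "0 \<le> s" "s < 1" for s
  proof -
    note ps = pot(1)[OF s]
    have ev: "\<forall>\<^sub>F n in sequentially. cmod (\<Sum>w\<in>F (q n). of_real (c (q n) w) * pot s (s *\<^sub>R w)) \<le> hn (pot s) * C"
    proof -
      have "\<forall>\<^sub>F n in sequentially. s < r (q n)"
        using order_tendstoD(1)[OF LIMSEQ_subseq_LIMSEQ[OF rlim q], of s] s by (simp add: o_def)
      then show ?thesis
      proof eventually_elim
        case (elim n)
        have FB: "F (q n) \<subseteq> cball 0 1" using F(2) AB by blast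
        have "(\<Sum>w\<in>F (q n). of_real (c (q n) w) * pot s (s *\<^sub>R w)) = ip (pot s) (fpot (F (q n)) (c (q n)) s)"
          by (rule ip_fpot[OF FB s ps, symmetric])
        also have "cmod \<dots> \<le> hn (pot s) * hn (fpot (F (q n)) (c (q n)) s)"
          by (intro ip_Cauchy_Schwarz ps fpot_mem FB s)
        also have "\<dots> \<le> hn (pot s) * C"
          using hn_fpot_mono[OF F(1) FB s(1) less_imp_le[OF elim] r(2)] lt[of "q n"] hn_nonneg[OF ps]
          by (intro mult_left_mono) (auto intro: order_trans less_imp_le)
        finally show ?case .
      qed
    qed
    have "(\<lambda>n. cmod (\<Sum>w\<in>F (q n). of_real (c (q n) w) * pot s (s *\<^sub>R w))) \<longlonglongrightarrow> cmod (\<integral>z. pot s (s *\<^sub>R z) \<partial>\<mu>)"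
      by (intro tendsto_norm lim continuous_on_dilate ps s)
    then have "cmod (\<integral>z. pot s (s *\<^sub>R z) \<partial>\<mu>) \<le> hn (pot s) * C"
      by (rule tendsto_upperbound[OF _ ev]) simp
    moreover have "cmod (\<integral>z. pot s (s *\<^sub>R z) \<partial>\<mu>) = (hn (pot s))\<^sup>2"
      unfolding pot(2)[OF s ps, symmetric] ip_self(2)[OF ps] by (simp add: norm_power)
    ultimately have "(hn (pot s))\<^sup>2 \<le> hn (pot s) * C" by simp
    moreover have "C > 0" using lt[of 0] hn_nonneg[OF fpot_mem[of "F 0" "r 0" "c 0"]] F(2)[of 0] AB r[of 0] by force
    ultimately show ?thesis
      using hn_nonneg[OF ps] by (cases "hn (pot s) = 0") (auto simp: power2_eq_square)
  qed
  have "energy a \<mu> \<le> ennreal (C\<^sup>2)"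
    unfolding energy_eq using bound pot(1)
    by (intro SUP_least ennreal_leI power_mono) (auto intro: hn_nonneg)
  then show False using inf[OF \<mu>] by (auto simp: top_unique)
qed

text \<open>A combination of almost minimal energy among those on \<open>A\<close>: moving a little mass to
  \<open>\<zeta>\<close> cannot lower the energy much, which bounds the potential at \<open>\<zeta>\<close> from below.\<close>

lemma large_potential:
  fixes A :: "(complex ^ 'd) set"
  assumes A: "compact A" "A \<subseteq> sphere 0 1" "A \<noteq> {}"
    and inf: "\<And>\<mu>. prob_space \<mu> \<Longrightarrow> sets \<mu> = sets (borel_sphere :: (complex ^ 'd) measure) \<Longrightarrow>
      emeasure \<mu> (sphere 0 1 - A) = 0 \<Longrightarrow> energy a \<mu> = \<infinity>"
    and C: "C \<ge> 1"
  shows "\<exists>F c \<rho> T. finite F \<and> F \<subseteq> A \<and> (\<forall>w\<in>F. c w \<ge> 0) \<and> sum c F = 1 \<and> 0 < \<rho> \<and> \<rho> < 1 \<and> C \<le> T \<and>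
     hn (fpot F c \<rho>) \<le> T \<and> (\<forall>\<zeta>\<in>A. C * T \<le> Re (\<Sum>w\<in>F. of_real (c w) * K \<zeta> (\<rho> *\<^sub>R w)))"
proof -
  \<comment> \<open>The extra 1 gives \<open>T * (T - C) \<ge> 1\<close>, which absorbs the loss in
    \<open>lower\<close>.\<close>
  obtain r where r: "0 < r" "r < 1"
    and large: "\<And>F c. finite F \<Longrightarrow> F \<subseteq> A \<Longrightarrow> (\<forall>w\<in>F. c w \<ge> 0) \<Longrightarrow> sum c F = 1 \<Longrightarrow> C + 1 \<le> hn (fpot F c r)"
    using fpot_norm_large[OF A(1,2) inf, of "C + 1"] by blast
  have AB: "A \<subseteq> cball 0 1" using A(2) by (auto simp: sphere_def)
  define adm where "adm F c \<longleftrightarrow> finite F \<and> F \<subseteq> A \<and> (\<forall>w\<in>F. c w \<ge> (0::real)) \<and> sum c F = 1" for F c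
  define S where "S = {(hn (fpot F c r))\<^sup>2 | F c. adm F c}"
  obtain \<zeta>0 where "\<zeta>0 \<in> A" using A(3) by blast
  then have "adm {\<zeta>0} (\<lambda>_. 1)" by (simp add: adm_def)
  then have "S \<noteq> {}" by (auto simp: S_def)
  have bdd: "bdd_below S" by (rule bdd_belowI[of _ 0]) (auto simp: S_def)
  define Q where "Q = Re (\<kappa> (of_real (r\<^sup>2)))"
  have r2: "0 \<le> r\<^sup>2" "r\<^sup>2 < 1" using r by (auto simp: abs_square_less_1)
  have Q: "Q \<ge> 1" using kappa_real[OF r2] by (simp add: Q_def)
  text \<open>\<open>t\<close> is the mass moved and \<open>t\<^sup>2\<close> the tolerance; \<open>2 * Q + 2 * (Inf S + 1)\<close> bounds the square
    of the distance to the kernel at \<open>\<zeta>\<close>.\<close>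
  define D where "D = 2 * Q + 2 * (Inf S + 1)"
  have "Inf S \<ge> 0" using \<open>S \<noteq> {}\<close> by (intro cInf_greatest) (auto simp: S_def)
  then have D: "D \<ge> 1" using Q by (simp add: D_def)
  define t where "t = 1 / (D + 1)"
  have t: "0 < t" "t < 1" using D by (auto simp: t_def)
  have t2: "t\<^sup>2 \<le> 1" using t by (simp add: power_le_one)
  obtain F c where adm: "adm F c" and near: "(hn (fpot F c r))\<^sup>2 < Inf S + t\<^sup>2"
    using cInf_lessD[OF \<open>S \<noteq> {}\<close>, of "Inf S + t\<^sup>2"] t by (auto simp: S_def)
  have F: "finite F" "F \<subseteq> A" "\<And>w. w \<in> F \<Longrightarrow> c w \<ge> 0" "sum c F = 1" using adm by (auto simp: adm_def)
  have FB: "F \<subseteq> cball 0 1" using F(2) AB by blast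
  define T where "T = hn (fpot F c r)"
  have T: "T \<ge> C + 1" unfolding T_def using F by (intro large) auto
  have pm: "fpot F c r \<in> H" using FB r by (intro fpot_mem) auto
  have lower: "T\<^sup>2 - 1 \<le> Re (fpot F c r (r *\<^sub>R \<zeta>))" if \<zeta>: "\<zeta> \<in> A" for \<zeta>
  proof -
    have r\<zeta>: "r *\<^sub>R \<zeta> \<in> ball 0 1" using \<zeta> AB r by (intro scaleR_in_ball) auto
    define k where "k = kf (r *\<^sub>R \<zeta>)"
    have k: "k \<in> H" using kf_mem[OF r\<zeta>] by (simp add: k_def)
    have \<zeta>1: "norm \<zeta> = 1" using \<zeta> A(2) by auto
    have kQ: "(hn k)\<^sup>2 = Q" unfolding k_def hn_kf_sq[OF r\<zeta>] K_scaleR cinner_prod_self \<zeta>1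
      by (simp add: Q_def power2_eq_square)
    \<comment> \<open>The mixture of the given masses with a point mass at \<open>\<zeta>\<close>,
      written so that \<open>\<zeta>\<close> may already belong to \<open>F\<close>.\<close>
    define d where "d w = (1 - t) * (if w \<in> F then c w else 0) + t * (if w = \<zeta> then 1 else 0)" for w
    have sumd: "(\<Sum>w\<in>insert \<zeta> F. of_real (d w) * u w) = of_real (1 - t) * (\<Sum>w\<in>F. of_real (c w) * u w) + of_real t * u \<zeta>" for u :: "complex ^ 'd \<Rightarrow> complex"
    proof -
      have "(\<Sum>w\<in>insert \<zeta> F. of_real (d w) * u w) =
        of_real (1 - t) * (\<Sum>w\<in>insert \<zeta> F. of_real (if w \<in> F then c w else 0) * u w) + of_real t * (\<Sum>w\<in>insert \<zeta> F. of_real (if w = \<zeta> then 1 else 0) * u w)"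
        by (simp add: d_def sum_distrib_left sum.distrib[symmetric] algebra_simps del: sum.insert)
      moreover have "(\<Sum>w\<in>insert \<zeta> F. of_real (if w \<in> F then c w else 0) * u w) = (\<Sum>w\<in>F. of_real (c w) * u w)"
        using F(1) by (intro sum.mono_neutral_cong_right) auto
      moreover have "(\<Sum>w\<in>insert \<zeta> F. of_real (if w = \<zeta> then 1 else 0) * u w) = (\<Sum>w\<in>{\<zeta>}. u w)"
        using F(1) by (intro sum.mono_neutral_cong_right) auto
      ultimately show ?thesis by simp
    qed
    have "complex_of_real (sum d (insert \<zeta> F)) = of_real (1 - t) * of_real (sum c F) + of_real t"
      using sumd[of "\<lambda>_. 1"] by simp
    then have "sum d (insert \<zeta> F) = 1" using F(4) by (metis add.commute diff_add_cancel mult.right_neutral of_real_1 of_real_add of_real_eq_iff)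
    then have "adm (insert \<zeta> F) d"
      unfolding adm_def using F \<zeta> t by (auto simp: d_def)
    then have "Inf S \<le> (hn (fpot (insert \<zeta> F) d r))\<^sup>2" using bdd by (intro cInf_lower) (auto simp: S_def)
    also have "fpot (insert \<zeta> F) d r = (\<lambda>z. fpot F c r z + of_real t * (k z - fpot F c r z))"
      unfolding fpot_def[of "insert \<zeta> F"] sumd by (simp add: fpot_def k_def algebra_simps)
    also have "(hn (\<lambda>z. fpot F c r z + of_real t * (k z - fpot F c r z)))\<^sup>2 =
       T\<^sup>2 + t\<^sup>2 * (hn (\<lambda>z. k z - fpot F c r z))\<^sup>2 + 2 * t * (Re (ip (fpot F c r) k) - T\<^sup>2)"
      unfolding hn_add_sq[OF pm scale_mem[OF diff_mem[OF k pm]]] hn_scale[OF diff_mem[OF k pm]]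
        ip_scale_right[OF diff_mem[OF k pm] pm] ip_diff_right[OF k pm pm] ip_self(2)[OF pm] T_def[symmetric]
      using t by (simp add: power_mult_distrib)
    also have "(hn (\<lambda>z. k z - fpot F c r z))\<^sup>2 \<le> 2 * Q + 2 * T\<^sup>2"
    proof -
      have "- (hn k * T) \<le> Re (ip k (fpot F c r))"
        using ip_Cauchy_Schwarz[OF k pm] abs_Re_le_cmod[of "ip k (fpot F c r)"] unfolding T_def by linarith
      moreover have "0 \<le> (hn k - T)\<^sup>2" by simp
      ultimately show ?thesis
        unfolding hn_diff_sq[OF k pm] T_def[symmetric] using kQ by (simp add: power2_diff)
    qed
    finally have "Inf S \<le> T\<^sup>2 + t\<^sup>2 * (2 * Q + 2 * T\<^sup>2) + 2 * t * (Re (ip (fpot F c r) k) - T\<^sup>2)"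
      using t by (simp add: mult_left_mono)
    moreover have "T\<^sup>2 \<le> Inf S + 1" using near t2 by (simp add: T_def)
    then have "2 * Q + 2 * T\<^sup>2 \<le> D" by (simp add: D_def)
    then have "t\<^sup>2 * (2 * Q + 2 * T\<^sup>2) \<le> t\<^sup>2 * D" by (intro mult_left_mono) auto
    ultimately have "T\<^sup>2 - t\<^sup>2 \<le> T\<^sup>2 + t\<^sup>2 * D + 2 * t * (Re (ip (fpot F c r) k) - T\<^sup>2)"
      using near by (simp add: T_def)
    then have "2 * t * (T\<^sup>2 - Re (ip (fpot F c r) k)) \<le> t * (t * (D + 1))"
      by (simp add: algebra_simps power2_eq_square)
    then have "2 * (T\<^sup>2 - Re (ip (fpot F c r) k)) \<le> t * (D + 1)"
      using t(1) by (simp add: mult.assoc mult.left_commute)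
    also have "t * (D + 1) = 1" using D by (simp add: t_def)
    finally have "T\<^sup>2 - 1 \<le> Re (ip (fpot F c r) k)" by simp
    then show ?thesis using ip_kf[OF pm r\<zeta>] by (simp add: k_def)
  qed
  \<comment> \<open>Since \<open>K (r *\<^sub>R \<zeta>) (r *\<^sub>R w) = K \<zeta> (r\<^sup>2
    *\<^sub>R w)\<close>, moving the masses to radius \<open>r\<^sup>2\<close> carries the estimate
    from \<open>r *\<^sub>R \<zeta>\<close> to the boundary point itself. This is the origin of
    \<open>\<rho> = r\<^sup>2\<close>.\<close>
  have "C * T \<le> Re (\<Sum>w\<in>F. of_real (c w) * K \<zeta> (r\<^sup>2 *\<^sub>R w))" if \<zeta>: "\<zeta> \<in> A" for \<zeta>
  proof -
    have r\<zeta>: "r *\<^sub>R \<zeta> \<in> ball 0 1" using \<zeta> AB r by (intro scaleR_in_ball) auto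
    have "fpot F c r (r *\<^sub>R \<zeta>) = (\<Sum>w\<in>F. of_real (c w) * K \<zeta> (r\<^sup>2 *\<^sub>R w))"
      unfolding fpot_def
    proof (intro sum.cong refl arg_cong2[of _ _ _ _ "(*)"])
      fix w assume "w \<in> F"
      show "kf (r *\<^sub>R w) (r *\<^sub>R \<zeta>) = K \<zeta> (r\<^sup>2 *\<^sub>R w)"
        using r\<zeta> K_scaleR[of r \<zeta> r w] K_scaleR[of 1 \<zeta> "r\<^sup>2" w] by (simp add: kf_apply power2_eq_square del: mem_ball)
    qed
    moreover have "C * T \<le> T\<^sup>2 - 1"
    proof -
      have "1 * 1 \<le> T * (T - C)" using T C by (intro mult_mono) auto
      then show ?thesis by (simp add: power2_eq_square algebra_simps)
    qed
    ultimately show ?thesis using lower[OF \<zeta>] by simp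
  qed
  moreover have "hn (fpot F c (r\<^sup>2)) \<le> T"
    unfolding T_def using F FB r r2 by (intro hn_fpot_mono) (auto simp: power2_eq_square mult_left_le)
  ultimately show ?thesis
    using F r r2 T by (intro exI[of _ F] exI[of _ c] exI[of _ "r\<^sup>2"] exI[of _ T]) auto
qed

end

section \<open>The Sarason function and Henkin measures\<close>

context cnp_space
begin

definition Bk :: "complex ^ 'd \<Rightarrow> complex ^ 'd \<Rightarrow> complex" where
  "Bk z w = 1 - 1 / K z w"

lemma psd_Bk: "psd_kernel (ball 0 1) Bk"
  using complete_pick by (simp add: complete_pick_kernel_def Bk_def[abs_def])

lemma K_mult_Bk: "z \<in> ball 0 1 \<Longrightarrow> w \<in> ball 0 1 \<Longrightarrow> K z w * Bk z w = K z w - 1"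
  using K_nonzero[of z w] by (simp add: Bk_def right_diff_distrib)

lemma Bk_diag:
  assumes "x \<in> ball 0 1"
  shows "Bk x x = of_real (Re (Bk x x))" "0 \<le> Re (Bk x x)" "Re (Bk x x) < 1"
proof -
  show "0 \<le> Re (Bk x x)" "Bk x x = of_real (Re (Bk x x))"
    using psd_diag[OF psd_Bk assms] by (auto simp: complex_nonneg_Reals_iff complex_eq_iff)
  obtain k where k: "K x x = complex_of_real k" "k \<ge> 1" using K_self[of x] assms by auto
  show "Re (Bk x x) < 1" unfolding Bk_def k(1) using k(2) by (simp add: Re_divide_of_real)
qed

text \<open>Slices of a psd kernel \<open>G\<close> with \<open>K G \<le> K\<close> are multipliers, because
  \<open>G z x * G x w \<le> G x x * G z w\<close>.\<close>

lemma mult_bound_slice: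
  assumes G: "psd_kernel (ball 0 1) G" and KG: "psd_kernel (ball 0 1) (\<lambda>z w. K z w - K z w * G z w)"
    and x: "x \<in> ball 0 1"
  shows "mult_bound (\<lambda>z. G z x) (sqrt (Re (G x x)))"
proof -
  have d: "0 \<le> Re (G x x)" "G x x = of_real (Re (G x x))"
    using psd_diag[OF G x] by (auto simp: complex_nonneg_Reals_iff complex_eq_iff)
  have "psd_kernel (ball 0 1) (\<lambda>z w. K z w * (G x x * G z w - G z x * G x w) + of_real (Re (G x x)) * (K z w - K z w * G z w))"
    using d(1) by (intro psd_add psd_mult psd_K psd_Schur_complement G x psd_scale KG)
  then have "psd_kernel (ball 0 1) (\<lambda>z w. K z w * (of_real ((sqrt (Re (G x x)))\<^sup>2) - G z x * cnj (G w x)))"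
  proof (rule psd_cong_imp)
    fix z w :: "complex ^ 'd" assume zw: "z \<in> ball 0 1" "w \<in> ball 0 1"
    have "cnj (G w x) = G x w" using psd_hermitian[OF G zw(2) x] by simp
    moreover have "of_real ((sqrt (Re (G x x)))\<^sup>2) = G x x" using d by simp
    moreover have "of_real (Re (G x x)) = G x x" using d(2) by simp
    ultimately show "K z w * (of_real ((sqrt (Re (G x x)))\<^sup>2) - G z x * cnj (G w x)) =
      K z w * (G x x * G z w - G z x * G x w) + of_real (Re (G x x)) * (K z w - K z w * G z w)"
      by (simp only:) (simp add: algebra_simps)
  qed
  then show ?thesis using d(1) by (simp add: mult_bound_def)
qed

lemma psd_K_minus_KB: "psd_kernel (ball 0 1) (\<lambda>z w. K z w - K z w * Bk z w)"
  by (rule psd_cong_imp[OF psd_one]) (simp add: K_mult_Bk del: mem_ball)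

lemma mult_bound_Bk: "x \<in> ball 0 1 \<Longrightarrow> mult_bound (\<lambda>z. Bk z x) (sqrt (Re (Bk x x)))"
  by (rule mult_bound_slice[OF psd_Bk psd_K_minus_KB])

lemma kf_eq_inverse: "z \<in> ball 0 1 \<Longrightarrow> x \<in> ball 0 1 \<Longrightarrow> kf x z = 1 / (1 - Bk z x)"
  by (simp add: kf_apply Bk_def del: mem_ball)

lemma Bk_neq_1: "z \<in> ball 0 1 \<Longrightarrow> w \<in> ball 0 1 \<Longrightarrow> Bk z w \<noteq> 1"
  using K_nonzero[of z w] by (simp add: Bk_def)

text \<open>The slice \<open>Bk z x\<close> is a multiplier of norm strictly below 1, so its Neumann
  inverse, the kernel function at \<open>x\<close>, is a multiplier too.\<close>

lemma mult_bound_kf: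
  assumes x: "x \<in> ball 0 1"
  shows "mult_bound (kf x) (1 / (1 - sqrt (Re (Bk x x))))"
proof (rule mult_bound_cong)
  show "mult_bound (\<lambda>z. 1 / (1 - Bk z x)) (1 / (1 - sqrt (Re (Bk x x))))"
    using Bk_diag[OF x] Bk_neq_1[OF _ x] by (intro mult_bound_inverse mult_bound_Bk x) auto
qed (use x kf_eq_inverse in blast)

text \<open>With \<open>p = 1 / (1 - B)\<close> and \<open>q = 1 / (1 - D)\<close> one has
  \<open>p + q - 1 = p * q * (1 - B * D)\<close>: accretivity of the kernel function is
  contractivity of \<open>Bk\<close> in linear form.\<close>

lemma psd_kf_accretive:
  assumes x: "x \<in> ball 0 1"
  shows "psd_kernel (ball 0 1) (\<lambda>z w. K z w * (kf x z + cnj (kf x w) - 1))"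
proof -
  have "mult_bound (\<lambda>z. Bk z x) 1" using Bk_diag[OF x] by (intro mult_bound_mono[OF mult_bound_Bk[OF x]]) simp
  then have "psd_kernel (ball 0 1) (\<lambda>z w. kf x z * cnj (kf x w) * (K z w * (of_real (1\<^sup>2) - Bk z x * cnj (Bk w x))))"
    unfolding mult_bound_def by (intro psd_congruence) blast
  then show ?thesis
  proof (rule psd_cong_imp)
    fix z w :: "complex ^ 'd" assume zw: "z \<in> ball 0 1" "w \<in> ball 0 1"
    define p q where "p = kf x z" and "q = cnj (kf x w)"
    have pq: "p \<noteq> 0" "q \<noteq> 0" using K_nonzero[OF zw(1) x] K_nonzero[OF zw(2) x]
      by (simp_all add: p_def q_def kf_apply zw del: mem_ball mem_ball_0)
    have BB: "Bk z x = 1 - 1 / p" "cnj (Bk w x) = 1 - 1 / q"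
      by (simp_all add: p_def q_def kf_apply[OF zw(1)] kf_apply[OF zw(2)] Bk_def)
    show "K z w * (kf x z + cnj (kf x w) - 1) =
        kf x z * cnj (kf x w) * (K z w * (of_real (1\<^sup>2) - Bk z x * cnj (Bk w x)))"
      unfolding p_def[symmetric] q_def[symmetric] BB using pq by (simp add: field_simps)
  qed
qed

text \<open>The row of multipliers \<open>Bk _ (p j)\<close>: Cauchy-Schwarz for the psd kernel \<open>Bk \<otimes> ip\<close> on pairs
  (point, vector), between the pairs \<open>(p j, h j)\<close> and the pairs \<open>(x, kf x)\<close>.\<close>

lemma row_contraction:
  assumes I: "finite I" "p ` I \<subseteq> ball 0 1" and h: "\<And>i. i \<in> I \<Longrightarrow> h i \<in> H"
  shows "(hn (\<lambda>x. \<Sum>j\<in>I. c j * (Bk x (p j) * h j x)))\<^sup>2 \<le> Re (qform I c (\<lambda>i j. Bk (p i) (p j) * ip (h j) (h i)))"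
proof -
  define R where "R = Re (qform I c (\<lambda>i j. Bk (p i) (p j) * ip (h j) (h i)))"
  define G where "G = (\<lambda>(x, f) (y, g). Bk x y * ip g f)"
  have psdG: "psd_kernel (ball 0 1 \<times> H) G"
    unfolding G_def case_prod_beta
    by (intro psd_mult psd_pullback[OF psd_Bk, of fst] psd_pullback[OF psd_gram, of snd]) auto
  have J: "(\<lambda>i. (p i, h i)) ` I \<subseteq> ball 0 1 \<times> H" using I h by auto
  have R: "R \<ge> 0"
    using psd_family[OF psdG I(1) J, of c] by (simp add: R_def G_def complex_nonneg_Reals_iff)
  define x where "x = (\<lambda>z. \<Sum>j\<in>I. c j * (Bk z (p j) * h j z))"
  have "psd_kernel (ball 0 1) (\<lambda>z w. of_real ((sqrt R)\<^sup>2) * K z w - x z * cnj (x w))"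
  proof (rule psd_kernelI)
    fix F d assume F: "finite F" "F \<subseteq> ball (0 :: complex ^ 'd) 1"
    define L where "L = (\<Sum>z\<in>F. cnj (d z) * x z)"
    have FJ: "(\<lambda>z. (z, kf z)) ` F \<subseteq> ball 0 1 \<times> H" using F(2) kf_mem by auto
    have "(cmod (\<Sum>z\<in>F. \<Sum>j\<in>I. cnj (d z) * c j * G (z, kf z) (p j, h j)))\<^sup>2
      \<le> Re (qform F d (\<lambda>z w. G (z, kf z) (w, kf w))) * Re (qform I c (\<lambda>i j. G (p i, h i) (p j, h j)))"
      by (rule psd_Cauchy_Schwarz[OF psdG F(1) FJ I(1) J])
    moreover have "(\<Sum>z\<in>F. \<Sum>j\<in>I. cnj (d z) * c j * G (z, kf z) (p j, h j)) = L"
      unfolding L_def x_def sum_distrib_left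
      using F h by (intro sum.cong refl) (auto simp: G_def ip_kf subset_iff simp del: mem_ball mem_ball_0)
    moreover have "Re (qform I c (\<lambda>i j. G (p i, h i) (p j, h j))) = R" by (simp add: G_def R_def)
    \<comment> \<open>On the pairs (point, kernel function) the product kernel is
      \<open>K - 1\<close>, and dropping the 1 gives contraction constant 1.\<close>
    moreover have "qform F d (\<lambda>z w. G (z, kf z) (w, kf w)) = qform F d (\<lambda>z w. K z w - 1)"
    proof (rule qform_cong)
      fix z w assume zw: "z \<in> F" "w \<in> F"
      then have b: "z \<in> ball 0 1" "w \<in> ball 0 1" using F by auto
      then have "ip (kf w) (kf z) = K z w" by (simp only: ip_kf kf_mem kf_apply)
      then show "G (z, kf z) (w, kf w) = K z w - 1" using K_mult_Bk[OF b] by (simp add: G_def mult.commute)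
    qed
    moreover have "Re (qform F d (\<lambda>z w. K z w - 1)) \<le> Re (qform F d K)"
      using psd_qform[OF psd_one F, of d] by (simp add: qform_diff complex_nonneg_Reals_iff)
    ultimately have "(cmod L)\<^sup>2 \<le> R * Re (qform F d K)"
      using R by (smt (verit) mult.commute mult_left_mono)
    moreover have "qform F d (\<lambda>z w. of_real ((sqrt R)\<^sup>2) * K z w - x z * cnj (x w)) =
       of_real ((sqrt R)\<^sup>2) * of_real (Re (qform F d K)) - of_real ((cmod L)\<^sup>2)"
      unfolding qform_diff qform_scale qform_rank1 L_def[symmetric] complex_norm_square
      by (simp only: qform_real[OF psd_K F, symmetric])
    ultimately show "qform F d (\<lambda>z w. of_real ((sqrt R)\<^sup>2) * K z w - x z * cnj (x w)) \<in> \<real>\<^sub>\<ge>\<^sub>0"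
      using R by (simp only: of_real_mult[symmetric] of_real_diff[symmetric] nonneg_Reals_of_real_iff diff_ge_0_iff_ge real_sqrt_pow2)
  qed
  moreover have "x z = 0" if "z \<notin> ball 0 1" for z
    unfolding x_def using vanishes_off[OF h that] by (intro sum.neutral) simp
  moreover have "sqrt R \<ge> 0" using R by simp
  ultimately have "hn x \<le> sqrt R" "x \<in> H" using mem_if_psd by blast+
  then have "(hn x)\<^sup>2 \<le> (sqrt R)\<^sup>2" by (intro power_mono hn_nonneg)
  then show ?thesis using R by (simp add: x_def R_def)
qed

section \<open>The Sarason function and the damped functions\<close>

context
  fixes f assumes f: "f \<in> H"
begin

definition hf :: "complex ^ 'd \<Rightarrow> complex ^ 'd \<Rightarrow> complex" where
  "hf w = (\<lambda>x. kf w x * f x)"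

lemma hf_mem: "w \<in> ball 0 1 \<Longrightarrow> hf w \<in> H"
  unfolding hf_def by (rule mult_bound_mult(1)[OF mult_bound_kf f])

lemma Bk_mult_hf: "w \<in> ball 0 1 \<Longrightarrow> Bk x w * hf w x = hf w x - f x"
proof (cases "x \<in> ball 0 1")
  case True
  assume "w \<in> ball 0 1"
  from K_mult_Bk[OF True this] have "K x w * Bk x w * f x = (K x w - 1) * f x" by simp
  then show ?thesis using True by (simp add: hf_def kf_apply algebra_simps del: mem_ball mem_ball_0)
qed (use vanishes_off[OF f] in \<open>simp add: hf_def\<close>)

text \<open>The Sarason function of \<open>f\<close>; in the Hardy space its real part is the Poisson extension of
  \<open>\<bar>f\<bar>\<^sup>2\<close>.\<close>

definition V :: "complex ^ 'd \<Rightarrow> complex" where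
  "V z = 2 * ip f (hf z) - of_real ((hn f)\<^sup>2)"

lemma V_plus_cnj:
  assumes "z \<in> ball 0 1" "w \<in> ball 0 1"
  shows "V z + cnj (V w) = 2 * (ip (hf w) (hf z) - ip (\<lambda>x. hf w x - f x) (\<lambda>x. hf z x - f x))"
proof -
  note m = hf_mem[OF assms(1)] hf_mem[OF assms(2)]
  have "ip (\<lambda>x. hf w x - f x) (\<lambda>x. hf z x - f x) = ip (hf w) (hf z) - ip (hf w) f - ip f (hf z) + ip f f"
    using m f by (simp add: ip_diff ip_diff_right diff_mem)
  then show ?thesis
    unfolding V_def ip_self(2)[OF f, symmetric] using ip_cnj[OF f m(2)] ip_cnj[OF f f] by (simp add: ip_self(2)[OF f])
qed

text \<open>\<open>row_contraction\<close> for the vectors \<open>hf w\<close>: multiplication by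
  \<open>Bk _ w\<close> sends \<open>hf w\<close> to \<open>hf w - f\<close>.\<close>

lemma psd_V_aux:
  "psd_kernel (ball 0 1) (\<lambda>z w. Bk z w * ip (hf w) (hf z) - ip (\<lambda>x. hf w x - f x) (\<lambda>x. hf z x - f x))"
proof (rule psd_kernelI)
  fix F c assume F: "finite F" "F \<subseteq> ball (0 :: complex ^ 'd) 1"
  have m: "hf w \<in> H" if "w \<in> F" for w using F that by (auto intro: hf_mem)
  define g where "g w = (\<lambda>x. hf w x - f x)" for w
  have gm: "g w \<in> H" if "w \<in> F" for w unfolding g_def using m[OF that] f by (intro diff_mem)
  have "(\<lambda>x. \<Sum>w\<in>F. c w * (Bk x w * hf w x)) = (\<lambda>x. \<Sum>w\<in>F. c w * g w x)"
    using F Bk_mult_hf by (intro ext sum.cong refl) (auto simp: g_def simp del: mem_ball mem_ball_0)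
  moreover define R where "R = Re (qform F c (\<lambda>z w. Bk z w * ip (hf w) (hf z)))"
  ultimately have le: "(hn (\<lambda>x. \<Sum>w\<in>F. c w * g w x))\<^sup>2 \<le> R"
    using row_contraction[OF F(1), of "\<lambda>x. x" hf c] F m by simp
  have R: "qform F c (\<lambda>z w. Bk z w * ip (hf w) (hf z)) = of_real R" unfolding R_def
  proof (rule qform_real[OF _ F])
    show "psd_kernel (ball 0 1) (\<lambda>z w. Bk z w * ip (hf w) (hf z))"
      by (intro psd_mult psd_Bk psd_pullback[OF psd_gram]) (auto intro: hf_mem)
  qed
  have gram: "qform F c (\<lambda>z w. ip (g w) (g z)) = of_real ((hn (\<lambda>x. \<Sum>w\<in>F. c w * g w x))\<^sup>2)"
    by (rule qform_gram[OF F(1)]) (rule gm)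
  show "qform F c (\<lambda>z w. Bk z w * ip (hf w) (hf z) - ip (\<lambda>x. hf w x - f x) (\<lambda>x. hf z x - f x)) \<in> \<real>\<^sub>\<ge>\<^sub>0"
    unfolding qform_diff g_def[symmetric] gram R of_real_diff[symmetric] nonneg_Reals_of_real_iff
    using le by simp
qed

text \<open>Replacing \<open>K\<close> by \<open>K * Bk + 1\<close> in front of the Gram kernel of
  the \<open>hf\<close> splits off one copy of that Gram kernel and leaves the psd kernel of
  \<open>psd_V_aux\<close>.\<close>

lemma K_V_eq:
  assumes zw: "z \<in> ball 0 1" "w \<in> ball 0 1"
  shows "K z w * (V z + cnj (V w)) = 2 * (K z w * (Bk z w * ip (hf w) (hf z) - ip (\<lambda>x. hf w x - f x) (\<lambda>x. hf z x - f x)) + ip (hf w) (hf z))"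
proof -
  have "K z w * (Bk z w * ip (hf w) (hf z)) = (K z w - 1) * ip (hf w) (hf z)"
    using K_mult_Bk[OF zw] by (simp add: mult.assoc[symmetric])
  then show ?thesis unfolding V_plus_cnj[OF zw] by (simp add: algebra_simps)
qed

lemma psd_V: "psd_kernel (ball 0 1) (\<lambda>z w. K z w * (V z + cnj (V w)))"
proof (rule psd_cong_imp)
  show "psd_kernel (ball 0 1) (\<lambda>z w. of_real 2 * (K z w * (Bk z w * ip (hf w) (hf z) - ip (\<lambda>x. hf w x - f x) (\<lambda>x. hf z x - f x)) + ip (hf w) (hf z)))"
    by (intro psd_scale psd_add psd_mult psd_K psd_V_aux psd_pullback[OF psd_gram]) (auto intro: hf_mem)
qed (simp add: K_V_eq del: mem_ball mem_ball_0)

text \<open>On the diagonal, with \<open>k = K z z\<close>, \<open>K_V_eq\<close> gives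
  \<open>k * Re (V z) \<ge> (hn (hf z))\<^sup>2\<close>. As \<open>hf z\<close> has the value
  \<open>k * f z\<close> at \<open>z\<close>, evaluation there gives
  \<open>(hn (hf z))\<^sup>2 \<ge> k * (cmod (f z))\<^sup>2\<close>.\<close>

lemma Re_V_ge:
  assumes z: "z \<in> ball 0 1"
  shows "(cmod (f z))\<^sup>2 \<le> Re (V z)"
proof -
  obtain k where k: "K z z = complex_of_real k" "k \<ge> 1" using K_self[of z] z by auto
  have "(cmod (ip (hf z) (kf z)))\<^sup>2 \<le> (hn (hf z) * hn (kf z))\<^sup>2"
    using ip_Cauchy_Schwarz[OF hf_mem[OF z] kf_mem[OF z]] by (intro power_mono) auto
  moreover have "ip (hf z) (kf z) = of_real k * f z"
    by (simp only: ip_kf[OF hf_mem[OF z] z]) (simp only: hf_def kf_apply[OF z] k)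
  ultimately have "k\<^sup>2 * (cmod (f z))\<^sup>2 \<le> (hn (hf z))\<^sup>2 * k"
    using hn_kf_sq[OF z] k by (simp add: norm_mult power_mult_distrib)
  then have "k * (k * (cmod (f z))\<^sup>2) \<le> k * (hn (hf z))\<^sup>2"
    by (simp only: power2_eq_square[of k] mult_ac)
  then have 1: "k * (cmod (f z))\<^sup>2 \<le> (hn (hf z))\<^sup>2"
    by (rule mult_left_le_imp_le) (use k(2) in simp)
  have "0 \<le> Re (K z z * (Bk z z * ip (hf z) (hf z) - ip (\<lambda>x. hf z x - f x) (\<lambda>x. hf z x - f x)))"
  proof -
    have "0 \<le> Re (complex_of_real k * y)" if "y \<in> \<real>\<^sub>\<ge>\<^sub>0" for y
      using that k(2) by (simp add: complex_nonneg_Reals_iff)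
    from this[OF psd_diag[OF psd_V_aux z]] show ?thesis unfolding k(1) .
  qed
  then have "2 * (hn (hf z))\<^sup>2 \<le> Re (K z z * (V z + cnj (V z)))"
    unfolding K_V_eq[OF z z] using ip_self(1)[OF hf_mem[OF z]] by simp
  also have "\<dots> = 2 * (k * Re (V z))" unfolding k by simp
  finally have "k * (cmod (f z))\<^sup>2 \<le> k * Re (V z)" using 1 by simp
  then show ?thesis using k(2) by simp
qed

definition damp :: "real \<Rightarrow> complex ^ 'd \<Rightarrow> complex" where
  "damp \<epsilon> z = (if z \<in> ball 0 1 then 1 / (1 + of_real \<epsilon> * V z) else 0)"

lemma norm_one_plus_V:
  assumes "z \<in> ball 0 1" "\<epsilon> \<ge> 0"
  shows "1 + \<epsilon> * (cmod (f z))\<^sup>2 \<le> cmod (1 + of_real \<epsilon> * V z)"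
proof -
  have "1 + \<epsilon> * (cmod (f z))\<^sup>2 \<le> Re (1 + of_real \<epsilon> * V z)"
    using Re_V_ge[OF assms(1)] assms(2) by (simp add: mult_left_mono)
  then show ?thesis using complex_Re_le_cmod order_trans by blast
qed

lemma norm_damp_le:
  assumes "z \<in> ball 0 1" "\<epsilon> \<ge> 0"
  shows "cmod (damp \<epsilon> z) \<le> 1 / (1 + \<epsilon> * (cmod (f z))\<^sup>2)"
  using norm_one_plus_V[OF assms] assms
  by (auto simp: damp_def norm_divide intro!: frac_le add_pos_nonneg)

lemma psd_K_minus_1: "psd_kernel (ball 0 1) (\<lambda>z w. K z w - 1)"
  using psd_of_mem[OF kf_mem, of 0]
  by (rule psd_cong_imp) (auto simp: hn_kf_0 kf_apply K_zero)

text \<open>By \<open>mem_if_psd\<close> with constant 1: for \<open>p = 1 + \<epsilon> V(z)\<close>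
  and \<open>q = 1 + \<epsilon> V(w)\<close>, the kernel \<open>K - 1 / (p * cnj q)\<close> is
  congruent to \<open>K * p * cnj q - 1\<close>. The latter expands into \<open>K - 1\<close>, an
  accretivity term and a rank-one multiple of \<open>K\<close>.\<close>

lemma damp_mem:
  assumes \<epsilon>: "\<epsilon> \<ge> 0"
  shows "damp \<epsilon> \<in> H" "hn (damp \<epsilon>) \<le> 1"
proof -
  have "psd_kernel (ball 0 1) (\<lambda>z w. damp \<epsilon> z * cnj (damp \<epsilon> w) *
     ((K z w - 1) + of_real \<epsilon> * (K z w * (V z + cnj (V w))) + (of_real \<epsilon> * V z) * cnj (of_real \<epsilon> * V w) * K z w))"
    by (intro psd_congruence psd_add psd_scale psd_V psd_K psd_K_minus_1 \<epsilon>)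
  then have "psd_kernel (ball 0 1) (\<lambda>z w. of_real (1\<^sup>2) * K z w - damp \<epsilon> z * cnj (damp \<epsilon> w))"
  proof (rule psd_cong_imp)
    fix z w :: "complex ^ 'd" assume zw: "z \<in> ball 0 1" "w \<in> ball 0 1"
    define p q where "p = 1 + of_real \<epsilon> * V z" and "q = 1 + of_real \<epsilon> * V w"
    have pq: "p \<noteq> 0" "q \<noteq> 0"
      using norm_one_plus_V[OF zw(1) \<epsilon>] norm_one_plus_V[OF zw(2) \<epsilon>] \<epsilon> add_pos_nonneg[of 1 "\<epsilon> * (cmod (f z))\<^sup>2"] add_pos_nonneg[of 1 "\<epsilon> * (cmod (f w))\<^sup>2"]
      by (auto simp: p_def q_def)
    have "damp \<epsilon> z = 1 / p" "damp \<epsilon> w = 1 / q"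
      using zw by (auto simp: damp_def p_def q_def)
    moreover have "p * (1 / p) = 1" using pq by simp
    moreover have "cnj q * cnj (1 / q) = 1"
      unfolding complex_cnj_mult[symmetric] using pq by simp
    moreover have "(K z w - 1) + of_real \<epsilon> * (K z w * (V z + cnj (V w))) + (of_real \<epsilon> * V z) * cnj (of_real \<epsilon> * V w) * K z w
       = K z w * (p * cnj q) - 1"
      by (simp add: p_def q_def algebra_simps)
    moreover have "k - x * y = x * y * (k * (p * r) - 1)" if "p * x = 1" "r * y = 1" for k x y p r :: complex
      using that by algebra
    ultimately show "of_real (1\<^sup>2) * K z w - damp \<epsilon> z * cnj (damp \<epsilon> w) = damp \<epsilon> z * cnj (damp \<epsilon> w) *
     ((K z w - 1) + of_real \<epsilon> * (K z w * (V z + cnj (V w))) + (of_real \<epsilon> * V z) * cnj (of_real \<epsilon> * V w) * K z w)"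
      by (simp only: power_one of_real_1 mult_1_left)
  qed
  note psd = this
  have off: "damp \<epsilon> z = 0" if "z \<notin> ball 0 1" for z using that by (simp add: damp_def)
  from mem_if_psd[OF psd zero_le_one off] show "damp \<epsilon> \<in> H" "hn (damp \<epsilon>) \<le> 1" by blast+
qed

end

end

lemma approach_1:
  assumes "r < (1::real)"
  shows "\<exists>s. (\<forall>n. r \<le> s n \<and> s n < 1) \<and> filterlim s (at_left 1) sequentially"
proof (intro exI conjI allI)
  define s where "s n = 1 - (1 - r) * (1 / real (Suc n))" for n
  show "r \<le> s n" "s n < 1" for n
  proof -
    have "(1 - r) * (1 / real (Suc n)) \<le> (1 - r) * 1" using assms by (intro mult_left_mono) auto
    moreover have "(1 - r) * (1 / real (Suc n)) > 0" using assms by simp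
    moreover have "r \<le> 1 - X \<and> 1 - X < 1" if "X \<le> (1 - r) * 1" "X > 0" for X
      using that by simp
    ultimately show "r \<le> s n" "s n < 1" unfolding s_def by blast+
  qed
  note s1 = \<open>\<And>n. s n < 1\<close>
  have "(\<lambda>n. 1 - (1 - r) * (1 / real (Suc n))) \<longlonglongrightarrow> 1 - (1 - r) * 0"
    using LIMSEQ_inverse_real_of_nat by (intro tendsto_intros) (simp_all add: inverse_eq_divide)
  then show "filterlim s (at_left 1) sequentially"
    using s1 by (auto simp: filterlim_at s_def[abs_def] intro!: always_eventually simp: less_imp_neq)
qed

section \<open>Consequences of finite energy\<close>

context cnp_sphere_measure
begin

lemma integral_dilate_tendsto:
  assumes s: "\<And>n. 0 \<le> s n \<and> s n < 1" and g: "g \<in> H" "\<And>z. z \<in> ball 0 1 \<Longrightarrow> cmod (g z) \<le> C"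
    and u: "u \<in> borel_measurable \<mu>" and lim: "AE z in \<mu>. (\<lambda>n. g (s n *\<^sub>R z)) \<longlonglongrightarrow> u z"
  shows "(\<lambda>n. \<integral>z. g (s n *\<^sub>R z) \<partial>\<mu>) \<longlonglongrightarrow> (\<integral>z. u z \<partial>\<mu>)"
proof (rule integral_dominated_convergence[where w = "\<lambda>_. C"])
  show "(\<lambda>z. g (s n *\<^sub>R z)) \<in> borel_measurable \<mu>" for n
    using s[of n] by (intro measurable_\<mu> continuous_on_dilate g) auto
  show "AE z in \<mu>. cmod (g (s n *\<^sub>R z)) \<le> C" for n
    using s[of n] by (intro AE_I2 g(2) scaleR_in_ball) (auto simp: space_\<mu>)
qed (use u lim in auto)

lemma unbounded_imp_infinite_energy:
  assumes E: "compact E" and null: "emeasure \<mu> (sphere 0 1 - E) = 0" and unb: "unboundedness_set H E"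
  shows "energy a \<mu> = \<infinity>"
proof (rule ccontr)
  assume "energy a \<mu> \<noteq> \<infinity>"
  then have "energy a \<mu> < \<infinity>" by (simp add: top.not_eq_extremum)
  \<comment> \<open>Any tolerance below 1 serves, since the two limits to be compared are 0 and
    1.\<close>
  from finite_energy_uniform[OF this, of "1/8"]
  obtain r where r: "0 \<le> r" "r < 1"
    and unif: "\<And>s g. r \<le> s \<Longrightarrow> s < 1 \<Longrightarrow> g \<in> H \<Longrightarrow>
      cmod ((\<integral>z. g (s *\<^sub>R z) \<partial>\<mu>) - (\<integral>z. g (r *\<^sub>R z) \<partial>\<mu>)) \<le> 1/8 * hn g" by auto
  obtain f where f: "f \<in> H" "\<And>\<zeta>. \<zeta> \<in> E \<Longrightarrow> filterlim (\<lambda>r. cmod (f (r *\<^sub>R \<zeta>))) at_top (at_left 1)"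
    using unb by (auto simp: unboundedness_set_def)
  obtain s where s: "\<And>n. r \<le> s n \<and> s n < 1" "filterlim s (at_left 1) sequentially"
    using approach_1[OF r(2)] by blast
  have s': "0 \<le> s n \<and> s n < 1" for n using s(1)[of n] r by auto
  have AE_E: "AE z in \<mu>. z \<in> E"
  proof (rule AE_I'[of "sphere 0 1 - E"])
    have "E \<in> sets borel" using E by (intro borel_closed compact_imp_closed)
    then have "sphere 0 1 - E \<in> sets \<mu>" unfolding sets_\<mu> by (auto simp: sets_restrict_space_iff)
    then show "sphere 0 1 - E \<in> null_sets \<mu>" using null by auto
  qed (auto simp: space_\<mu>)
  have cb: "cmod (damp f \<epsilon> z) \<le> 1" if "z \<in> ball 0 1" "\<epsilon> \<ge> 0" for z \<epsilon>
  proof -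
    have "1 / (1 + \<epsilon> * (cmod (f z))\<^sup>2) \<le> 1" using that by (simp add: divide_le_eq_1 add_pos_nonneg)
    then show ?thesis using norm_damp_le[OF f(1) that] by linarith
  qed
  \<comment> \<open>The radius \<open>r\<close> is the same for every \<open>\<epsilon>\<close>,
    because all damped functions lie in the unit ball; so \<open>\<epsilon>\<close> may tend to 0
    afterwards at this fixed radius.\<close>
  have small: "cmod (\<integral>z. damp f \<epsilon> (r *\<^sub>R z) \<partial>\<mu>) \<le> 1/8" if \<epsilon>: "\<epsilon> > 0" for \<epsilon>
  proof -
    have c: "damp f \<epsilon> \<in> H" "hn (damp f \<epsilon>) \<le> 1" using damp_mem[OF f(1), of \<epsilon>] \<epsilon> by auto
    have "(\<lambda>n. \<integral>z. damp f \<epsilon> (s n *\<^sub>R z) \<partial>\<mu>) \<longlonglongrightarrow> (\<integral>z. 0 \<partial>\<mu>)"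
    proof (rule integral_dilate_tendsto[OF s' c(1)])
      show "cmod (damp f \<epsilon> z) \<le> 1" if "z \<in> ball 0 1" for z using cb[OF that] \<epsilon> by simp
      show "AE z in \<mu>. (\<lambda>n. damp f \<epsilon> (s n *\<^sub>R z)) \<longlonglongrightarrow> 0"
        using AE_E AE_space
      proof eventually_elim
        case (elim z)
        have b: "s n *\<^sub>R z \<in> ball 0 1" for n using elim(2) s'[of n] by (intro scaleR_in_ball) (auto simp: space_\<mu>)
        have "filterlim (\<lambda>n. cmod (f (s n *\<^sub>R z))) at_top sequentially"
          by (rule filterlim_compose[OF f(2)[OF elim(1)] s(2)])
        then have "filterlim (\<lambda>n. (cmod (f (s n *\<^sub>R z)))\<^sup>2) at_top sequentially"
          by (intro filterlim_pow_at_top) auto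
        then have "filterlim (\<lambda>n. 1 + \<epsilon> * (cmod (f (s n *\<^sub>R z)))\<^sup>2) at_top sequentially"
          using \<epsilon> by (intro filterlim_tendsto_add_at_top[OF tendsto_const] filterlim_tendsto_pos_mult_at_top[OF tendsto_const])
        then have "(\<lambda>n. 1 / (1 + \<epsilon> * (cmod (f (s n *\<^sub>R z)))\<^sup>2)) \<longlonglongrightarrow> 0"
          by (intro tendsto_divide_0[OF tendsto_const] filterlim_at_top_imp_at_infinity)
        then show ?case
          by (rule Lim_null_comparison[rotated]) (use norm_damp_le[OF f(1) b] \<epsilon> in auto)
      qed
    qed simp
    then have "(\<lambda>n. cmod ((\<integral>z. damp f \<epsilon> (s n *\<^sub>R z) \<partial>\<mu>) - (\<integral>z. damp f \<epsilon> (r *\<^sub>R z) \<partial>\<mu>))) \<longlonglongrightarrow> cmod (0 - (\<integral>z. damp f \<epsilon> (r *\<^sub>R z) \<partial>\<mu>))"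
      by (intro tendsto_norm tendsto_diff tendsto_const) simp
    moreover have "cmod ((\<integral>z. damp f \<epsilon> (s n *\<^sub>R z) \<partial>\<mu>) - (\<integral>z. damp f \<epsilon> (r *\<^sub>R z) \<partial>\<mu>)) \<le> 1/8" for n
      using unif[of "s n", OF _ _ c(1)] s(1)[of n] c(2) by fastforce
    ultimately have "cmod (0 - (\<integral>z. damp f \<epsilon> (r *\<^sub>R z) \<partial>\<mu>)) \<le> 1/8"
      by (intro LIMSEQ_le_const2) auto
    then show ?thesis by simp
  qed
  have "(\<lambda>n. \<integral>z. damp f (1 / real (Suc n)) (r *\<^sub>R z) \<partial>\<mu>) \<longlonglongrightarrow> (\<integral>z. 1 \<partial>\<mu>)"
  proof (rule integral_dominated_convergence[where w = "\<lambda>_. 1"])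
    show "(\<lambda>z. damp f (1 / real (Suc n)) (r *\<^sub>R z)) \<in> borel_measurable \<mu>" for n
      using r damp_mem[OF f(1), of "1 / real (Suc n)"] by (intro measurable_\<mu> continuous_on_dilate) auto
    show "AE z in \<mu>. cmod (damp f (1 / real (Suc n)) (r *\<^sub>R z)) \<le> 1" for n
      using r by (intro AE_I2 cb scaleR_in_ball) (auto simp: space_\<mu>)
    show "AE z in \<mu>. (\<lambda>n. damp f (1 / real (Suc n)) (r *\<^sub>R z)) \<longlonglongrightarrow> 1"
    proof (rule AE_I2)
      fix z assume "z \<in> space \<mu>"
      then have b: "r *\<^sub>R z \<in> ball 0 1" using r by (intro scaleR_in_ball) (auto simp: space_\<mu>)
      have "(\<lambda>n. 1 / (1 + complex_of_real (1 / real (Suc n)) * V f (r *\<^sub>R z))) \<longlonglongrightarrow> 1 / (1 + complex_of_real 0 * V f (r *\<^sub>R z))"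
        using LIMSEQ_inverse_real_of_nat by (intro tendsto_intros tendsto_of_real) (simp_all add: inverse_eq_divide)
      then show "(\<lambda>n. damp f (1 / real (Suc n)) (r *\<^sub>R z)) \<longlonglongrightarrow> 1"
        using b by (simp add: damp_def[OF f(1)] del: mem_ball mem_ball_0)
    qed
  qed auto
  then have "(\<lambda>n. cmod (\<integral>z. damp f (1 / real (Suc n)) (r *\<^sub>R z) \<partial>\<mu>)) \<longlonglongrightarrow> cmod 1"
    by (intro tendsto_norm) (simp add: prob_space)
  then have "cmod 1 \<le> 1/8"
    by (rule LIMSEQ_le_const2) (use small in \<open>auto simp del: of_nat_Suc\<close>)
  then show False by simp
qed

text \<open>By \<open>finite_energy_uniform\<close> the integrals over the sphere are replaced, with
  a uniform error, by integrals over a sphere of fixed radius \<open>r < 1\<close>. There pointwise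
  convergence and a uniform bound suffice.\<close>

lemma finite_energy_imp_henkin:
  assumes fin: "energy a \<mu> < \<infinity>"
  shows "henkin_measure H ip (\<lambda>A. of_real (measure \<mu> A))"
  unfolding henkin_measure_def
proof (intro conjI allI impI)
  have fm: "finite_measure \<mu>" by unfold_locales
  show "complex_measure borel_sphere (\<lambda>A. complex_of_real (measure \<mu> A))"
    by (rule complex_measure_of_finite_measure(1)[OF fm sets_\<mu>])
  fix p :: "nat \<Rightarrow> complex ^ 'd \<Rightarrow> complex"
  assume poly: "\<forall>n. polynomial_fun (p n)" and sup: "(SUP n. mult_norm H ip (p n)) < \<infinity>"
    and lim: "\<forall>z\<in>ball 0 1. (\<lambda>n. p n z) \<longlonglongrightarrow> 0"
  define C where "C = enn2real (SUP n. mult_norm H ip (p n))"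
  have C: "mult_norm H ip (p n) \<le> ennreal C" for n
  proof -
    have "mult_norm H ip (p n) \<le> (SUP n. mult_norm H ip (p n))" by (intro SUP_upper) auto
    also have "\<dots> = ennreal C" unfolding C_def using sup by simp
    finally show ?thesis .
  qed
  have C0: "C \<ge> 0" by (simp add: C_def)
  \<comment> \<open>\<open>kf 0\<close> is the constant 1 on the ball, with norm 1. The product cuts
    the polynomial off outside the ball, and its norm in \<open>H\<close> is at most the multiplier
    norm.\<close>
  define q where "q n = (\<lambda>z. p n z * kf 0 z)" for n
  have pm: "p n \<in> multipliers H" for n
    using C[of n] by (auto simp: mult_norm_def top_unique split: if_splits)
  have k0: "kf 0 \<in> H" by (intro kf_mem) simp
  have q: "q n \<in> H" "hn (q n) \<le> C" for n
  proof -
    show qm: "q n \<in> H" using pm[of n] k0 by (simp add: multipliers_def q_def)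
    have "ennreal (hn (q n)) \<le> mult_norm H ip (p n)"
      using pm[of n] k0 hn_kf_0 by (auto simp: mult_norm_def q_def intro!: SUP_upper)
    then have "ennreal (hn (q n)) \<le> ennreal C" using C order_trans by blast
    then show "hn (q n) \<le> C" using C0 by (simp add: ennreal_le_iff)
  qed
  have qp: "q n z = p n z" if "z \<in> ball 0 1" for n z
    using that by (simp add: q_def kf_apply K_zero del: mem_ball mem_ball_0)
  have pint: "(\<integral>z. p n z \<partial>\<mu>) = complex_measure_integral borel_sphere (\<lambda>A. of_real (measure \<mu> A)) (p n)" for n
    by (rule complex_measure_of_finite_measure(2)[OF fm sets_\<mu>, symmetric])
  have "(\<lambda>n. \<integral>z. p n z \<partial>\<mu>) \<longlonglongrightarrow> 0"
  proof (rule LIMSEQ_I)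
    fix e :: real assume e: "e > 0"
    define e' where "e' = e / (2 * (C + 1))"
    have e': "e' > 0" using e C0 by (simp add: e'_def)
    obtain r where r: "0 \<le> r" "r < 1"
      and unif: "\<And>s g. r \<le> s \<Longrightarrow> s < 1 \<Longrightarrow> g \<in> H \<Longrightarrow>
        cmod ((\<integral>z. g (s *\<^sub>R z) \<partial>\<mu>) - (\<integral>z. g (r *\<^sub>R z) \<partial>\<mu>)) \<le> e' * hn g"
      using finite_energy_uniform[OF fin e'] by blast
    obtain s where s: "\<And>n. r \<le> s n \<and> s n < 1" "filterlim s (at_left 1) sequentially"
      using approach_1[OF r(2)] by blast
    have s': "0 \<le> s n \<and> s n < 1" for n using s(1)[of n] r by auto
    have slim: "s \<longlonglongrightarrow> 1" using s(2) by (simp add: filterlim_at)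
    have near: "cmod ((\<integral>z. p n z \<partial>\<mu>) - (\<integral>z. q n (r *\<^sub>R z) \<partial>\<mu>)) \<le> e' * C" for n
    proof -
      obtain B where B: "\<And>z. z \<in> cball 0 1 \<Longrightarrow> cmod (p n z) \<le> B"
        using compact_imp_bounded[OF compact_continuous_image[OF continuous_on_polynomial_fun compact_cball]] poly
        by (metis (no_types, lifting) bounded_iff imageI)
      have "(\<lambda>m. \<integral>z. q n (s m *\<^sub>R z) \<partial>\<mu>) \<longlonglongrightarrow> (\<integral>z. p n z \<partial>\<mu>)"
      proof (rule integral_dilate_tendsto[OF s' q(1)])
        show "cmod (q n z) \<le> B" if "z \<in> ball 0 1" for z using B[of z] that qp[OF that] by auto
        show "p n \<in> borel_measurable \<mu>" using poly by (intro measurable_\<mu> continuous_on_polynomial_fun) auto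
        show "AE z in \<mu>. (\<lambda>m. q n (s m *\<^sub>R z)) \<longlonglongrightarrow> p n z"
        proof (rule AE_I2)
          fix z assume z: "z \<in> space \<mu>"
          have "q n (s m *\<^sub>R z) = p n (s m *\<^sub>R z)" for m
            using z s'[of m] by (intro qp scaleR_in_ball) (auto simp: space_\<mu>)
          moreover have "isCont (p n) z"
            using continuous_on_polynomial_fun[of "p n" UNIV] poly by (simp add: continuous_on_eq_continuous_at)
          moreover have "(\<lambda>m. s m *\<^sub>R z) \<longlonglongrightarrow> 1 *\<^sub>R z" by (intro tendsto_intros slim)
          ultimately show "(\<lambda>m. q n (s m *\<^sub>R z)) \<longlonglongrightarrow> p n z"
            using isCont_tendsto_compose[of z "p n" "\<lambda>m. s m *\<^sub>R z"] by simp
        qed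
      qed
      then have "(\<lambda>m. cmod ((\<integral>z. q n (s m *\<^sub>R z) \<partial>\<mu>) - (\<integral>z. q n (r *\<^sub>R z) \<partial>\<mu>))) \<longlonglongrightarrow>
          cmod ((\<integral>z. p n z \<partial>\<mu>) - (\<integral>z. q n (r *\<^sub>R z) \<partial>\<mu>))"
        by (intro tendsto_intros)
      moreover have "cmod ((\<integral>z. q n (s m *\<^sub>R z) \<partial>\<mu>) - (\<integral>z. q n (r *\<^sub>R z) \<partial>\<mu>)) \<le> e' * C" for m
        using unif[of "s m", OF _ _ q(1)] s(1)[of m] mult_left_mono[OF q(2), of e'] e' by (meson less_imp_le order_trans)
      ultimately show ?thesis by (intro LIMSEQ_le_const2) auto
    qed
    have r2: "0 \<le> r\<^sup>2" "r\<^sup>2 < 1" using r by (auto simp: abs_square_less_1)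
    have "(\<lambda>n. \<integral>z. q n (r *\<^sub>R z) \<partial>\<mu>) \<longlonglongrightarrow> (\<integral>z. 0 \<partial>\<mu>)"
    proof (rule integral_dominated_convergence[where w = "\<lambda>_. C * sqrt (Re (\<kappa> (of_real (r\<^sup>2))))"])
      show "(\<lambda>z. q n (r *\<^sub>R z)) \<in> borel_measurable \<mu>" for n
        using r q by (intro measurable_\<mu> continuous_on_dilate) auto
      show "AE z in \<mu>. (\<lambda>n. q n (r *\<^sub>R z)) \<longlonglongrightarrow> 0"
      proof (rule AE_I2)
        fix z assume "z \<in> space \<mu>"
        then have b: "r *\<^sub>R z \<in> ball 0 1" using r by (intro scaleR_in_ball) (auto simp: space_\<mu>)
        show "(\<lambda>n. q n (r *\<^sub>R z)) \<longlonglongrightarrow> 0" unfolding qp[OF b] using lim b by blast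
      qed
      show "AE z in \<mu>. cmod (q n (r *\<^sub>R z)) \<le> C * sqrt (Re (\<kappa> (of_real (r\<^sup>2))))" for n
      proof (rule AE_I2)
        fix z assume z: "z \<in> space \<mu>"
        then have b: "r *\<^sub>R z \<in> ball 0 1" using r by (intro scaleR_in_ball) (auto simp: space_\<mu>)
        have "(hn (kf (r *\<^sub>R z)))\<^sup>2 = Re (\<kappa> (of_real (r\<^sup>2)))"
          using hn_kf_sq[OF b] z by (simp add: K_scaleR cinner_prod_self power2_eq_square space_\<mu>)
        then have "hn (kf (r *\<^sub>R z)) = sqrt (Re (\<kappa> (of_real (r\<^sup>2))))"
          using hn_nonneg[OF kf_mem[OF b]] by (metis real_sqrt_unique)
        moreover have "hn (q n) * hn (kf (r *\<^sub>R z)) \<le> C * hn (kf (r *\<^sub>R z))"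
          using q(2) hn_nonneg[OF kf_mem[OF b]] by (intro mult_right_mono)
        ultimately show "cmod (q n (r *\<^sub>R z)) \<le> C * sqrt (Re (\<kappa> (of_real (r\<^sup>2))))"
          using order_trans[OF eval_bound[OF q(1) b, of n]] by simp
      qed
    qed auto
    then have "(\<lambda>n. \<integral>z. q n (r *\<^sub>R z) \<partial>\<mu>) \<longlonglongrightarrow> 0" by simp
    then obtain N where N: "\<And>n. n \<ge> N \<Longrightarrow> cmod (\<integral>z. q n (r *\<^sub>R z) \<partial>\<mu>) < e / 2"
      using LIMSEQ_D[of _ 0 "e/2"] e by fastforce
    have "cmod ((\<integral>z. p n z \<partial>\<mu>) - 0) < e" if "n \<ge> N" for n
    proof -
      have "e' * C \<le> e / 2" using C0 e by (simp add: e'_def field_simps)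
      moreover have "cmod (\<integral>z. p n z \<partial>\<mu>) \<le> cmod ((\<integral>z. p n z \<partial>\<mu>) - (\<integral>z. q n (r *\<^sub>R z) \<partial>\<mu>)) + cmod (\<integral>z. q n (r *\<^sub>R z) \<partial>\<mu>)"
        using norm_triangle_ineq[of "(\<integral>z. p n z \<partial>\<mu>) - (\<integral>z. q n (r *\<^sub>R z) \<partial>\<mu>)" "\<integral>z. q n (r *\<^sub>R z) \<partial>\<mu>"] by simp
      ultimately show ?thesis using near[of n] N[OF that] by simp
    qed
    then show "\<exists>N. \<forall>n\<ge>N. cmod ((\<integral>z. p n z \<partial>\<mu>) - 0) < e" by blast
  qed
  then show "(\<lambda>n. complex_measure_integral borel_sphere (\<lambda>A. of_real (measure \<mu> A)) (p n)) \<longlonglongrightarrow> 0"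
    unfolding pint .
qed

end

section \<open>Polynomial approximation in multiplier norm\<close>

definition multi_monom :: "('d \<Rightarrow> nat) \<Rightarrow> complex ^ 'd::finite \<Rightarrow> complex" where
  "multi_monom \<alpha> z = (\<Prod>i\<in>UNIV. z $ i ^ \<alpha> i)"

lemma polynomial_fun_iff:
  "polynomial_fun p \<longleftrightarrow> (\<exists>S c. finite S \<and> p = (\<lambda>z. \<Sum>\<alpha>\<in>S. c \<alpha> * multi_monom \<alpha> z))"
  by (simp add: polynomial_fun_def multi_monom_def)

lemma polynomial_fun_multi_monom: "polynomial_fun (\<lambda>z. c * multi_monom \<alpha> z)"
  unfolding polynomial_fun_iff by (intro exI[of _ "{\<alpha>}"] exI[of _ "\<lambda>_. c"]) simp

lemma polynomial_fun_add:
  assumes "polynomial_fun p" "polynomial_fun q"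
  shows "polynomial_fun (\<lambda>z. p z + q z)"
proof -
  obtain S c where p: "finite S" "p = (\<lambda>z. \<Sum>\<alpha>\<in>S. c \<alpha> * multi_monom \<alpha> z)"
    using assms(1) by (auto simp: polynomial_fun_iff)
  obtain T d where q: "finite T" "q = (\<lambda>z. \<Sum>\<alpha>\<in>T. d \<alpha> * multi_monom \<alpha> z)"
    using assms(2) by (auto simp: polynomial_fun_iff)
  define e where "e \<alpha> = (if \<alpha> \<in> S then c \<alpha> else 0) + (if \<alpha> \<in> T then d \<alpha> else 0)" for \<alpha>
  have "p z + q z = (\<Sum>\<alpha>\<in>S \<union> T. e \<alpha> * multi_monom \<alpha> z)" for z
  proof -
    have "p z = (\<Sum>\<alpha>\<in>S \<union> T. (if \<alpha> \<in> S then c \<alpha> else 0) * multi_monom \<alpha> z)"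
      unfolding p(2) using p q by (intro sum.mono_neutral_cong_left) auto
    moreover have "q z = (\<Sum>\<alpha>\<in>S \<union> T. (if \<alpha> \<in> T then d \<alpha> else 0) * multi_monom \<alpha> z)"
      unfolding q(2) using p q by (intro sum.mono_neutral_cong_left) auto
    ultimately show ?thesis by (simp add: e_def sum.distrib distrib_right)
  qed
  then show ?thesis unfolding polynomial_fun_iff using p q by blast
qed

lemma polynomial_fun_const: "polynomial_fun (\<lambda>z. c)"
  using polynomial_fun_multi_monom[of c "\<lambda>_. 0"] by (simp add: multi_monom_def)

lemma polynomial_fun_sum:
  "(\<And>i. i \<in> I \<Longrightarrow> polynomial_fun (p i)) \<Longrightarrow> polynomial_fun (\<lambda>z. \<Sum>i\<in>I. p i z)"
  by (induction I rule: infinite_finite_induct) (auto simp: polynomial_fun_const intro: polynomial_fun_add)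

lemma polynomial_fun_mult:
  assumes "polynomial_fun p" "polynomial_fun q"
  shows "polynomial_fun (\<lambda>z. p z * q z)"
proof -
  obtain S c where p: "finite S" "p = (\<lambda>z. \<Sum>\<alpha>\<in>S. c \<alpha> * multi_monom \<alpha> z)"
    using assms(1) by (auto simp: polynomial_fun_iff)
  obtain T d where q: "finite T" "q = (\<lambda>z. \<Sum>\<alpha>\<in>T. d \<alpha> * multi_monom \<alpha> z)"
    using assms(2) by (auto simp: polynomial_fun_iff)
  have "multi_monom \<alpha> z * multi_monom \<beta> z = multi_monom (\<lambda>i. \<alpha> i + \<beta> i) z" for \<alpha> \<beta> and z :: "complex ^ 'a"
    by (simp add: multi_monom_def power_add prod.distrib)
  then have "p z * q z = (\<Sum>\<alpha>\<in>S. \<Sum>\<beta>\<in>T. (c \<alpha> * d \<beta>) * multi_monom (\<lambda>i. \<alpha> i + \<beta> i) z)" for z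
    unfolding p(2) q(2) sum_product
    by (intro sum.cong refl) (metis (no_types, lifting) mult.assoc mult.left_commute)
  then show ?thesis by (simp add: polynomial_fun_sum polynomial_fun_multi_monom)
qed

lemma polynomial_fun_cinner_prod: "polynomial_fun (\<lambda>z. cinner_prod z x)"
proof -
  have "z $ i = multi_monom (\<lambda>j. if j = i then 1 else 0) z" for i and z :: "complex ^ 'a"
  proof -
    have "multi_monom (\<lambda>j. if j = i then 1 else 0) z = (\<Prod>j\<in>UNIV. if j = i then z $ j else 1)"
      unfolding multi_monom_def by (intro prod.cong) auto
    then show ?thesis by simp
  qed
  then have "cinner_prod z x = (\<Sum>i\<in>UNIV. cnj (x $ i) * multi_monom (\<lambda>j. if j = i then 1 else 0) z)" for z
    by (simp add: cinner_prod_def mult.commute)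
  then show ?thesis by (simp add: polynomial_fun_sum polynomial_fun_multi_monom)
qed

lemma polynomial_fun_power: "polynomial_fun p \<Longrightarrow> polynomial_fun (\<lambda>z. p z ^ n)"
  by (induction n) (auto simp: polynomial_fun_const polynomial_fun_mult)

section \<open>The closure of the polynomials in the multiplier norm\<close>

context cnp_space
begin

text \<open>Henkin measures are tested on polynomials, so the multipliers built from potentials must
  be norm limits of polynomials. A bound for \<open>\<phi>\<close> is included for use in
  products.\<close>

definition approximable :: "(complex ^ 'd \<Rightarrow> complex) \<Rightarrow> bool" where
  "approximable \<phi> \<longleftrightarrow> (\<exists>c. mult_bound \<phi> c) \<and> (\<forall>e>0. \<exists>p. polynomial_fun p \<and> mult_bound (\<lambda>z. \<phi> z - p z) e)"

lemma approximable_mult_bound: "approximable \<phi> \<Longrightarrow> \<exists>c. mult_bound \<phi> c"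
  by (simp add: approximable_def)

lemma mult_bound_zero: "e \<ge> 0 \<Longrightarrow> mult_bound (\<lambda>z. 0) e"
  using mult_bound_mono[OF mult_bound_const[of 0]] by simp

lemma approximable_polynomial:
  assumes "polynomial_fun p" "mult_bound p c"
  shows "approximable p"
  using assms mult_bound_zero unfolding approximable_def by (auto intro!: exI[of _ p])

lemma approximable_cong:
  assumes "approximable \<phi>" "\<And>z. z \<in> ball 0 1 \<Longrightarrow> \<psi> z = \<phi> z"
  shows "approximable \<psi>"
  unfolding approximable_def
proof (intro conjI allI impI)
  show "\<exists>c. mult_bound \<psi> c" using assms mult_bound_cong unfolding approximable_def by blast
  fix e :: real assume "e > 0"
  then obtain p where p: "polynomial_fun p" "mult_bound (\<lambda>z. \<phi> z - p z) e" using assms by (auto simp: approximable_def)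
  then have "mult_bound (\<lambda>z. \<psi> z - p z) e" by (rule_tac mult_bound_cong) (auto simp: assms(2) simp del: mem_ball mem_ball_0)
  then show "\<exists>p. polynomial_fun p \<and> mult_bound (\<lambda>z. \<psi> z - p z) e" using p by blast
qed

lemma approximable_limit:
  assumes "\<And>e. e > 0 \<Longrightarrow> \<exists>\<psi>. approximable \<psi> \<and> mult_bound (\<lambda>z. \<phi> z - \<psi> z) e"
  shows "approximable \<phi>"
  unfolding approximable_def
proof (intro conjI allI impI)
  obtain \<psi> where \<psi>: "mult_bound (\<lambda>z. \<phi> z - \<psi> z) 1" "approximable \<psi>" using assms[of 1] by auto
  then obtain c where "mult_bound \<psi> c" using approximable_mult_bound by blast
  from mult_bound_add[OF \<psi>(1) this] show "\<exists>c. mult_bound \<phi> c" by auto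
  fix e :: real assume e: "e > 0"
  obtain \<psi> where \<psi>: "approximable \<psi>" "mult_bound (\<lambda>z. \<phi> z - \<psi> z) (e/2)" using assms[of "e/2"] e by auto
  obtain p where p: "polynomial_fun p" "mult_bound (\<lambda>z. \<psi> z - p z) (e/2)"
    using \<psi>(1) e unfolding approximable_def by (meson half_gt_zero)
  from mult_bound_add[OF \<psi>(2) p(2)] have "mult_bound (\<lambda>z. \<phi> z - p z) e" by simp
  then show "\<exists>p. polynomial_fun p \<and> mult_bound (\<lambda>z. \<phi> z - p z) e" using p by blast
qed

lemma approximable_const: "approximable (\<lambda>z. t)"
  by (rule approximable_polynomial[OF polynomial_fun_const mult_bound_const])

lemma approximable_add:
  assumes "approximable \<phi>" "approximable \<psi>"
  shows "approximable (\<lambda>z. \<phi> z + \<psi> z)"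
  unfolding approximable_def
proof (intro conjI allI impI)
  show "\<exists>c. mult_bound (\<lambda>z. \<phi> z + \<psi> z) c" using assms mult_bound_add by (meson approximable_mult_bound)
  fix e :: real assume e: "e > 0"
  obtain p where p: "polynomial_fun p" "mult_bound (\<lambda>z. \<phi> z - p z) (e/2)"
    using assms(1) e unfolding approximable_def by (meson half_gt_zero)
  obtain q where q: "polynomial_fun q" "mult_bound (\<lambda>z. \<psi> z - q z) (e/2)"
    using assms(2) e unfolding approximable_def by (meson half_gt_zero)
  from mult_bound_add[OF p(2) q(2)] have "mult_bound (\<lambda>z. \<phi> z + \<psi> z - (p z + q z)) e" by (simp add: algebra_simps)
  then show "\<exists>p. polynomial_fun p \<and> mult_bound (\<lambda>z. \<phi> z + \<psi> z - p z) e"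
    using polynomial_fun_add[OF p(1) q(1)] by blast
qed

lemma approximable_mult:
  assumes "approximable \<phi>" "approximable \<psi>"
  shows "approximable (\<lambda>z. \<phi> z * \<psi> z)"
  unfolding approximable_def
proof (intro conjI allI impI)
  obtain c d where cd: "mult_bound \<phi> c" "mult_bound \<psi> d" using assms approximable_mult_bound by blast
  then show "\<exists>c. mult_bound (\<lambda>z. \<phi> z * \<psi> z) c" using mult_bound_prod by blast
  have c: "c \<ge> 0" "d \<ge> 0" using cd by (auto simp: mult_bound_def)
  fix e :: real assume e: "e > 0"
  define e1 where "e1 = min 1 (e / (c + d + 1))"
  have e1: "e1 > 0" "e1 \<le> 1" "e1 * (c + d + 1) \<le> e"
  proof -
    show "e1 > 0" "e1 \<le> 1" using e c by (auto simp: e1_def)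
    have "e1 \<le> e / (c + d + 1)" by (simp add: e1_def)
    then show "e1 * (c + d + 1) \<le> e" using c by (simp add: pos_le_divide_eq)
  qed
  obtain p where p: "polynomial_fun p" "mult_bound (\<lambda>z. \<phi> z - p z) e1"
    using assms(1) e1 unfolding approximable_def by meson
  obtain q where q: "polynomial_fun q" "mult_bound (\<lambda>z. \<psi> z - q z) e1"
    using assms(2) e1 unfolding approximable_def by meson
  have "mult_bound (\<lambda>z. \<psi> z - (\<psi> z - q z)) (d + e1)" by (rule mult_bound_diff[OF cd(2) q(2)])
  then have "mult_bound q (d + e1)" by simp
  from mult_bound_add[OF mult_bound_prod[OF cd(1) q(2)] mult_bound_prod[OF p(2) this]]
  have "mult_bound (\<lambda>z. \<phi> z * \<psi> z - p z * q z) (c * e1 + e1 * (d + e1))" by (simp add: algebra_simps)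
  moreover have "c * e1 + e1 * (d + e1) \<le> e1 * (c + d + 1)"
    using e1 by (simp add: algebra_simps)
  ultimately have "mult_bound (\<lambda>z. \<phi> z * \<psi> z - p z * q z) e" using mult_bound_mono e1(3) order_trans by blast
  then show "\<exists>p. polynomial_fun p \<and> mult_bound (\<lambda>z. \<phi> z * \<psi> z - p z) e"
    using polynomial_fun_mult[OF p(1) q(1)] by blast
qed

lemma approximable_sum:
  "(\<And>i. i \<in> I \<Longrightarrow> approximable (\<phi> i)) \<Longrightarrow> approximable (\<lambda>z. \<Sum>i\<in>I. \<phi> i z)"
  by (induction I rule: infinite_finite_induct) (auto simp: approximable_const intro: approximable_add)

lemma approximable_power: "approximable \<phi> \<Longrightarrow> approximable (\<lambda>z. \<phi> z ^ n)"
  by (induction n) (auto simp: approximable_const approximable_mult)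

text \<open>Partial sums of the Neumann series; the remainder \<open>u ^ M / (1 - u)\<close> has
  bound \<open>\<theta> ^ M / (1 - \<theta>)\<close> by \<open>mult_bound_inverse\<close>.\<close>

lemma approximable_inverse:
  assumes u: "approximable u" "mult_bound u \<theta>" and \<theta>: "\<theta> < 1" and ne: "\<And>z. z \<in> ball 0 1 \<Longrightarrow> u z \<noteq> 1"
  shows "approximable (\<lambda>z. 1 / (1 - u z))"
proof (rule approximable_limit)
  fix e :: real assume e: "e > 0"
  have \<theta>0: "\<theta> \<ge> 0" using u by (simp add: mult_bound_def)
  have "(\<lambda>M. \<theta> ^ M * (1 / (1 - \<theta>))) \<longlonglongrightarrow> 0 * (1 / (1 - \<theta>))"
    using \<theta> \<theta>0 by (intro tendsto_intros LIMSEQ_realpow_zero)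
  then have "\<forall>\<^sub>F M in sequentially. \<theta> ^ M * (1 / (1 - \<theta>)) < e"
    using e by (intro order_tendstoD(2)) auto
  then obtain M where M: "\<theta> ^ M * (1 / (1 - \<theta>)) < e" by (auto simp: eventually_sequentially)
  have "mult_bound (\<lambda>z. 1 / (1 - u z) - (\<Sum>m<M. u z ^ m)) (\<theta> ^ M * (1 / (1 - \<theta>)))"
  proof (rule mult_bound_cong[OF mult_bound_prod[OF mult_bound_power[OF u(2)] mult_bound_inverse[OF u(2) \<theta> ne]]])
    show "1 / (1 - u z) - (\<Sum>m<M. u z ^ m) = u z ^ M * (1 / (1 - u z))" if "z \<in> ball 0 1" for z
      using ne[OF that] by (simp add: sum_gp_strict diff_divide_distrib)
  qed
  then have "mult_bound (\<lambda>z. 1 / (1 - u z) - (\<Sum>m<M. u z ^ m)) e" using M by (rule_tac mult_bound_mono) auto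
  then show "\<exists>\<psi>. approximable \<psi> \<and> mult_bound (\<lambda>z. 1 / (1 - u z) - \<psi> z) e"
    by (intro exI[of _ "\<lambda>z. \<Sum>m<M. u z ^ m"] conjI approximable_sum approximable_power u)
qed

lemma Bk_sums:
  assumes "z \<in> ball 0 1" "w \<in> ball 0 1"
  shows "(\<lambda>n. of_real (b n) * cinner_prod z w ^ n) sums Bk z w"
proof -
  have c: "cmod (cinner_prod z w) < 1" using assms by (intro cinner_prod_lt_1) auto
  show ?thesis unfolding Bk_def power_kernel_eq beta_eq[OF c, symmetric] \<beta>_def
    by (intro summable_sums summable_norm_cancel[OF summable_b] c)
qed

lemma psd_partial_B: "finite I \<Longrightarrow> psd_kernel X (\<lambda>z w. \<Sum>n\<in>I. of_real (b n) * cinner_prod z w ^ n)"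
  by (intro psd_sum psd_scale psd_power psd_cinner_prod b_nn)

text \<open>The tails of the series for \<open>Bk\<close> are psd kernels dominated by
  \<open>Bk\<close>, so \<open>mult_bound_slice\<close> bounds the slice of a tail by the square
  root of its value at \<open>(x, x)\<close>, which tends to 0.\<close>

lemma approximable_Bk:
  assumes x: "x \<in> ball 0 1"
  shows "approximable (\<lambda>z. Bk z x)"
proof (rule approximable_limit)
  fix e :: real assume e: "e > 0"
  define P where "P N z w = (\<Sum>n<N. of_real (b n) * cinner_prod z w ^ n)" for N and z w :: "complex ^ 'd"
  have Plim: "(\<lambda>N. P N z w) \<longlonglongrightarrow> Bk z w" if "z \<in> ball 0 1" "w \<in> ball 0 1" for z w
    using Bk_sums[OF that] by (simp add: sums_def P_def)
  have psdP: "psd_kernel (ball 0 1) (P N)" for N unfolding P_def[abs_def] by (intro psd_partial_B) simp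
  have psdT: "psd_kernel (ball 0 1) (\<lambda>z w. Bk z w - P N z w)" for N
  proof (rule psd_limit[where k = "\<lambda>M z w. P (M + N) z w - P N z w"])
    fix M
    show "psd_kernel (ball 0 1) (\<lambda>z w. P (M + N) z w - P N z w)"
    proof (rule psd_cong_imp)
      show "psd_kernel (ball 0 1) (\<lambda>z w. \<Sum>n\<in>{N..<M+N}. of_real (b n) * cinner_prod z w ^ n)"
        by (intro psd_partial_B) simp
      show "P (M + N) z w - P N z w = (\<Sum>n\<in>{N..<M+N}. of_real (b n) * cinner_prod z w ^ n)" for z w
        unfolding P_def lessThan_atLeast0 by (subst sum_diff_nat_ivl) auto
    qed
  next
    fix z w :: "complex ^ 'd" assume "z \<in> ball 0 1" "w \<in> ball 0 1"
    then show "(\<lambda>M. P (M + N) z w - P N z w) \<longlonglongrightarrow> Bk z w - P N z w"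
      by (intro tendsto_diff tendsto_const LIMSEQ_ignore_initial_segment Plim)
  qed
  have KT: "psd_kernel (ball 0 1) (\<lambda>z w. K z w - K z w * (Bk z w - P N z w))" for N
  proof (rule psd_cong_imp[OF psd_add[OF psd_K_minus_KB psd_mult[OF psd_K psdP[of N]]]])
  qed (simp add: algebra_simps)
  have "(\<lambda>N. sqrt (Re (Bk x x - P N x x))) \<longlonglongrightarrow> sqrt (Re (Bk x x - Bk x x))"
    by (intro tendsto_intros Plim x)
  then have "\<forall>\<^sub>F N in sequentially. sqrt (Re (Bk x x - P N x x)) < e"
    using e by (intro order_tendstoD(2)) auto
  then obtain N where N: "sqrt (Re (Bk x x - P N x x)) < e" by (auto simp: eventually_sequentially)
  have m: "mult_bound (\<lambda>z. Bk z x - P N z x) (sqrt (Re (Bk x x - P N x x)))"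
    by (rule mult_bound_slice[OF psdT KT x])
  then have "mult_bound (\<lambda>z. Bk z x - P N z x) e" using N by (rule_tac mult_bound_mono) auto
  moreover have "approximable (\<lambda>z. P N z x)"
  proof (rule approximable_polynomial)
    show "polynomial_fun (\<lambda>z. P N z x)" unfolding P_def
      by (intro polynomial_fun_sum polynomial_fun_mult polynomial_fun_const polynomial_fun_power polynomial_fun_cinner_prod)
    have "mult_bound (\<lambda>z. Bk z x - (Bk z x - P N z x)) (sqrt (Re (Bk x x)) + sqrt (Re (Bk x x - P N x x)))"
      by (rule mult_bound_diff[OF mult_bound_Bk[OF x] m])
    then show "mult_bound (\<lambda>z. P N z x) (sqrt (Re (Bk x x)) + sqrt (Re (Bk x x - P N x x)))" by simp
  qed
  ultimately show "\<exists>\<psi>. approximable \<psi> \<and> mult_bound (\<lambda>z. Bk z x - \<psi> z) e" by blast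
qed

lemma approximable_kf:
  assumes x: "x \<in> ball 0 1"
  shows "approximable (kf x)"
proof (rule approximable_cong)
  show "approximable (\<lambda>z. 1 / (1 - Bk z x))"
    using Bk_diag[OF x] Bk_neq_1[OF _ x] by (intro approximable_inverse[OF approximable_Bk mult_bound_Bk] x) auto
qed (use x kf_eq_inverse in blast)

text \<open>For accretive \<open>g\<close> of norm at most \<open>L\<close> and \<open>R = L\<^sup>2 + 1\<close>, the multiplier
  \<open>u = 1 - (1 + g) / R\<close> has norm less than 1, so \<open>1 / (1 + g)\<close> is a Neumann series in \<open>u\<close>.\<close>

lemma approximable_accretive_inverse:
  assumes g: "approximable g" and acc: "psd_kernel (ball 0 1) (\<lambda>z w. K z w * (g z + cnj (g w)))"
    and Re: "\<And>z. z \<in> ball 0 1 \<Longrightarrow> Re (g z) \<ge> 0"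
  shows "approximable (\<lambda>z. 1 / (1 + g z))" "mult_bound (\<lambda>z. 1 / (1 + g z)) 1"
proof -
  obtain L where L: "mult_bound g L" using approximable_mult_bound[OF g] by blast
  define R where "R = L\<^sup>2 + 1"
  have R: "R \<ge> 1" by (simp add: R_def)
  define u where "u z = (of_real (R - 1) - g z) * of_real (1 / R)" for z
  \<comment> \<open>In the square of \<open>R - 1 - g\<close> the cross terms are non-positive by
    accretivity, leaving \<open>(R - 1)\<^sup>2 + L\<^sup>2\<close>. This is below
    \<open>R\<^sup>2\<close> exactly if \<open>L\<^sup>2 < 2 * R - 1\<close>, which the choice of
    \<open>R\<close> ensures.\<close>
  define \<theta> where "\<theta> = sqrt ((R - 1)\<^sup>2 + L\<^sup>2) / R"
  have ne: "1 + g z \<noteq> 0" if "z \<in> ball 0 1" for z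
  proof
    assume "1 + g z = 0"
    then have "Re (1 + g z) = 0" by simp
    then show False using Re[OF that] by simp
  qed
  have "psd_kernel (ball 0 1) (\<lambda>z w. of_real (1 / R\<^sup>2) * (K z w * (of_real (L\<^sup>2) - g z * cnj (g w)) + of_real (R - 1) * (K z w * (g z + cnj (g w)))))"
    using L R acc by (intro psd_scale psd_add) (auto simp: mult_bound_def)
  then have "psd_kernel (ball 0 1) (\<lambda>z w. K z w * (of_real (\<theta>\<^sup>2) - u z * cnj (u w)))"
  proof (rule psd_cong_imp)
    fix z w
    have \<theta>2: "\<theta>\<^sup>2 = ((R - 1)\<^sup>2 + L\<^sup>2) * (1 / R\<^sup>2)"
      by (simp add: \<theta>_def power_divide)
    have uu: "u z * cnj (u w) = (of_real (R - 1) - g z) * (of_real (R - 1) - cnj (g w)) * of_real (1 / R\<^sup>2)"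
      by (simp add: u_def power2_eq_square)
    show "K z w * (of_real (\<theta>\<^sup>2) - u z * cnj (u w)) =
      of_real (1 / R\<^sup>2) * (K z w * (of_real (L\<^sup>2) - g z * cnj (g w)) + of_real (R - 1) * (K z w * (g z + cnj (g w))))"
      unfolding \<theta>2 uu of_real_mult of_real_add of_real_power
      by (simp only: algebra_simps power2_eq_square)
  qed
  moreover have "\<theta> \<ge> 0" using R by (simp add: \<theta>_def)
  ultimately have mu: "mult_bound u \<theta>" by (simp add: mult_bound_def)
  have "(R - 1)\<^sup>2 + L\<^sup>2 < R\<^sup>2" by (simp add: R_def power2_eq_square algebra_simps add_pos_nonneg)
  then have "sqrt ((R - 1)\<^sup>2 + L\<^sup>2) < R" using R real_sqrt_less_mono[of "(R - 1)\<^sup>2 + L\<^sup>2" "R\<^sup>2"] by simp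
  then have \<theta>1: "\<theta> < 1" using R by (simp add: \<theta>_def)
  have u1: "1 - u z = (1 + g z) * of_real (1 / R)" for z
    using R by (simp add: u_def field_simps)
  have "approximable u" unfolding u_def[abs_def]
    using approximable_add[OF approximable_const[of "of_real (R - 1)"] approximable_mult[OF approximable_const[of "-1"] g]]
    by (intro approximable_mult approximable_const) simp
  then have "approximable (\<lambda>z. 1 / (1 - u z))"
  proof (rule approximable_inverse[OF _ mu \<theta>1])
    show "u z \<noteq> 1" if "z \<in> ball 0 1" for z
    proof
      assume "u z = 1"
      then have "(1 + g z) * of_real (1 / R) = 0" using u1[of z] by simp
      then show False using ne[OF that] R by simp
    qed
  qed
  from approximable_mult[OF approximable_const[of "of_real (1 / R)"] this]
  show "approximable (\<lambda>z. 1 / (1 + g z))"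
    by (rule approximable_cong) (use R in \<open>simp add: u1\<close>)
  \<comment> \<open>The product of \<open>1 + g\<close> with its conjugate exceeds 1 by an
    accretivity term and a rank-one term, so the inverse is a contraction.\<close>
  have "psd_kernel (ball 0 1) (\<lambda>z w. (1 / (1 + g z)) * cnj (1 / (1 + g w)) * (K z w * (g z + cnj (g w)) + g z * cnj (g w) * K z w))"
    by (intro psd_congruence psd_add acc psd_K)
  then have "psd_kernel (ball 0 1) (\<lambda>z w. K z w * (of_real (1\<^sup>2) - (1 / (1 + g z)) * cnj (1 / (1 + g w))))"
  proof (rule psd_cong_imp)
    fix z w :: "complex ^ 'd" assume zw: "z \<in> ball 0 1" "w \<in> ball 0 1"
    have 1: "(1 + g z) * (1 / (1 + g z)) = 1" using ne[OF zw(1)] by simp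
    have 2: "(1 + cnj (g w)) * cnj (1 / (1 + g w)) = 1"
    proof -
      have "(1 + cnj (g w)) * cnj (1 / (1 + g w)) = cnj ((1 + g w) * (1 / (1 + g w)))"
        by (simp only: complex_cnj_mult complex_cnj_add complex_cnj_one)
      then show ?thesis using ne[OF zw(2)] by simp
    qed
    have "k * (1 - x * y) = x * y * (k * (s + t) + s * t * k)" if "(1 + s) * x = 1" "(1 + t) * y = 1" for k s t x y :: complex
      using that by algebra
    from this[OF 1 2] show "K z w * (of_real (1\<^sup>2) - (1 / (1 + g z)) * cnj (1 / (1 + g w))) =
       (1 / (1 + g z)) * cnj (1 / (1 + g w)) * (K z w * (g z + cnj (g w)) + g z * cnj (g w) * K z w)"
      by (simp only: power_one of_real_1)
  qed
  then show "mult_bound (\<lambda>z. 1 / (1 + g z)) 1" by (simp add: mult_bound_def)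
qed

text \<open>The potential from \<open>large_potential\<close> divided by \<open>T\<close>: the norm
  becomes at most 1, the real part stays at least \<open>C\<close> on \<open>A\<close>, and the
  total mass is \<open>1 / T \<le> 1 / C\<close>. The masses lie at radius
  \<open>\<rho> < 1\<close>, so \<open>g\<close> is continuous on the closed ball. Distance from
  \<open>A\<close> is measured by \<open>1 - Re (cinner_prod z w)\<close>, as in
  \<open>norm_kappa_le\<close>.\<close>

lemma peak_potential:
  fixes A :: "(complex ^ 'd) set"
  assumes A: "compact A" "A \<subseteq> sphere 0 1" "A \<noteq> {}"
    and inf: "\<And>\<mu>. prob_space \<mu> \<Longrightarrow> sets \<mu> = sets (borel_sphere :: (complex ^ 'd) measure) \<Longrightarrow>
      emeasure \<mu> (sphere 0 1 - A) = 0 \<Longrightarrow> energy a \<mu> = \<infinity>"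
    and C: "C \<ge> 1"
  shows "\<exists>g. continuous_on (cball 0 1) g \<and> (\<forall>z\<in>cball 0 1. Re (g z) \<ge> 0) \<and> (\<forall>z\<in>A. C \<le> Re (g z)) \<and>
     (\<forall>z\<in>cball 0 1. \<forall>\<delta>. 0 < \<delta> \<longrightarrow> \<delta> \<le> 1 \<longrightarrow> (\<forall>w\<in>A. \<delta> \<le> 1 - Re (cinner_prod z w)) \<longrightarrow> cmod (g z) \<le> 1 / (C * (a 1 * \<delta>))) \<and>
     approximable g \<and> psd_kernel (ball 0 1) (\<lambda>z w. K z w * (g z + cnj (g w))) \<and>
     (\<lambda>z. if z \<in> ball 0 1 then g z else 0) \<in> H \<and> hn (\<lambda>z. if z \<in> ball 0 1 then g z else 0) \<le> 1"
proof -
  obtain F c \<rho> T where F: "finite F" "F \<subseteq> A" and c: "\<And>w. w \<in> F \<Longrightarrow> c w \<ge> 0" "sum c F = 1"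
    and \<rho>: "0 < \<rho>" "\<rho> < 1" and T: "C \<le> T" "hn (fpot F c \<rho>) \<le> T"
    and large: "\<And>\<zeta>. \<zeta> \<in> A \<Longrightarrow> C * T \<le> Re (\<Sum>w\<in>F. of_real (c w) * K \<zeta> (\<rho> *\<^sub>R w))"
    using large_potential[OF A inf C] by blast
  have T0: "T > 0" using T C by simp
  have Fn: "norm w = 1" if "w \<in> F" for w using that F A by auto
  have FB: "F \<subseteq> cball 0 1" using Fn by auto
  have \<rho>w: "\<rho> *\<^sub>R w \<in> ball 0 1" if "w \<in> F" for w using Fn[OF that] \<rho> by simp
  have cip: "cmod (cinner_prod z (\<rho> *\<^sub>R w)) < 1" if "z \<in> cball 0 1" "w \<in> F" for z w
    using that \<rho>w[OF that(2)] by (intro cinner_prod_lt_1') auto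
  define g where "g z = (\<Sum>w\<in>F. of_real (c w / T) * K z (\<rho> *\<^sub>R w))" for z
  have g_alt: "g z = of_real (1 / T) * (\<Sum>w\<in>F. of_real (c w) * K z (\<rho> *\<^sub>R w))" for z
    unfolding g_def sum_distrib_left by (intro sum.cong refl) simp
  have g_ball: "g z = (\<Sum>w\<in>F. of_real (c w / T) * kf (\<rho> *\<^sub>R w) z)" if "z \<in> ball 0 1" for z
    unfolding g_def kf_apply[OF that] ..
  have "continuous_on (cball 0 1) g"
    unfolding g_def[abs_def] by (intro continuous_intros continuous_on_K cip)
  moreover have "Re (g z) \<ge> 0" if z: "z \<in> cball 0 1" for z
  proof -
    have "Re (of_real (c w / T) * K z (\<rho> *\<^sub>R w)) \<ge> 0" if "w \<in> F" for w
      using Re_kappa_nonneg[OF cip[OF z that]] c(1)[OF that] T0 by (simp add: power_kernel_eq)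
    then show ?thesis unfolding g_def Re_sum by (intro sum_nonneg)
  qed
  moreover have "C \<le> Re (g z)" if "z \<in> A" for z
  proof -
    have "Re (g z) = Re (\<Sum>w\<in>F. of_real (c w) * K z (\<rho> *\<^sub>R w)) / T" unfolding g_alt by simp
    then show ?thesis using large[OF that] T0 by (simp add: pos_le_divide_eq)
  qed
  moreover have "cmod (g z) \<le> 1 / (C * (a 1 * \<delta>))"
    if z: "z \<in> cball 0 1" and \<delta>: "0 < \<delta>" "\<delta> \<le> 1" "\<forall>w\<in>A. \<delta> \<le> 1 - Re (cinner_prod z w)" for z \<delta>
  proof -
    have pos: "a 1 * \<delta> > 0" using a_pos[of 1] \<delta> by simp
    have "cmod (of_real (c w / T) * K z (\<rho> *\<^sub>R w)) \<le> c w / T * (1 / (a 1 * \<delta>))" if w: "w \<in> F" for w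
    proof -
      have "\<delta> \<le> 1 - Re (cinner_prod z (\<rho> *\<^sub>R w))"
      proof -
        have "Re (cinner_prod z w) \<le> 1 - \<delta>" using \<delta>(3) w F(2) by fastforce
        then have "\<rho> * Re (cinner_prod z w) \<le> \<rho> * (1 - \<delta>)" using \<rho> by (intro mult_left_mono) auto
        also have "\<dots> \<le> 1 * (1 - \<delta>)" using \<rho> \<delta> by (intro mult_right_mono) auto
        finally show ?thesis by (simp add: cinner_prod_scaleR_right)
      qed
      then have "a 1 * \<delta> \<le> a 1 * (1 - Re (cinner_prod z (\<rho> *\<^sub>R w)))"
        using a_pos[of 1] by (intro mult_left_mono) auto
      then have "1 / (a 1 * (1 - Re (cinner_prod z (\<rho> *\<^sub>R w)))) \<le> 1 / (a 1 * \<delta>)"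
        using pos by (intro frac_le) auto
      then have "cmod (K z (\<rho> *\<^sub>R w)) \<le> 1 / (a 1 * \<delta>)"
        using norm_kappa_le[OF cip[OF z w]] by (simp add: power_kernel_eq)
      then have "c w / T * cmod (K z (\<rho> *\<^sub>R w)) \<le> c w / T * (1 / (a 1 * \<delta>))"
        using c(1)[OF w] T0 by (intro mult_left_mono) auto
      then show ?thesis using c(1)[OF w] T0 by (simp add: norm_mult norm_divide)
    qed
    then have "cmod (g z) \<le> (\<Sum>w\<in>F. c w / T * (1 / (a 1 * \<delta>)))"
      unfolding g_def by (rule sum_norm_le)
    also have "\<dots> = sum c F / T * (1 / (a 1 * \<delta>))"
      unfolding sum_divide_distrib sum_distrib_right ..
    also have "\<dots> = 1 / (T * (a 1 * \<delta>))" using c(2) by simp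
    also have "\<dots> \<le> 1 / (C * (a 1 * \<delta>))"
    proof (rule frac_le)
      show "C * (a 1 * \<delta>) \<le> T * (a 1 * \<delta>)" using T pos by (intro mult_right_mono) auto
      show "0 < C * (a 1 * \<delta>)" using C by (intro mult_pos_pos[OF _ pos]) simp
    qed auto
    finally show ?thesis .
  qed
  moreover have "approximable g"
  proof (rule approximable_cong)
    show "approximable (\<lambda>z. \<Sum>w\<in>F. of_real (c w / T) * kf (\<rho> *\<^sub>R w) z)"
      using \<rho>w by (intro approximable_sum approximable_mult approximable_const approximable_kf)
  qed (rule g_ball)
  moreover have "psd_kernel (ball 0 1) (\<lambda>z w. K z w * (g z + cnj (g w)))"
  proof (rule psd_cong_imp)
    show "psd_kernel (ball 0 1) (\<lambda>z w. \<Sum>x\<in>F. of_real (c x / T) * (K z w * (kf (\<rho> *\<^sub>R x) z + cnj (kf (\<rho> *\<^sub>R x) w) - 1) + K z w))"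
      using c T0 \<rho>w by (intro psd_sum psd_scale psd_add psd_kf_accretive psd_K) auto
    fix z w :: "complex ^ 'd" assume zw: "z \<in> ball 0 1" "w \<in> ball 0 1"
    have "cnj (g w) = (\<Sum>x\<in>F. of_real (c x / T) * cnj (kf (\<rho> *\<^sub>R x) w))"
      unfolding g_ball[OF zw(2)] by simp
    then show "K z w * (g z + cnj (g w)) = (\<Sum>x\<in>F. of_real (c x / T) * (K z w * (kf (\<rho> *\<^sub>R x) z + cnj (kf (\<rho> *\<^sub>R x) w) - 1) + K z w))"
      unfolding g_ball[OF zw(1)] by (simp add: sum.distrib[symmetric] sum_distrib_left algebra_simps del: of_real_divide)
  qed
  moreover have h: "(\<lambda>z. if z \<in> ball 0 1 then g z else 0) = (\<lambda>z. of_real (1 / T) * fpot F c \<rho> z)"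
  proof
    fix z
    have fm: "fpot F c \<rho> \<in> H" using FB \<rho> by (intro fpot_mem) auto
    show "(if z \<in> ball 0 1 then g z else 0) = of_real (1 / T) * fpot F c \<rho> z"
      using vanishes_off[OF fm, of z] by (auto simp: g_alt fpot_def kf_def)
  qed
  moreover have "(\<lambda>z. of_real (1 / T) * fpot F c \<rho> z) \<in> H" "hn (\<lambda>z. of_real (1 / T) * fpot F c \<rho> z) \<le> 1"
  proof -
    have fm: "fpot F c \<rho> \<in> H" using FB \<rho> by (intro fpot_mem) auto
    then show "(\<lambda>z. of_real (1 / T) * fpot F c \<rho> z) \<in> H" by (rule scale_mem)
    show "hn (\<lambda>z. of_real (1 / T) * fpot F c \<rho> z) \<le> 1"
      unfolding hn_scale[OF fm] using T T0 by (simp add: norm_divide)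
  qed
  ultimately show ?thesis by (intro exI[of _ g]) (simp only: h, blast)
qed

end

section \<open>Sets of capacity zero\<close>

lemma compact_inner_approximation:
  fixes m :: "(complex ^ 'd::finite) measure"
  assumes fm: "finite_measure m" and sets: "sets m = sets (borel_sphere :: (complex ^ 'd) measure)"
    and B: "B \<in> sets (borel_sphere :: (complex ^ 'd) measure)" and e: "e > 0"
  shows "\<exists>K. compact K \<and> K \<subseteq> B \<and> measure m (B - K) < e"
proof -
  interpret finite_measure m by fact
  have sp: "space m = sphere 0 1" using sets_eq_imp_space_eq[OF sets] by (simp add: space_restrict_space)
  have BB: "B \<in> sets borel" "B \<subseteq> sphere 0 1" using B by (auto simp: sets_restrict_space_iff)
  have idm: "(\<lambda>x. x) \<in> measurable m borel"
    unfolding measurable_cong_sets[OF sets refl]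
    by (intro borel_measurable_continuous_on_restrict continuous_intros)
  \<comment> \<open>The push-forward to the whole space, where \<open>inner_regular\<close>
    applies.\<close>
  define N where "N = distr m borel (\<lambda>x. x)"
  have N: "emeasure N S = emeasure m S" if "S \<in> sets borel" "S \<subseteq> sphere 0 1" for S
    unfolding N_def using that sp by (subst emeasure_distr[OF idm]) (auto simp: Int_absorb2)
  have "emeasure N B = (SUP K\<in>{K. K \<subseteq> B \<and> compact K}. emeasure N K)"
  proof (rule inner_regular)
    show "sets N = sets borel" by (simp add: N_def)
    have "finite_measure N" unfolding N_def by (rule finite_measure_distr[OF idm])
    then show "emeasure N (space N) \<noteq> \<infinity>" by (simp add: finite_measure.emeasure_finite)
  qed (use BB in auto)
  then have sup: "emeasure m B = (SUP K\<in>{K. K \<subseteq> B \<and> compact K}. emeasure N K)"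
    using N[OF BB] by simp
  have "\<exists>K. K \<subseteq> B \<and> compact K \<and> emeasure m B < emeasure N K + ennreal e"
  proof (rule ccontr)
    assume "\<not> ?thesis"
    then have "emeasure N K + ennreal e \<le> emeasure m B" if "K \<subseteq> B" "compact K" for K
      using that by (auto simp: not_less)
    then have "(SUP K\<in>{K. K \<subseteq> B \<and> compact K}. emeasure N K + ennreal e) \<le> emeasure m B"
      by (intro SUP_least) auto
    then have "emeasure m B + ennreal e \<le> emeasure m B"
      unfolding sup by (subst (asm) ennreal_SUP_add_left) auto
    then have "ennreal (measure m B + e) \<le> ennreal (measure m B)"
      using e by (simp add: emeasure_eq_measure ennreal_plus)
    then show False using e by (simp add: ennreal_le_iff)
  qed
  then obtain K where K: "K \<subseteq> B" "compact K" "emeasure m B < emeasure N K + ennreal e" by blast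
  have Kb: "K \<in> sets borel" using K(2) by (intro borel_closed compact_imp_closed)
  have Km: "K \<in> sets m" unfolding sets using Kb K(1) BB(2) by (auto simp: sets_restrict_space_iff)
  have "emeasure N K = emeasure m K" using K BB by (intro N Kb) auto
  then have "ennreal (measure m B) < ennreal (measure m K + e)"
    using K(3) e by (simp add: emeasure_eq_measure ennreal_plus)
  then have "measure m B < measure m K + e" by (subst (asm) ennreal_less_iff) auto
  moreover have "measure m (B - K) = measure m B - measure m K"
    using finite_measure_Diff[of B K] B sets Km K(1) by simp
  ultimately show ?thesis using K by (intro exI[of _ K]) auto
qed

text \<open>Inner regularity of both Jordan parts: the union of two compact sets exhausts
  \<open>B\<close> up to \<open>e/2\<close> for each part at once, and the charge vanishes on that
  union.\<close>

lemma complex_measure_null_if_compact_null: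
  fixes E :: "(complex ^ 'd::finite) set"
  assumes \<nu>: "complex_measure borel_sphere \<nu>"
    and null: "\<And>K. compact K \<Longrightarrow> K \<subseteq> E \<Longrightarrow> \<nu> K = 0"
    and B: "B \<in> sets (borel_sphere :: (complex ^ 'd) measure)" "B \<subseteq> E"
  shows "\<nu> B = 0"
proof -
  let ?M = "borel_sphere :: (complex ^ 'd) measure"
  have main: "\<rho> B = 0" if sm: "signed_measure ?M \<rho>" and rn: "\<And>K. compact K \<Longrightarrow> K \<subseteq> E \<Longrightarrow> \<rho> K = 0" for \<rho>
  proof -
    interpret P: signed_measure ?M \<rho> by fact
    interpret N: signed_measure ?M "\<lambda>A. - \<rho> A" by (rule P.signed_measure_uminus)
    have "\<bar>\<rho> B\<bar> \<le> e" if e: "e > 0" for e :: real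
    proof -
      obtain K1 where K1: "compact K1" "K1 \<subseteq> B" "measure (positive_part ?M \<rho>) (B - K1) < e/2"
        using compact_inner_approximation[OF P.finite_positive_part P.sets_positive_part B(1), of "e/2"] e by auto
      obtain K2 where K2: "compact K2" "K2 \<subseteq> B" "measure (positive_part ?M (\<lambda>A. - \<rho> A)) (B - K2) < e/2"
        using compact_inner_approximation[OF N.finite_positive_part N.sets_positive_part B(1), of "e/2"] e by auto
      define K where "K = K1 \<union> K2"
      have K: "compact K" "K \<subseteq> B" using K1 K2 by (auto simp: K_def)
      have sub: "S \<in> sets ?M" if "compact S" "S \<subseteq> B" for S
        using that B by (auto simp: sets_restrict_space_iff intro: borel_closed compact_imp_closed)
      have BK: "B - K \<in> sets ?M" "B - K1 \<in> sets ?M" "B - K2 \<in> sets ?M" using B(1) sub K K1 K2 by auto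
      have "\<rho> (B - K) = \<rho> B - \<rho> K" by (rule P.rho_Diff[OF B(1) sub[OF K] K(2)])
      moreover have "\<rho> K = 0" using K B(2) by (intro rn) auto
      moreover have "\<rho> (B - K) = measure (positive_part ?M \<rho>) (B - K) - measure (positive_part ?M (\<lambda>A. - \<rho> A)) (B - K)"
        by (rule P.Jordan_decomposition[OF BK(1)])
      moreover have "measure (positive_part ?M \<rho>) (B - K) \<le> measure (positive_part ?M \<rho>) (B - K1)"
        using BK by (intro finite_measure.finite_measure_mono[OF P.finite_positive_part]) (auto simp: K_def)
      moreover have "measure (positive_part ?M (\<lambda>A. - \<rho> A)) (B - K) \<le> measure (positive_part ?M (\<lambda>A. - \<rho> A)) (B - K2)"
        using BK by (intro finite_measure.finite_measure_mono[OF N.finite_positive_part]) (auto simp: K_def)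
      ultimately show ?thesis
        using K1(3) K2(3) measure_nonneg[of "positive_part ?M \<rho>" "B - K"] measure_nonneg[of "positive_part ?M (\<lambda>A. - \<rho> A)" "B - K"]
        by linarith
    qed
    then have "\<bar>\<rho> B\<bar> \<le> 0" by (rule field_le_epsilon) simp
    then show ?thesis by simp
  qed
  have "Re (\<nu> B) = 0" by (rule main[OF complex_measure_signed(1)[OF \<nu>]]) (simp add: null)
  moreover have "Im (\<nu> B) = 0" by (rule main[OF complex_measure_signed(2)[OF \<nu>]]) (simp add: null)
  ultimately show ?thesis by (simp add: complex_eq_iff)
qed

context cnp_space
begin

text \<open>Capacity zero with the supremum unfolded, since a reciprocal energy is 0 exactly when
  the energy is infinite.\<close>

definition infinite_energy_set :: "(complex ^ 'd) set \<Rightarrow> bool" where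
  "infinite_energy_set A \<longleftrightarrow> (\<forall>\<mu>. prob_space \<mu> \<longrightarrow> sets \<mu> = sets (borel_sphere :: (complex ^ 'd) measure) \<longrightarrow>
      emeasure \<mu> (sphere 0 1 - A) = 0 \<longrightarrow> energy a \<mu> = \<infinity>)"

lemma infinite_energy_subset:
  assumes "infinite_energy_set E" "A \<subseteq> E" "compact A"
  shows "infinite_energy_set A"
  unfolding infinite_energy_set_def
proof (intro allI impI)
  fix \<mu> :: "(complex ^ 'd) measure"
  assume \<mu>: "prob_space \<mu>" "sets \<mu> = sets (borel_sphere :: (complex ^ 'd) measure)" "emeasure \<mu> (sphere 0 1 - A) = 0"
  have "A \<in> sets borel" using assms(3) by (intro borel_closed compact_imp_closed)
  then have "sphere 0 1 - A \<in> sets \<mu>" unfolding \<mu>(2) by (auto simp: sets_restrict_space_iff)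
  then have "emeasure \<mu> (sphere 0 1 - E) \<le> emeasure \<mu> (sphere 0 1 - A)"
    using assms(2) by (intro emeasure_mono) auto
  then have "emeasure \<mu> (sphere 0 1 - E) = 0" using \<mu>(3) by simp
  then show "energy a \<mu> = \<infinity>" using assms(1) \<mu>(1,2) unfolding infinite_energy_set_def by blast
qed

lemma peak_potentialE:
  assumes "compact A" "A \<subseteq> sphere 0 1" "A \<noteq> {}" "infinite_energy_set A" "C \<ge> 1"
  obtains g where "continuous_on (cball 0 1) g" "\<And>z. z \<in> cball 0 1 \<Longrightarrow> Re (g z) \<ge> 0" "\<And>z. z \<in> A \<Longrightarrow> C \<le> Re (g z)"
    "\<And>z \<delta>. z \<in> cball 0 1 \<Longrightarrow> 0 < \<delta> \<Longrightarrow> \<delta> \<le> 1 \<Longrightarrow> (\<And>w. w \<in> A \<Longrightarrow> \<delta> \<le> 1 - Re (cinner_prod z w)) \<Longrightarrow> cmod (g z) \<le> 1 / (C * (a 1 * \<delta>))"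
    "approximable g" "psd_kernel (ball 0 1) (\<lambda>z w. K z w * (g z + cnj (g w)))"
    "(\<lambda>z. if z \<in> ball 0 1 then g z else 0) \<in> H" "hn (\<lambda>z. if z \<in> ball 0 1 then g z else 0) \<le> 1"
proof -
  have inf: "energy a \<mu> = \<infinity>" if "prob_space \<mu>" "sets \<mu> = sets (borel_sphere :: (complex ^ 'd) measure)"
      "emeasure \<mu> (sphere 0 1 - A) = 0" for \<mu>
    using assms(4) that unfolding infinite_energy_set_def by blast
  show ?thesis using peak_potential[OF assms(1-3) inf assms(5)] that by blast
qed

text \<open>The weights \<open>(1/2) ^ n\<close> are summable while the weighted lower bounds
  \<open>(1/2) ^ n * 4 ^ n\<close> are unbounded. All real parts are non-negative, so there is no
  cancellation and any single term bounds \<open>Re f\<close> from below.\<close>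

lemma infinite_energy_imp_unbounded:
  fixes E :: "(complex ^ 'd) set"
  assumes E: "compact E" "E \<subseteq> sphere 0 1" and inf: "infinite_energy_set E"
  shows "unboundedness_set H E"
proof (cases "E = {}")
  case True
  then show ?thesis using zero_mem by (auto simp: unboundedness_set_def)
next
  case False
  define P where "P n g \<longleftrightarrow> continuous_on (cball 0 1) g \<and> (\<forall>z\<in>cball 0 1. Re (g z) \<ge> 0) \<and> (\<forall>z\<in>E. 4 ^ n \<le> Re (g z)) \<and>
     (\<lambda>z. if z \<in> ball 0 1 then g z else 0) \<in> H \<and> hn (\<lambda>z. if z \<in> ball 0 1 then g z else 0) \<le> 1"
     for n :: nat and g :: "complex ^ 'd \<Rightarrow> complex"
  have "\<exists>g. P n g" for n :: nat
  proof -
    obtain g where "continuous_on (cball 0 1) g" "\<And>z. z \<in> cball 0 1 \<Longrightarrow> Re (g z) \<ge> 0" "\<And>z. z \<in> E \<Longrightarrow> 4 ^ n \<le> Re (g z)"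
      "(\<lambda>z. if z \<in> ball 0 1 then g z else 0) \<in> H" "hn (\<lambda>z. if z \<in> ball 0 1 then g z else 0) \<le> 1"
      by (rule peak_potentialE[OF E False inf, of "4 ^ n"]) auto
    then show ?thesis unfolding P_def by blast
  qed
  then obtain g where gP: "\<And>n. P n (g n)" by metis
  have g: "\<And>n::nat. continuous_on (cball 0 1) (g n)" "\<And>n z. z \<in> cball 0 1 \<Longrightarrow> Re (g n z) \<ge> 0"
    "\<And>n z. z \<in> E \<Longrightarrow> 4 ^ n \<le> Re (g n z)"
    "\<And>n. (\<lambda>z. if z \<in> ball 0 1 then g n z else 0) \<in> H" "\<And>n. hn (\<lambda>z. if z \<in> ball 0 1 then g n z else 0) \<le> 1"
    using gP unfolding P_def by blast+
  define h where "h n = (\<lambda>z. if z \<in> ball 0 1 then g n z else 0)" for n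
  have h: "h n \<in> H" "hn (h n) \<le> 1" for n using g(4,5) by (auto simp: h_def)
  define q where "q i = complex_of_real ((1/2) ^ i)" for i
  define F where "F N = (\<lambda>z. \<Sum>i<N. q i * h i z)" for N
  have Fm: "F N \<in> H" for N unfolding F_def by (intro sum_mem h)
  have diff: "hn (\<lambda>z. F M z - F N z) \<le> 2 * (1/2) ^ N" if "N \<le> M" for M N
  proof -
    have "(\<lambda>z. F M z - F N z) = (\<lambda>z. \<Sum>i\<in>{N..<M}. q i * h i z)"
      unfolding F_def lessThan_atLeast0 using that by (subst sum_diff_nat_ivl) auto
    then have "hn (\<lambda>z. F M z - F N z) \<le> (\<Sum>i\<in>{N..<M}. cmod (q i) * hn (h i))"
      using hn_sum_le[of "{N..<M}" h q] h by simp
    also have "\<dots> \<le> (\<Sum>i\<in>{N..<M}. (1/2) ^ i * 1)"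
      using h by (intro sum_mono mult_mono) (auto simp: q_def norm_power hn_nonneg)
    also have "\<dots> = 2 * (1/2) ^ N - 2 * (1/2) ^ M"
      using that by (induction M rule: dec_induct) auto
    finally show ?thesis by (smt (verit) zero_le_power divide_nonneg_nonneg)
  qed
  have "\<forall>e>0. \<exists>N. \<forall>m\<ge>N. \<forall>n\<ge>N. hn (\<lambda>x. F m x - F n x) < e"
  proof (intro allI impI)
    fix e :: real assume e: "e > 0"
    then obtain N where N: "(1/2) ^ N < e / 2" using real_arch_pow_inv[of "e/2" "1/2"] by auto
    have small: "hn (\<lambda>x. F m x - F n x) < e" if "n \<ge> N" "m \<ge> n" for m n
    proof -
      have "(1/2 :: real) ^ n \<le> (1/2) ^ N" using that by (intro power_decreasing) auto
      then show ?thesis using diff[OF that(2)] N by linarith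
    qed
    have "hn (\<lambda>x. F m x - F n x) < e" if "m \<ge> N" "n \<ge> N" for m n
      using small[of n m] small[of m n] that hn_diff_commute[OF Fm Fm, of m n] by (cases "n \<le> m") auto
    then show "\<exists>N. \<forall>m\<ge>N. \<forall>n\<ge>N. hn (\<lambda>x. F m x - F n x) < e" by (intro exI[of _ N]) simp
  qed
  from complete[OF Fm this] obtain f where f: "f \<in> H" "(\<lambda>n. hn (\<lambda>x. F n x - f x)) \<longlonglongrightarrow> 0" ..
  have lower: "(1/2) ^ n * Re (g n z) \<le> Re (f z)" if z: "z \<in> ball 0 1" for n z
  proof (rule LIMSEQ_le_const)
    have "(\<lambda>N. F N z) \<longlonglongrightarrow> f z"
      using ip_tendsto(2)[OF Fm f kf_mem[OF z]] unfolding ip_kf[OF Fm z] ip_kf[OF f(1) z] .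
    then show "(\<lambda>N. Re (F N z)) \<longlonglongrightarrow> Re (f z)" by (rule tendsto_Re)
    have "(1/2) ^ n * Re (g n z) \<le> Re (F N z)" if "N \<ge> Suc n" for N
    proof -
      have "(\<Sum>i\<in>{n}. (1/2) ^ i * Re (g i z)) \<le> (\<Sum>i<N. (1/2) ^ i * Re (g i z))"
        using that z g(2)[of z] by (intro sum_mono2) auto
      moreover have "Re (F N z) = (\<Sum>i<N. (1/2) ^ i * Re (g i z))"
        unfolding F_def Re_sum q_def h_def using z by (intro sum.cong refl) simp
      ultimately show ?thesis by simp
    qed
    then show "\<exists>N. \<forall>m\<ge>N. (1/2) ^ n * Re (g n z) \<le> Re (F m z)" by blast
  qed
  have "filterlim (\<lambda>r. cmod (f (r *\<^sub>R \<zeta>))) at_top (at_left 1)" if \<zeta>: "\<zeta> \<in> E" for \<zeta>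
    unfolding filterlim_at_top
  proof
    fix Z :: real
    \<comment> \<open>By continuity the real part of \<open>g n\<close> exceeds
      \<open>4 ^ n - 1\<close> near \<open>\<zeta>\<close>; after weighting this is at least
      \<open>2 ^ n - 1\<close>, hence more than \<open>Z\<close>.\<close>
    obtain n where n: "Z + 1 < 2 ^ n" using real_arch_pow[of 2 "Z + 1"] by auto
    have \<zeta>1: "norm \<zeta> = 1" using \<zeta> E by auto
    have "continuous_on {0..1} (\<lambda>r. Re (g n (r *\<^sub>R \<zeta>)))"
      by (intro continuous_intros continuous_on_compose2[OF g(1)[of n]]) (use \<zeta>1 in auto)
    then have "((\<lambda>r. Re (g n (r *\<^sub>R \<zeta>))) \<longlongrightarrow> Re (g n (1 *\<^sub>R \<zeta>))) (at 1 within {0..1})"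
      unfolding continuous_on_def by (rule bspec) simp
    moreover have "Re (g n (1 *\<^sub>R \<zeta>)) > 4 ^ n - 1" using g(3)[OF \<zeta>, of n] by simp
    ultimately have "\<forall>\<^sub>F r in at 1 within {0..1}. 4 ^ n - 1 < Re (g n (r *\<^sub>R \<zeta>))"
      by (rule order_tendstoD(1))
    then have "\<forall>\<^sub>F r in at_left 1. 4 ^ n - 1 < Re (g n (r *\<^sub>R \<zeta>))"
      by (simp add: at_within_Icc_at_left)
    moreover have "\<forall>\<^sub>F r in at_left (1::real). 0 < r \<and> r < 1"
      by (rule eventually_at_leftI[of 0]) auto
    ultimately show "\<forall>\<^sub>F r in at_left 1. Z \<le> cmod (f (r *\<^sub>R \<zeta>))"
    proof eventually_elim
      case (elim r)
      have "r *\<^sub>R \<zeta> \<in> ball 0 1" using elim \<zeta>1 by simp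
      then have "(1/2) ^ n * Re (g n (r *\<^sub>R \<zeta>)) \<le> Re (f (r *\<^sub>R \<zeta>))" by (rule lower)
      moreover have "(1/2) ^ n * (4 ^ n - 1) \<le> (1/2) ^ n * Re (g n (r *\<^sub>R \<zeta>))"
        using elim by (intro mult_left_mono) auto
      moreover have "(1/2 :: real) ^ n * (4 ^ n - 1) = 2 ^ n - (1/2) ^ n"
        by (simp add: right_diff_distrib power_mult_distrib[symmetric])
      moreover have "(1/2 :: real) ^ n \<le> 1" by (simp add: power_le_one)
      ultimately have "Z \<le> Re (f (r *\<^sub>R \<zeta>))" using n by linarith
      then show ?case using complex_Re_le_cmod order_trans by blast
    qed
  qed
  then show ?thesis using f(1) by (auto simp: unboundedness_set_def)
qed

lemma infinite_energy_imp_null_compact: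
  fixes A :: "(complex ^ 'd) set"
  assumes A: "compact A" "A \<subseteq> sphere 0 1" and inf: "infinite_energy_set A" and \<nu>: "henkin_measure H ip \<nu>"
  shows "\<nu> A = 0"
proof (cases "A = {}")
  case True
  have cm: "complex_measure borel_sphere \<nu>" using \<nu> by (simp add: henkin_measure_def)
  then show ?thesis
    using signed_measure.rho_empty[OF complex_measure_signed(1)[OF cm]] signed_measure.rho_empty[OF complex_measure_signed(2)[OF cm]] True
    by (simp add: complex_eq_iff)
next
  case False
  \<comment> \<open>The bound 3 is 2 for \<open>1 - 1 / (1 + g)\<close> plus at most 1 for the error
    of the polynomial approximation.\<close>
  define P where "P n p g \<longleftrightarrow> polynomial_fun p \<and> mult_bound p 3 \<and> continuous_on (cball 0 1) g \<and> (\<forall>z\<in>cball 0 1. Re (g z) \<ge> 0) \<and>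
      (\<forall>z\<in>A. real (Suc n) \<le> Re (g z)) \<and>
      (\<forall>z\<in>cball 0 1. \<forall>\<delta>. 0 < \<delta> \<longrightarrow> \<delta> \<le> 1 \<longrightarrow> (\<forall>w\<in>A. \<delta> \<le> 1 - Re (cinner_prod z w)) \<longrightarrow> cmod (g z) \<le> 1 / (real (Suc n) * (a 1 * \<delta>))) \<and>
      (\<forall>z\<in>ball 0 1. cmod (1 - 1 / (1 + g z) - p z) \<le> 1 / real (Suc n))"
      for n :: nat and p g :: "complex ^ 'd \<Rightarrow> complex"
  have "\<exists>p g. P n p g" for n :: nat
  proof -
    obtain g where g: "continuous_on (cball 0 1) g" "\<And>z. z \<in> cball 0 1 \<Longrightarrow> Re (g z) \<ge> 0" "\<And>z. z \<in> A \<Longrightarrow> real (Suc n) \<le> Re (g z)"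
      "\<And>z \<delta>. z \<in> cball 0 1 \<Longrightarrow> 0 < \<delta> \<Longrightarrow> \<delta> \<le> 1 \<Longrightarrow> (\<And>w. w \<in> A \<Longrightarrow> \<delta> \<le> 1 - Re (cinner_prod z w)) \<Longrightarrow> cmod (g z) \<le> 1 / (real (Suc n) * (a 1 * \<delta>))"
      "approximable g" "psd_kernel (ball 0 1) (\<lambda>z w. K z w * (g z + cnj (g w)))"
      by (rule peak_potentialE[OF A False inf, of "real (Suc n)"]) auto
    have inv: "approximable (\<lambda>z. 1 / (1 + g z))" "mult_bound (\<lambda>z. 1 / (1 + g z)) 1"
      using approximable_accretive_inverse[OF g(5,6)] g(2) by auto
    have "approximable (\<lambda>z. 1 + (-1) * (1 / (1 + g z)))"
      by (intro approximable_add approximable_mult approximable_const inv)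
    then have ap: "approximable (\<lambda>z. 1 - 1 / (1 + g z))" by simp
    have m2: "mult_bound (\<lambda>z. 1 - 1 / (1 + g z)) (1 + 1)"
      using mult_bound_diff[OF mult_bound_const[of 1] inv(2)] by simp
    obtain p where p: "polynomial_fun p" "mult_bound (\<lambda>z. 1 - 1 / (1 + g z) - p z) (1 / real (Suc n))"
      using ap unfolding approximable_def by (meson of_nat_0_less_iff zero_less_Suc zero_less_divide_1_iff)
    have "mult_bound (\<lambda>z. 1 - 1 / (1 + g z) - (1 - 1 / (1 + g z) - p z)) (1 + 1 + 1 / real (Suc n))"
      by (rule mult_bound_diff[OF m2 p(2)])
    then have "mult_bound p (1 + 1 + 1 / real (Suc n))" by simp
    then have "mult_bound p 3" by (rule mult_bound_mono) simp
    moreover have "cmod (1 - 1 / (1 + g z) - p z) \<le> 1 / real (Suc n)" if "z \<in> ball 0 1" for z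
      using mult_bound_pointwise[OF p(2) that K_nonzero[OF that that]] .
    ultimately show ?thesis using p(1) g(1-4) unfolding P_def by blast
  qed
  then obtain p g where pP: "\<And>n. P n (p n) (g n)" by metis
  have p: "\<And>n. polynomial_fun (p n)" "\<And>n. mult_bound (p n) 3"
    and g: "\<And>n. continuous_on (cball 0 1) (g n)" "\<And>n z. z \<in> cball 0 1 \<Longrightarrow> Re (g n z) \<ge> 0"
      "\<And>n z. z \<in> A \<Longrightarrow> real (Suc n) \<le> Re (g n z)"
      "\<And>n z \<delta>. z \<in> cball 0 1 \<Longrightarrow> 0 < \<delta> \<Longrightarrow> \<delta> \<le> 1 \<Longrightarrow> \<forall>w\<in>A. \<delta> \<le> 1 - Re (cinner_prod z w) \<Longrightarrow> cmod (g n z) \<le> 1 / (real (Suc n) * (a 1 * \<delta>))"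
    and pg: "\<And>n z. z \<in> ball 0 1 \<Longrightarrow> cmod (1 - 1 / (1 + g n z) - p n z) \<le> 1 / real (Suc n)"
    using pP unfolding P_def by blast+
  have ne: "1 + g n z \<noteq> 0" if "z \<in> cball 0 1" for n z
  proof
    assume "1 + g n z = 0"
    then have "Re (1 + g n z) = 0" by simp
    then show False using g(2)[OF that, of n] by simp
  qed
  have cb: "closure (ball 0 1) = cball (0 :: complex ^ 'd) 1" by simp
  \<comment> \<open>Multiplier bounds control values only in the open ball; continuity carries the
    estimate to the sphere, where the measure lives.\<close>
  have pg': "cmod (1 - 1 / (1 + g n z) - p n z) \<le> 1 / real (Suc n)" if "z \<in> cball 0 1" for n z
  proof (rule continuous_le_on_closure[of "ball 0 1" "\<lambda>z. cmod (1 - 1 / (1 + g n z) - p n z)"])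
    show "continuous_on (closure (ball 0 1)) (\<lambda>z. cmod (1 - 1 / (1 + g n z) - p n z))"
      unfolding cb by (intro continuous_intros g(1) continuous_on_polynomial_fun p(1)) (use ne in blast)
    show "z \<in> closure (ball 0 1)" unfolding cb by fact
  qed (rule pg)
  have p3: "cmod (p n z) \<le> 3" if "z \<in> cball 0 1" for n z
  proof (rule continuous_le_on_closure[of "ball 0 1" "\<lambda>z. cmod (p n z)"])
    show "continuous_on (closure (ball 0 1)) (\<lambda>z. cmod (p n z))"
      by (intro continuous_intros continuous_on_polynomial_fun p(1))
    show "z \<in> closure (ball 0 1)" unfolding cb by fact
    show "cmod (p n z) \<le> 3" if "z \<in> ball 0 1" for z
      using mult_bound_pointwise[OF p(2) that K_nonzero[OF that that]] .
  qed
  have invn: "(\<lambda>n. 1 / real (Suc n)) \<longlonglongrightarrow> 0"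
    using LIMSEQ_inverse_real_of_nat by (simp add: inverse_eq_divide)
  have lim: "(\<lambda>n. p n z) \<longlonglongrightarrow> indicator A z" if z: "z \<in> cball 0 1" for z
  proof -
    have "(\<lambda>n. 1 - 1 / (1 + g n z) - p n z) \<longlonglongrightarrow> 0"
      by (rule Lim_null_comparison[OF always_eventually invn]) (use pg'[OF z] in auto)
    moreover have "(\<lambda>n. 1 - 1 / (1 + g n z)) \<longlonglongrightarrow> indicator A z"
    proof (cases "z \<in> A")
      case True
      have "cmod (1 / (1 + g n z)) \<le> 1 / real (Suc n)" for n
      proof -
        have "real (Suc n) \<le> Re (1 + g n z)" using g(3)[OF True, of n] by simp
        also have "\<dots> \<le> cmod (1 + g n z)" by (rule complex_Re_le_cmod)
        finally show ?thesis unfolding norm_divide norm_one by (intro frac_le) auto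
      qed
      then have "(\<lambda>n. 1 / (1 + g n z)) \<longlonglongrightarrow> 0"
        by (intro Lim_null_comparison[OF always_eventually invn]) auto
      then have "(\<lambda>n. 1 - 1 / (1 + g n z)) \<longlonglongrightarrow> 1 - 0" by (intro tendsto_intros)
      then show ?thesis using True by simp
    next
      case False
      define d where "d = infdist z A"
      have d: "d > 0" unfolding d_def
        using infdist_pos_not_in_closed[OF compact_imp_closed[OF A(1)] \<open>A \<noteq> {}\<close> False] .
      \<comment> \<open>In the closed ball \<open>norm_diff_cinner_prod\<close> gives
        \<open>(norm (z - w))\<^sup>2 \<le> 2 * (1 - Re (cinner_prod z w))\<close>, so the distance
        \<open>d\<close> yields the gap \<open>d\<^sup>2 / 2\<close>.\<close>
      define \<delta> where "\<delta> = min 1 (d\<^sup>2 / 2)"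
      have \<delta>: "0 < \<delta>" "\<delta> \<le> 1" using d by (auto simp: \<delta>_def)
      have "\<delta> \<le> 1 - Re (cinner_prod z w)" if w: "w \<in> A" for w
      proof -
        have "d \<le> norm (z - w)" unfolding d_def using infdist_le[OF w, of z] by (simp add: dist_norm)
        then have "d\<^sup>2 \<le> (norm (z - w))\<^sup>2" using d by (intro power_mono) auto
        also have "\<dots> = (norm z)\<^sup>2 + (norm w)\<^sup>2 - 2 * Re (cinner_prod z w)" by (rule norm_diff_cinner_prod)
        also have "\<dots> \<le> 1 + 1 - 2 * Re (cinner_prod z w)"
        proof -
          have "(norm z)\<^sup>2 \<le> 1" using z by (simp add: power_le_one)
          moreover have "(norm w)\<^sup>2 = 1" using w A(2) by auto
          ultimately show ?thesis by simp
        qed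
        finally have "d\<^sup>2 / 2 \<le> 1 - Re (cinner_prod z w)" by simp
        then show ?thesis by (simp add: \<delta>_def)
      qed
      then have gb: "cmod (g n z) \<le> 1 / real (Suc n) * (1 / (a 1 * \<delta>))" for n
        using g(4)[OF z \<delta>, of n] by (simp add: divide_simps)
      have "(\<lambda>n. 1 / real (Suc n) * (1 / (a 1 * \<delta>))) \<longlonglongrightarrow> 0 * (1 / (a 1 * \<delta>))"
        by (intro tendsto_intros invn)
      then have "(\<lambda>n. 1 / real (Suc n) * (1 / (a 1 * \<delta>))) \<longlonglongrightarrow> 0" by simp
      then have "(\<lambda>n. g n z) \<longlonglongrightarrow> 0"
        by (rule Lim_null_comparison[OF always_eventually, rotated]) (use gb in auto)
      then have "(\<lambda>n. 1 - 1 / (1 + g n z)) \<longlonglongrightarrow> 1 - 1 / (1 + 0)"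
        by (intro tendsto_intros) simp_all
      then show ?thesis using False by simp
    qed
    ultimately have "(\<lambda>n. (1 - 1 / (1 + g n z)) - (1 - 1 / (1 + g n z) - p n z)) \<longlonglongrightarrow> indicator A z - 0"
      by (intro tendsto_diff)
    then show ?thesis by simp
  qed
  have cm: "complex_measure borel_sphere \<nu>" using \<nu> by (simp add: henkin_measure_def)
  have Ab: "A \<in> sets (borel_sphere :: (complex ^ 'd) measure)"
    using A by (auto simp: sets_restrict_space_iff intro: borel_closed compact_imp_closed)
  have "(\<lambda>n. complex_measure_integral borel_sphere \<nu> (p n)) \<longlonglongrightarrow> \<nu> A"
  proof (rule complex_measure_integral_tendsto_indicator[OF cm Ab])
    show "p n \<in> borel_measurable borel_sphere" for n
      by (intro borel_measurable_continuous_on_restrict continuous_on_polynomial_fun p(1))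
    show "cmod (p n x) \<le> 3" if "x \<in> space borel_sphere" for n x
      using that by (intro p3) (simp add: space_restrict_space)
    show "(\<lambda>n. p n x) \<longlonglongrightarrow> indicator A x" if "x \<in> space borel_sphere" for x
      using that by (intro lim) (simp add: space_restrict_space)
  qed
  moreover have "(\<lambda>n. complex_measure_integral borel_sphere \<nu> (p n)) \<longlonglongrightarrow> 0"
  proof -
    have "(SUP n. mult_norm H ip (p n)) \<le> ennreal 3"
      using mult_bound_mult_norm[OF p(2)] by (intro SUP_least) auto
    then have "(SUP n. mult_norm H ip (p n)) < \<infinity>"
      by (rule le_less_trans) simp
    moreover have "(\<lambda>n. p n z) \<longlonglongrightarrow> 0" if "z \<in> ball 0 1" for z
    proof -
      have "z \<notin> A" using that A(2) by auto
      then show ?thesis using lim[of z] that by simp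
    qed
    ultimately show ?thesis using \<nu> p(1) unfolding henkin_measure_def by blast
  qed
  ultimately show ?thesis by (rule LIMSEQ_unique)
qed

lemma infinite_energy_imp_totally_null:
  fixes E :: "(complex ^ 'd) set"
  assumes E: "compact E" "E \<subseteq> sphere 0 1" and inf: "infinite_energy_set E"
  shows "totally_null H ip E"
  unfolding totally_null_def
proof (intro allI impI)
  fix \<nu> :: "(complex ^ 'd) set \<Rightarrow> complex" assume \<nu>: "henkin_measure H ip \<nu>"
  have cm: "complex_measure borel_sphere \<nu>" using \<nu> by (simp add: henkin_measure_def)
  have null: "\<nu> B = 0" if B: "B \<in> sets (borel_sphere :: (complex ^ 'd) measure)" "B \<subseteq> E" for B
  proof (rule complex_measure_null_if_compact_null[OF cm _ B])
    show "\<nu> K = 0" if "compact K" "K \<subseteq> E" for K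
      using that E by (intro infinite_energy_imp_null_compact[OF _ _ infinite_energy_subset[OF inf] \<nu>]) auto
  qed
  have "total_variation borel_sphere \<nu> E \<le> 0"
    unfolding total_variation_def
  proof (rule SUP_least)
    fix A :: "nat \<Rightarrow> (complex ^ 'd) set"
    assume A: "A \<in> {A. range A \<subseteq> sets borel_sphere \<and> disjoint_family A \<and> (\<Union>n. A n) = E}"
    then have "\<nu> (A n) = 0" for n by (intro null) auto
    then show "(\<Sum>n. ennreal (cmod (\<nu> (A n)))) \<le> 0" by simp
  qed
  then show "total_variation borel_sphere \<nu> E = 0" by simp
qed

text \<open>A probability measure on \<open>E\<close> of finite energy would be a Henkin measure
  whose total variation on \<open>E\<close> is at least 1, as the trivial partition of
  \<open>E\<close> shows.\<close>

lemma totally_null_imp_infinite_energy: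
  fixes E :: "(complex ^ 'd) set"
  assumes E: "compact E" "E \<subseteq> sphere 0 1" and tn: "totally_null H ip E"
  shows "infinite_energy_set E"
  unfolding infinite_energy_set_def
proof (intro allI impI, rule ccontr)
  fix \<mu> :: "(complex ^ 'd) measure"
  assume \<mu>: "prob_space \<mu>" "sets \<mu> = sets (borel_sphere :: (complex ^ 'd) measure)" "emeasure \<mu> (sphere 0 1 - E) = 0"
    and "energy a \<mu> \<noteq> \<infinity>"
  then have fin: "energy a \<mu> < \<infinity>" by (simp add: top.not_eq_extremum)
  interpret P: prob_space \<mu> by fact
  interpret cnp_sphere_measure a H ip \<mu> by unfold_locales (rule \<mu>(2))
  have "total_variation borel_sphere (\<lambda>A. complex_of_real (measure \<mu> A)) E = 0"
    using tn finite_energy_imp_henkin[OF fin] by (simp add: totally_null_def)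
  moreover have Eb: "E \<in> sets (borel_sphere :: (complex ^ 'd) measure)"
    using E by (auto simp: sets_restrict_space_iff intro: borel_closed compact_imp_closed)
  define A where "A n = (if n = 0 then E else {})" for n :: nat
  have "(\<Sum>n. ennreal (cmod (complex_of_real (measure \<mu> (A n))))) \<le> total_variation borel_sphere (\<lambda>A. complex_of_real (measure \<mu> A)) E"
  proof -
    have "A \<in> {A :: nat \<Rightarrow> (complex ^ 'd) set. range A \<subseteq> sets borel_sphere \<and> disjoint_family A \<and> (\<Union>n. A n) = E}"
    proof (intro CollectI conjI)
      show "range A \<subseteq> sets borel_sphere" using Eb by (auto simp: A_def)
      show "disjoint_family A" by (auto simp: A_def disjoint_family_on_def)
      show "(\<Union>n. A n) = E" by (auto simp: A_def)
    qed
    from SUP_upper[OF this, of "\<lambda>A. \<Sum>n. ennreal (cmod (complex_of_real (measure \<mu> (A n))))"]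
    show ?thesis unfolding total_variation_def .
  qed
  moreover have "f 0 \<le> suminf f" for f :: "nat \<Rightarrow> ennreal"
    using sum_le_suminf[of f "{0}"] by simp
  then have "ennreal (cmod (complex_of_real (measure \<mu> (A 0)))) \<le> (\<Sum>n. ennreal (cmod (complex_of_real (measure \<mu> (A n)))))" .
  moreover have "measure \<mu> (A 0) = 1"
  proof -
    have "measure \<mu> (space \<mu> - E) = 0" using \<mu>(3) by (simp add: space_\<mu> measure_def)
    then show ?thesis using P.prob_compl[of E] Eb \<mu>(2) by (simp add: A_def)
  qed
  ultimately have "ennreal (cmod (complex_of_real 1)) \<le> 0" by (simp only:)
  then show False by simp
qed

end

theorem theorem8p1:
  fixes a :: "nat \<Rightarrow> real"
    and H :: "(complex ^ 'd::finite \<Rightarrow> complex) set"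
    and ip :: "(complex ^ 'd \<Rightarrow> complex) \<Rightarrow> (complex ^ 'd \<Rightarrow> complex) \<Rightarrow> complex"
    and E :: "(complex ^ 'd) set"
  assumes "regular_unitarily_invariant_space a H ip"
    and "complete_pick_kernel (ball (0 :: complex ^ 'd) 1) (power_kernel a)"
    and "compact E"
    and "E \<subseteq> sphere 0 1"
  shows "(capacity a E = 0 \<longleftrightarrow> unboundedness_set H E) \<and>
         (unboundedness_set H E \<longleftrightarrow> totally_null H ip E)"
proof -
  interpret regular_unitarily_invariant_space a H ip by fact
  interpret cnp_space a H ip by unfold_locales fact
  have inv0: "1 / x = 0 \<longleftrightarrow> x = \<infinity>" for x :: ennreal
    by (simp add: ennreal_divide_eq_0_iff)
  have cap: "capacity a E = 0 \<longleftrightarrow> infinite_energy_set E"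
  proof -
    have "capacity a E = \<bottom> \<longleftrightarrow> (\<forall>\<mu>\<in>{\<mu>. prob_space \<mu> \<and> sets \<mu> = sets (borel_sphere :: (complex ^ 'd) measure) \<and> emeasure \<mu> (sphere 0 1 - E) = 0}. 1 / energy a \<mu> = \<bottom>)"
      unfolding capacity_def by (rule SUP_bot_conv(1))
    then show ?thesis unfolding bot_ennreal inv0 infinite_energy_set_def by blast
  qed
  have "infinite_energy_set E" if unb: "unboundedness_set H E"
    unfolding infinite_energy_set_def
  proof (intro allI impI)
    fix \<mu> :: "(complex ^ 'd) measure"
    assume \<mu>: "prob_space \<mu>" "sets \<mu> = sets (borel_sphere :: (complex ^ 'd) measure)" "emeasure \<mu> (sphere 0 1 - E) = 0"
    interpret P: prob_space \<mu> by fact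
    interpret cnp_sphere_measure a H ip \<mu> by unfold_locales (rule \<mu>(2))
    show "energy a \<mu> = \<infinity>" by (rule unbounded_imp_infinite_energy[OF assms(3) \<mu>(3) unb])
  qed
  \<comment> \<open>Infinite energy of every measure on \<open>E\<close> is the hub: each of the
    three properties is equivalent to it.\<close>
  then show ?thesis
    using cap infinite_energy_imp_unbounded[OF assms(3,4)] infinite_energy_imp_totally_null[OF assms(3,4)]
      totally_null_imp_infinite_energy[OF assms(3,4)] by blast
qed

end
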